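(* Suppose that $A$ is a unital $*$-algebra over $\mathbb C$ with a differential structure $(\Omega^1A,\mathrm d)$ such that $\Omega^1A$ is a star object in ${}_A\mathcal M_A$ and $\star\,\mathrm d=\overline{\mathrm d}\,\star:A\to\overline{\Omega^1A}$. Then the monoidal category ${}_A\mathcal E_A$ of bimodule covariant derivatives with invertible $\sigma$ is a bar category, with $\overline{(E,\nabla_E,\sigma_E)}=(\overline E,\nabla_{\overline E},\sigma_{\overline E})$ given by $$\nabla_{\overline E}(\overline e)=(\star^{-1}\otimes\mathrm{id})\,\Upsilon\,\overline{\sigma_E^{-1}\nabla_E(e)},\qquad \sigma_{\overline E}=(\star^{-1}\otimes\mathrm{id})\,\Upsilon\,\overline{\sigma_E^{-1}}\,\Upsilon^{-1}(\mathrm{id}\otimes\star),$$ the remaining data ($\overline\theta$ for morphisms $\theta$, $\Upsilon$, $\mathrm{bb}$, $\star:A\to\overline A$) being inherited from the bar category ${}_A\mathcal M_A$ of $A$-bimodules.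
   Context: **Differential structure:** $\Omega^1A$ is an $A$-bimodule with a derivation $\mathrm d:A\to\Omega^1A$ such that $\Omega^1A$ is spanned by elements $x\,\mathrm dy$ ($x,y\in A$). **The category ${}_A\mathcal E_A$:** objects are triples $(E,\nabla,\sigma)$ with $E$ an $A$-bimodule, $\nabla:E\to\Omega^1A\otimes_AE$ linear with $\nabla(a.e)=\mathrm da\otimes e+a.\nabla e$, and $\sigma:E\otimes_A\Omega^1A\to\Omega^1A\otimes_AE$ an invertible bimodule map with $\nabla(e.a)=\nabla(e).a+\sigma(e\otimes\mathrm da)$. Morphisms are bimodule maps $\theta:E\to F$ with $\nabla_F\theta=(\mathrm{id}\otimes\theta)\nabla_E$. Tensor product is $E\otimes_AF$ with $\nabla_{E\otimes F}=\nabla_E\otimes\mathrm{id}+(\sigma_E\otimes\mathrm{id})(\mathrm{id}\otimes\nabla_F)$, $\sigma_{E\otimes F}=(\sigma_E\otimes\mathrm{id})(\mathrm{id}\otimes\sigma_F)$; the unit is $(A,\mathrm d,\mathrm{id})$ (identifying $A\otimes_A\Omega^1A=\Omega^1A=\Omega^1A\otimes_AA$). **Bar category:** a monoidal category $(\mathcal C,\otimes,1)$ with a functor $X\mapsto\overline X$, $\theta\mapsto\overline\theta$ from $\mathcal C$ to $\mathcal C$, natural isomorphisms $\Upsilon_{X,Y}:\overline{X\otimes Y}\to\overline Y\otimes\overline X$ and $\mathrm{bb}_X:X\to\overline{\overline X}$, and an isomorphism $\star:1\to\overline1$, such that: $\Upsilon$ is coherent with the associator (the two induced maps $\overline{(X\otimes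 Y)\otimes Z}\to\overline Z\otimes(\overline Y\otimes\overline X)$ agree); $\Upsilon$ with $\star$ is coherent with the unit isomorphisms (e.g. $\overline{X\otimes 1}\to\overline1\otimes\overline X\to1\otimes\overline X\to\overline X$, via $\Upsilon$, $\star^{-1}\otimes\mathrm{id}$ and the unit isomorphism, equals the bar of the unit isomorphism $X\otimes 1\to X$, and likewise on the other side); $\overline\star\,\star=\mathrm{bb}_1$; and $\overline{\mathrm{bb}_X}=\mathrm{bb}_{\overline X}$. **The bar category ${}_A\mathcal M_A$:** for an $A$-bimodule $E$, $\overline E=\{\overline e:e\in E\}$ is the conjugate vector space with $a.\overline e=\overline{e.a^*}$, $\overline e.a=\overline{a^*.e}$; $\overline\theta(\overline e)=\overline{\theta(e)}$ (the same formula is used for $\overline{\mathrm d}$ etc.); $\Upsilon(\overline{e\otimes f})=\overline f\otimes\overline e$; $\mathrm{bb}_E(e)=\overline{\overline e}$; $\star:A\to\overline A$, $\star(a)=\overline{a^*}$. A star object is an object $E$ with a morphism $\star:E\to\overline E$, written $\star(e)=\overline{e^*}$, such that $\overline\star\star=\mathrm{bb}_E$. So the hypothesis on $\Omega^1A$ says that it has an antilinear involution with $(a.\mathrm db)^*=\mathrm d(b^* ).a^*$. *)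

theory Defs
  imports Complex_Main "HOL-Library.FuncSet" "HOL-Library.Infinite_Typeclass" "HOL-Algebra.Module"
begin

section \<open>Bar categories\<close>

text \<open>
  A category is given by its objects and its hom-sets. The hom-sets need not be disjoint, so
  composition and all constructions on morphisms take the objects involved as arguments:
  \<open>comp C X Y Z g f\<close> is the composite of \<open>f : X \<rightarrow> Y\<close> and \<open>g : Y \<rightarrow> Z\<close>, and
  \<open>tensor_mor C X X' Y Y' f g\<close> is \<open>f \<otimes> g\<close> for \<open>f : X \<rightarrow> X'\<close>, \<open>g : Y \<rightarrow> Y'\<close>.
\<close>

record ('o, 'm) category_data =
  Obj :: "'o set"
  Hom :: "'o \<Rightarrow> 'o \<Rightarrow> 'm set"
  ident :: "'o \<Rightarrow> 'm"
  comp :: "'o \<Rightarrow> 'o \<Rightarrow> 'o \<Rightarrow> 'm \<Rightarrow> 'm \<Rightarrow> 'm"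

record ('o, 'm) monoidal_data = "('o, 'm) category_data" +
  tensor_ob :: "'o \<Rightarrow> 'o \<Rightarrow> 'o"
  tensor_mor :: "'o \<Rightarrow> 'o \<Rightarrow> 'o \<Rightarrow> 'o \<Rightarrow> 'm \<Rightarrow> 'm \<Rightarrow> 'm"
  unit_ob :: 'o
  associator :: "'o \<Rightarrow> 'o \<Rightarrow> 'o \<Rightarrow> 'm"
  lunitor :: "'o \<Rightarrow> 'm"
  runitor :: "'o \<Rightarrow> 'm"

record ('o, 'm) bar_data = "('o, 'm) monoidal_data" +
  bar_ob :: "'o \<Rightarrow> 'o"
  bar_mor :: "'o \<Rightarrow> 'o \<Rightarrow> 'm \<Rightarrow> 'm"
  Upsilon :: "'o \<Rightarrow> 'o \<Rightarrow> 'm"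
  bb :: "'o \<Rightarrow> 'm"
  unit_star :: 'm

definition is_inverse ::
    "('o, 'm, 'z) category_data_scheme \<Rightarrow> 'o \<Rightarrow> 'o \<Rightarrow> 'm \<Rightarrow> 'm \<Rightarrow> bool" where
  "is_inverse C X Y f g \<longleftrightarrow> f \<in> Hom C X Y \<and> g \<in> Hom C Y X \<and>
     comp C X Y X g f = ident C X \<and> comp C Y X Y f g = ident C Y"

definition is_iso :: "('o, 'm, 'z) category_data_scheme \<Rightarrow> 'o \<Rightarrow> 'o \<Rightarrow> 'm \<Rightarrow> bool" where
  "is_iso C X Y f \<longleftrightarrow> (\<exists>g. is_inverse C X Y f g)"

definition inverse_mor :: "('o, 'm, 'z) category_data_scheme \<Rightarrow> 'o \<Rightarrow> 'o \<Rightarrow> 'm \<Rightarrow> 'm" where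
  "inverse_mor C X Y f = (THE g. is_inverse C X Y f g)"

locale category =
  fixes C :: "('o, 'm, 'z) category_data_scheme"
  assumes ident_hom: "X \<in> Obj C \<Longrightarrow> ident C X \<in> Hom C X X"
    and comp_hom: "\<lbrakk>X \<in> Obj C; Y \<in> Obj C; Z \<in> Obj C; f \<in> Hom C X Y; g \<in> Hom C Y Z\<rbrakk>
      \<Longrightarrow> comp C X Y Z g f \<in> Hom C X Z"
    and comp_ident_left: "\<lbrakk>X \<in> Obj C; Y \<in> Obj C; f \<in> Hom C X Y\<rbrakk>
      \<Longrightarrow> comp C X Y Y (ident C Y) f = f"
    and comp_ident_right: "\<lbrakk>X \<in> Obj C; Y \<in> Obj C; f \<in> Hom C X Y\<rbrakk>
      \<Longrightarrow> comp C X X Y f (ident C X) = f"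
    and comp_assoc: "\<lbrakk>W \<in> Obj C; X \<in> Obj C; Y \<in> Obj C; Z \<in> Obj C;
        f \<in> Hom C W X; g \<in> Hom C X Y; h \<in> Hom C Y Z\<rbrakk>
      \<Longrightarrow> comp C W Y Z h (comp C W X Y g f) = comp C W X Z (comp C X Y Z h g) f"

locale monoidal_category = category C
  for C :: "('o, 'm, 'z) monoidal_data_scheme" +
  assumes tensor_obj: "\<lbrakk>X \<in> Obj C; Y \<in> Obj C\<rbrakk> \<Longrightarrow> tensor_ob C X Y \<in> Obj C"
    and tensor_hom: "\<lbrakk>X \<in> Obj C; X' \<in> Obj C; Y \<in> Obj C; Y' \<in> Obj C;
        f \<in> Hom C X X'; g \<in> Hom C Y Y'\<rbrakk>
      \<Longrightarrow> tensor_mor C X X' Y Y' f g \<in> Hom C (tensor_ob C X Y) (tensor_ob C X' Y')"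
    and tensor_ident: "\<lbrakk>X \<in> Obj C; Y \<in> Obj C\<rbrakk>
      \<Longrightarrow> tensor_mor C X X Y Y (ident C X) (ident C Y) = ident C (tensor_ob C X Y)"
    and tensor_comp: "\<lbrakk>X \<in> Obj C; X' \<in> Obj C; X'' \<in> Obj C; Y \<in> Obj C; Y' \<in> Obj C; Y'' \<in> Obj C;
        f \<in> Hom C X X'; f' \<in> Hom C X' X''; g \<in> Hom C Y Y'; g' \<in> Hom C Y' Y''\<rbrakk>
      \<Longrightarrow> tensor_mor C X X'' Y Y'' (comp C X X' X'' f' f) (comp C Y Y' Y'' g' g)
        = comp C (tensor_ob C X Y) (tensor_ob C X' Y') (tensor_ob C X'' Y'')
            (tensor_mor C X' X'' Y' Y'' f' g') (tensor_mor C X X' Y Y' f g)"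
    and unit_obj: "unit_ob C \<in> Obj C"
    and associator_iso: "\<lbrakk>X \<in> Obj C; Y \<in> Obj C; Z \<in> Obj C\<rbrakk>
      \<Longrightarrow> is_iso C (tensor_ob C (tensor_ob C X Y) Z) (tensor_ob C X (tensor_ob C Y Z))
            (associator C X Y Z)"
    and lunitor_iso: "X \<in> Obj C \<Longrightarrow> is_iso C (tensor_ob C (unit_ob C) X) X (lunitor C X)"
    and runitor_iso: "X \<in> Obj C \<Longrightarrow> is_iso C (tensor_ob C X (unit_ob C)) X (runitor C X)"
    and associator_natural: "\<lbrakk>X \<in> Obj C; X' \<in> Obj C; Y \<in> Obj C; Y' \<in> Obj C; Z \<in> Obj C; Z' \<in> Obj C;
        f \<in> Hom C X X'; g \<in> Hom C Y Y'; h \<in> Hom C Z Z'\<rbrakk>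
      \<Longrightarrow> comp C (tensor_ob C (tensor_ob C X Y) Z) (tensor_ob C (tensor_ob C X' Y') Z')
            (tensor_ob C X' (tensor_ob C Y' Z'))
            (associator C X' Y' Z')
            (tensor_mor C (tensor_ob C X Y) (tensor_ob C X' Y') Z Z' (tensor_mor C X X' Y Y' f g) h)
        = comp C (tensor_ob C (tensor_ob C X Y) Z) (tensor_ob C X (tensor_ob C Y Z))
            (tensor_ob C X' (tensor_ob C Y' Z'))
            (tensor_mor C X X' (tensor_ob C Y Z) (tensor_ob C Y' Z') f (tensor_mor C Y Y' Z Z' g h))
            (associator C X Y Z)"
    and lunitor_natural: "\<lbrakk>X \<in> Obj C; X' \<in> Obj C; f \<in> Hom C X X'\<rbrakk>
      \<Longrightarrow> comp C (tensor_ob C (unit_ob C) X) (tensor_ob C (unit_ob C) X') X' (lunitor C X')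
            (tensor_mor C (unit_ob C) (unit_ob C) X X' (ident C (unit_ob C)) f)
        = comp C (tensor_ob C (unit_ob C) X) X X' f (lunitor C X)"
    and runitor_natural: "\<lbrakk>X \<in> Obj C; X' \<in> Obj C; f \<in> Hom C X X'\<rbrakk>
      \<Longrightarrow> comp C (tensor_ob C X (unit_ob C)) (tensor_ob C X' (unit_ob C)) X' (runitor C X')
            (tensor_mor C X X' (unit_ob C) (unit_ob C) f (ident C (unit_ob C)))
        = comp C (tensor_ob C X (unit_ob C)) X X' f (runitor C X)"
    and pentagon: "\<lbrakk>W \<in> Obj C; X \<in> Obj C; Y \<in> Obj C; Z \<in> Obj C\<rbrakk>
      \<Longrightarrow> comp C (tensor_ob C (tensor_ob C (tensor_ob C W X) Y) Z)
            (tensor_ob C (tensor_ob C W X) (tensor_ob C Y Z))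
            (tensor_ob C W (tensor_ob C X (tensor_ob C Y Z)))
            (associator C W X (tensor_ob C Y Z)) (associator C (tensor_ob C W X) Y Z)
        = comp C (tensor_ob C (tensor_ob C (tensor_ob C W X) Y) Z)
            (tensor_ob C W (tensor_ob C (tensor_ob C X Y) Z))
            (tensor_ob C W (tensor_ob C X (tensor_ob C Y Z)))
            (tensor_mor C W W (tensor_ob C (tensor_ob C X Y) Z) (tensor_ob C X (tensor_ob C Y Z))
              (ident C W) (associator C X Y Z))
            (comp C (tensor_ob C (tensor_ob C (tensor_ob C W X) Y) Z)
              (tensor_ob C (tensor_ob C W (tensor_ob C X Y)) Z)
              (tensor_ob C W (tensor_ob C (tensor_ob C X Y) Z))
              (associator C W (tensor_ob C X Y) Z)
              (tensor_mor C (tensor_ob C (tensor_ob C W X) Y) (tensor_ob C W (tensor_ob C X Y)) Z Z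
                (associator C W X Y) (ident C Z)))"
    and triangle: "\<lbrakk>X \<in> Obj C; Y \<in> Obj C\<rbrakk>
      \<Longrightarrow> comp C (tensor_ob C (tensor_ob C X (unit_ob C)) Y) (tensor_ob C X (tensor_ob C (unit_ob C) Y))
            (tensor_ob C X Y)
            (tensor_mor C X X (tensor_ob C (unit_ob C) Y) Y (ident C X) (lunitor C Y))
            (associator C X (unit_ob C) Y)
        = tensor_mor C (tensor_ob C X (unit_ob C)) X Y Y (runitor C X) (ident C Y)"

locale bar_category = monoidal_category C
  for C :: "('o, 'm, 'z) bar_data_scheme" +
  assumes bar_obj: "X \<in> Obj C \<Longrightarrow> bar_ob C X \<in> Obj C"
    and bar_hom: "\<lbrakk>X \<in> Obj C; Y \<in> Obj C; f \<in> Hom C X Y\<rbrakk>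
      \<Longrightarrow> bar_mor C X Y f \<in> Hom C (bar_ob C X) (bar_ob C Y)"
    and bar_ident: "X \<in> Obj C \<Longrightarrow> bar_mor C X X (ident C X) = ident C (bar_ob C X)"
    and bar_comp: "\<lbrakk>X \<in> Obj C; Y \<in> Obj C; Z \<in> Obj C; f \<in> Hom C X Y; g \<in> Hom C Y Z\<rbrakk>
      \<Longrightarrow> bar_mor C X Z (comp C X Y Z g f)
        = comp C (bar_ob C X) (bar_ob C Y) (bar_ob C Z) (bar_mor C Y Z g) (bar_mor C X Y f)"
    and Upsilon_iso: "\<lbrakk>X \<in> Obj C; Y \<in> Obj C\<rbrakk>
      \<Longrightarrow> is_iso C (bar_ob C (tensor_ob C X Y)) (tensor_ob C (bar_ob C Y) (bar_ob C X))
            (Upsilon C X Y)"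
    and Upsilon_natural: "\<lbrakk>X \<in> Obj C; X' \<in> Obj C; Y \<in> Obj C; Y' \<in> Obj C;
        f \<in> Hom C X X'; g \<in> Hom C Y Y'\<rbrakk>
      \<Longrightarrow> comp C (bar_ob C (tensor_ob C X Y)) (bar_ob C (tensor_ob C X' Y'))
            (tensor_ob C (bar_ob C Y') (bar_ob C X'))
            (Upsilon C X' Y')
            (bar_mor C (tensor_ob C X Y) (tensor_ob C X' Y') (tensor_mor C X X' Y Y' f g))
        = comp C (bar_ob C (tensor_ob C X Y)) (tensor_ob C (bar_ob C Y) (bar_ob C X))
            (tensor_ob C (bar_ob C Y') (bar_ob C X'))
            (tensor_mor C (bar_ob C Y) (bar_ob C Y') (bar_ob C X) (bar_ob C X')
              (bar_mor C Y Y' g) (bar_mor C X X' f))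
            (Upsilon C X Y)"
    and bb_iso: "X \<in> Obj C \<Longrightarrow> is_iso C X (bar_ob C (bar_ob C X)) (bb C X)"
    and bb_natural: "\<lbrakk>X \<in> Obj C; Y \<in> Obj C; f \<in> Hom C X Y\<rbrakk>
      \<Longrightarrow> comp C X Y (bar_ob C (bar_ob C Y)) (bb C Y) f
        = comp C X (bar_ob C (bar_ob C X)) (bar_ob C (bar_ob C Y))
            (bar_mor C (bar_ob C X) (bar_ob C Y) (bar_mor C X Y f)) (bb C X)"
    and unit_star_iso: "is_iso C (unit_ob C) (bar_ob C (unit_ob C)) (unit_star C)"
    and Upsilon_associator: "\<lbrakk>X \<in> Obj C; Y \<in> Obj C; Z \<in> Obj C\<rbrakk>
      \<Longrightarrow> comp C (bar_ob C (tensor_ob C (tensor_ob C X Y) Z))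
            (tensor_ob C (bar_ob C Z) (bar_ob C (tensor_ob C X Y)))
            (tensor_ob C (bar_ob C Z) (tensor_ob C (bar_ob C Y) (bar_ob C X)))
            (tensor_mor C (bar_ob C Z) (bar_ob C Z)
              (bar_ob C (tensor_ob C X Y)) (tensor_ob C (bar_ob C Y) (bar_ob C X))
              (ident C (bar_ob C Z)) (Upsilon C X Y))
            (Upsilon C (tensor_ob C X Y) Z)
        = comp C (bar_ob C (tensor_ob C (tensor_ob C X Y) Z))
            (tensor_ob C (tensor_ob C (bar_ob C Z) (bar_ob C Y)) (bar_ob C X))
            (tensor_ob C (bar_ob C Z) (tensor_ob C (bar_ob C Y) (bar_ob C X)))
            (associator C (bar_ob C Z) (bar_ob C Y) (bar_ob C X))
            (comp C (bar_ob C (tensor_ob C (tensor_ob C X Y) Z))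
              (tensor_ob C (bar_ob C (tensor_ob C Y Z)) (bar_ob C X))
              (tensor_ob C (tensor_ob C (bar_ob C Z) (bar_ob C Y)) (bar_ob C X))
              (tensor_mor C (bar_ob C (tensor_ob C Y Z)) (tensor_ob C (bar_ob C Z) (bar_ob C Y))
                (bar_ob C X) (bar_ob C X) (Upsilon C Y Z) (ident C (bar_ob C X)))
              (comp C (bar_ob C (tensor_ob C (tensor_ob C X Y) Z))
                (bar_ob C (tensor_ob C X (tensor_ob C Y Z)))
                (tensor_ob C (bar_ob C (tensor_ob C Y Z)) (bar_ob C X))
                (Upsilon C X (tensor_ob C Y Z))
                (bar_mor C (tensor_ob C (tensor_ob C X Y) Z) (tensor_ob C X (tensor_ob C Y Z))
                  (associator C X Y Z))))"
    and Upsilon_runitor: "X \<in> Obj C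
      \<Longrightarrow> comp C (bar_ob C (tensor_ob C X (unit_ob C))) (tensor_ob C (unit_ob C) (bar_ob C X))
            (bar_ob C X)
            (lunitor C (bar_ob C X))
            (comp C (bar_ob C (tensor_ob C X (unit_ob C)))
              (tensor_ob C (bar_ob C (unit_ob C)) (bar_ob C X))
              (tensor_ob C (unit_ob C) (bar_ob C X))
              (tensor_mor C (bar_ob C (unit_ob C)) (unit_ob C) (bar_ob C X) (bar_ob C X)
                (inverse_mor C (unit_ob C) (bar_ob C (unit_ob C)) (unit_star C))
                (ident C (bar_ob C X)))
              (Upsilon C X (unit_ob C)))
        = bar_mor C (tensor_ob C X (unit_ob C)) X (runitor C X)"
    and Upsilon_lunitor: "X \<in> Obj C
      \<Longrightarrow> comp C (bar_ob C (tensor_ob C (unit_ob C) X)) (tensor_ob C (bar_ob C X) (unit_ob C))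
            (bar_ob C X)
            (runitor C (bar_ob C X))
            (comp C (bar_ob C (tensor_ob C (unit_ob C) X))
              (tensor_ob C (bar_ob C X) (bar_ob C (unit_ob C)))
              (tensor_ob C (bar_ob C X) (unit_ob C))
              (tensor_mor C (bar_ob C X) (bar_ob C X) (bar_ob C (unit_ob C)) (unit_ob C)
                (ident C (bar_ob C X))
                (inverse_mor C (unit_ob C) (bar_ob C (unit_ob C)) (unit_star C)))
              (Upsilon C (unit_ob C) X))
        = bar_mor C (tensor_ob C (unit_ob C) X) X (lunitor C X)"
    and bar_unit_star: "comp C (unit_ob C) (bar_ob C (unit_ob C)) (bar_ob C (bar_ob C (unit_ob C)))
          (bar_mor C (unit_ob C) (bar_ob C (unit_ob C)) (unit_star C)) (unit_star C)
        = bb C (unit_ob C)"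
    and bar_bb: "X \<in> Obj C
      \<Longrightarrow> bar_mor C X (bar_ob C (bar_ob C X)) (bb C X) = bb C (bar_ob C X)"

definition star_object :: "('o, 'm, 'z) bar_data_scheme \<Rightarrow> 'o \<Rightarrow> 'm \<Rightarrow> bool" where
  "star_object C X s \<longleftrightarrow> X \<in> Obj C \<and> s \<in> Hom C X (bar_ob C X) \<and>
     comp C X (bar_ob C X) (bar_ob C (bar_ob C X)) (bar_mor C X (bar_ob C X) s) s = bb C X"


section \<open>Star algebras and bimodules\<close>

definition complex_field :: "complex ring" where
  "complex_field = \<lparr>carrier = UNIV, mult = (*), one = 1, zero = 0, add = (+)\<rparr>"

text \<open>
  All carriers are subsets of one type \<open>'u\<close>. The multiplication and unit of the record are those
  of the algebra; in a bimodule (as for any module in HOL-Algebra) these two fields are ignored.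
\<close>

record 'u star_alg = "(complex, 'u) module" +
  star :: "'u \<Rightarrow> 'u"

record 'u bimod = "(complex, 'u) module" +
  lact :: "'u \<Rightarrow> 'u \<Rightarrow> 'u"  (infixr \<open>\<rhd>\<index>\<close> 70)
  ract :: "'u \<Rightarrow> 'u \<Rightarrow> 'u"  (infixl \<open>\<lhd>\<index>\<close> 70)

locale star_algebra =
  fixes A :: "'u star_alg" (structure)
  assumes ring: "ring A"
    and vector_space: "module complex_field A"
    and smult_mult_left: "\<lbrakk>a \<in> carrier A; b \<in> carrier A\<rbrakk> \<Longrightarrow> (c \<odot> a) \<otimes> b = c \<odot> (a \<otimes> b)"
    and smult_mult_right: "\<lbrakk>a \<in> carrier A; b \<in> carrier A\<rbrakk> \<Longrightarrow> a \<otimes> (c \<odot> b) = c \<odot> (a \<otimes> b)"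
    and star_closed: "a \<in> carrier A \<Longrightarrow> star A a \<in> carrier A"
    and star_add: "\<lbrakk>a \<in> carrier A; b \<in> carrier A\<rbrakk> \<Longrightarrow> star A (a \<oplus> b) = star A a \<oplus> star A b"
    and star_smult: "a \<in> carrier A \<Longrightarrow> star A (c \<odot> a) = cnj c \<odot> star A a"
    and star_mult: "\<lbrakk>a \<in> carrier A; b \<in> carrier A\<rbrakk> \<Longrightarrow> star A (a \<otimes> b) = star A b \<otimes> star A a"
    and star_star: "a \<in> carrier A \<Longrightarrow> star A (star A a) = a"

locale bimodule =
  fixes A :: "'u star_alg" (structure) and E :: "'u bimod" (structure)
  assumes vector_space: "module complex_field E"
    and lact_closed: "\<lbrakk>a \<in> carrier A; e \<in> carrier E\<rbrakk> \<Longrightarrow> a \<rhd>\<^bsub>E\<^esub> e \<in> carrier E"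
    and lact_add_left: "\<lbrakk>a \<in> carrier A; b \<in> carrier A; e \<in> carrier E\<rbrakk>
      \<Longrightarrow> (a \<oplus> b) \<rhd>\<^bsub>E\<^esub> e = a \<rhd>\<^bsub>E\<^esub> e \<oplus>\<^bsub>E\<^esub> b \<rhd>\<^bsub>E\<^esub> e"
    and lact_add_right: "\<lbrakk>a \<in> carrier A; e \<in> carrier E; f \<in> carrier E\<rbrakk>
      \<Longrightarrow> a \<rhd>\<^bsub>E\<^esub> (e \<oplus>\<^bsub>E\<^esub> f) = a \<rhd>\<^bsub>E\<^esub> e \<oplus>\<^bsub>E\<^esub> a \<rhd>\<^bsub>E\<^esub> f"
    and lact_smult_left: "\<lbrakk>a \<in> carrier A; e \<in> carrier E\<rbrakk>
      \<Longrightarrow> (c \<odot> a) \<rhd>\<^bsub>E\<^esub> e = c \<odot>\<^bsub>E\<^esub> (a \<rhd>\<^bsub>E\<^esub> e)"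
    and lact_smult_right: "\<lbrakk>a \<in> carrier A; e \<in> carrier E\<rbrakk>
      \<Longrightarrow> a \<rhd>\<^bsub>E\<^esub> (c \<odot>\<^bsub>E\<^esub> e) = c \<odot>\<^bsub>E\<^esub> (a \<rhd>\<^bsub>E\<^esub> e)"
    and lact_mult: "\<lbrakk>a \<in> carrier A; b \<in> carrier A; e \<in> carrier E\<rbrakk>
      \<Longrightarrow> (a \<otimes> b) \<rhd>\<^bsub>E\<^esub> e = a \<rhd>\<^bsub>E\<^esub> (b \<rhd>\<^bsub>E\<^esub> e)"
    and lact_one: "e \<in> carrier E \<Longrightarrow> \<one> \<rhd>\<^bsub>E\<^esub> e = e"
    and ract_closed: "\<lbrakk>a \<in> carrier A; e \<in> carrier E\<rbrakk> \<Longrightarrow> e \<lhd>\<^bsub>E\<^esub> a \<in> carrier E"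
    and ract_add_right: "\<lbrakk>a \<in> carrier A; b \<in> carrier A; e \<in> carrier E\<rbrakk>
      \<Longrightarrow> e \<lhd>\<^bsub>E\<^esub> (a \<oplus> b) = (e \<lhd>\<^bsub>E\<^esub> a) \<oplus>\<^bsub>E\<^esub> (e \<lhd>\<^bsub>E\<^esub> b)"
    and ract_add_left: "\<lbrakk>a \<in> carrier A; e \<in> carrier E; f \<in> carrier E\<rbrakk>
      \<Longrightarrow> (e \<oplus>\<^bsub>E\<^esub> f) \<lhd>\<^bsub>E\<^esub> a = (e \<lhd>\<^bsub>E\<^esub> a) \<oplus>\<^bsub>E\<^esub> (f \<lhd>\<^bsub>E\<^esub> a)"
    and ract_smult_right: "\<lbrakk>a \<in> carrier A; e \<in> carrier E\<rbrakk>
      \<Longrightarrow> e \<lhd>\<^bsub>E\<^esub> (c \<odot> a) = c \<odot>\<^bsub>E\<^esub> (e \<lhd>\<^bsub>E\<^esub> a)"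
    and ract_smult_left: "\<lbrakk>a \<in> carrier A; e \<in> carrier E\<rbrakk>
      \<Longrightarrow> (c \<odot>\<^bsub>E\<^esub> e) \<lhd>\<^bsub>E\<^esub> a = c \<odot>\<^bsub>E\<^esub> (e \<lhd>\<^bsub>E\<^esub> a)"
    and ract_mult: "\<lbrakk>a \<in> carrier A; b \<in> carrier A; e \<in> carrier E\<rbrakk>
      \<Longrightarrow> e \<lhd>\<^bsub>E\<^esub> (a \<otimes> b) = (e \<lhd>\<^bsub>E\<^esub> a) \<lhd>\<^bsub>E\<^esub> b"
    and ract_one: "e \<in> carrier E \<Longrightarrow> e \<lhd>\<^bsub>E\<^esub> \<one> = e"
    and lact_ract: "\<lbrakk>a \<in> carrier A; b \<in> carrier A; e \<in> carrier E\<rbrakk>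
      \<Longrightarrow> (a \<rhd>\<^bsub>E\<^esub> e) \<lhd>\<^bsub>E\<^esub> b = a \<rhd>\<^bsub>E\<^esub> (e \<lhd>\<^bsub>E\<^esub> b)"

definition bimod_hom :: "'u star_alg \<Rightarrow> 'u bimod \<Rightarrow> 'u bimod \<Rightarrow> ('u \<Rightarrow> 'u) set" where
  "bimod_hom A E F = {\<theta> \<in> carrier E \<rightarrow>\<^sub>E carrier F.
     (\<forall>e\<in>carrier E. \<forall>e'\<in>carrier E. \<theta> (e \<oplus>\<^bsub>E\<^esub> e') = \<theta> e \<oplus>\<^bsub>F\<^esub> \<theta> e') \<and>
     (\<forall>c. \<forall>e\<in>carrier E. \<theta> (c \<odot>\<^bsub>E\<^esub> e) = c \<odot>\<^bsub>F\<^esub> \<theta> e) \<and>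
     (\<forall>a\<in>carrier A. \<forall>e\<in>carrier E. \<theta> (a \<rhd>\<^bsub>E\<^esub> e) = a \<rhd>\<^bsub>F\<^esub> \<theta> e) \<and>
     (\<forall>a\<in>carrier A. \<forall>e\<in>carrier E. \<theta> (e \<lhd>\<^bsub>E\<^esub> a) = \<theta> e \<lhd>\<^bsub>F\<^esub> a)}"

definition regular_bimod :: "'u star_alg \<Rightarrow> 'u bimod" where
  "regular_bimod A = \<lparr>carrier = carrier A, mult = mult A, one = one A, zero = zero A, add = add A,
     smult = smult A, lact = mult A, ract = mult A\<rparr>"

text \<open>
  The conjugate bimodule has the same underlying set, i.e. the bar of an element \<open>e\<close> is
  represented by \<open>e\<close> itself, and the bar of a map is the same map on underlying sets.
\<close>

definition conj_bimod :: "'u star_alg \<Rightarrow> 'u bimod \<Rightarrow> 'u bimod" where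
  "conj_bimod A E = E\<lparr>smult := \<lambda>c e. cnj c \<odot>\<^bsub>E\<^esub> e,
     lact := \<lambda>a e. e \<lhd>\<^bsub>E\<^esub> star A a, ract := \<lambda>e a. star A a \<rhd>\<^bsub>E\<^esub> e\<rparr>"


section \<open>Tensor product over the algebra\<close>

text \<open>
  The elements of the tensor product are formal sums of pairs, i.e. lists, modulo the congruence
  below. Compatibility with complex scalars follows from \<open>balanced\<close>, the complex numbers acting
  through the algebra.
\<close>

inductive tensor_eq ::
    "'u star_alg \<Rightarrow> 'u bimod \<Rightarrow> 'u bimod \<Rightarrow> ('u \<times> 'u) list \<Rightarrow> ('u \<times> 'u) list \<Rightarrow> bool"
  for A :: "'u star_alg" and E :: "'u bimod" and F :: "'u bimod" where
  refl: "tensor_eq A E F l l"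
| sym: "tensor_eq A E F l k \<Longrightarrow> tensor_eq A E F k l"
| trans: "tensor_eq A E F j k \<Longrightarrow> tensor_eq A E F k l \<Longrightarrow> tensor_eq A E F j l"
| cong: "tensor_eq A E F l k \<Longrightarrow> tensor_eq A E F (p @ l @ q) (p @ k @ q)"
| comm: "tensor_eq A E F [x, y] [y, x]"
| zero: "f \<in> carrier F \<Longrightarrow> tensor_eq A E F [(\<zero>\<^bsub>E\<^esub>, f)] []"
| add_left: "\<lbrakk>e \<in> carrier E; e' \<in> carrier E; f \<in> carrier F\<rbrakk>
    \<Longrightarrow> tensor_eq A E F [(e \<oplus>\<^bsub>E\<^esub> e', f)] [(e, f), (e', f)]"
| add_right: "\<lbrakk>e \<in> carrier E; f \<in> carrier F; f' \<in> carrier F\<rbrakk>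
    \<Longrightarrow> tensor_eq A E F [(e, f \<oplus>\<^bsub>F\<^esub> f')] [(e, f), (e, f')]"
| balanced: "\<lbrakk>a \<in> carrier A; e \<in> carrier E; f \<in> carrier F\<rbrakk>
    \<Longrightarrow> tensor_eq A E F [(e \<lhd>\<^bsub>E\<^esub> a, f)] [(e, a \<rhd>\<^bsub>F\<^esub> f)]"

text \<open>
  In order that all tensor products have their carrier in the same type, a class is represented by
  the code in \<open>'u\<close> of a chosen list. An injective coding exists as \<open>'u\<close> is infinite.
\<close>

definition list_code :: "('u::infinite \<times> 'u) list \<Rightarrow> 'u" where
  "list_code = (SOME f. inj f)"

definition tensor_class ::
    "'u::infinite star_alg \<Rightarrow> 'u bimod \<Rightarrow> 'u bimod \<Rightarrow> ('u \<times> 'u) list \<Rightarrow> 'u" where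
  "tensor_class A E F l = list_code (SOME k. tensor_eq A E F l k)"

definition tensor_rep :: "'u::infinite \<Rightarrow> ('u \<times> 'u) list" where
  "tensor_rep = inv_into UNIV list_code"

definition tensor_bimod :: "'u::infinite star_alg \<Rightarrow> 'u bimod \<Rightarrow> 'u bimod \<Rightarrow> 'u bimod" where
  "tensor_bimod A E F =
     \<lparr>carrier = tensor_class A E F ` lists (carrier E \<times> carrier F),
      mult = undefined, one = undefined,
      zero = tensor_class A E F [],
      add = \<lambda>s t. tensor_class A E F (tensor_rep s @ tensor_rep t),
      smult = \<lambda>c t. tensor_class A E F (map (\<lambda>(e, f). (c \<odot>\<^bsub>E\<^esub> e, f)) (tensor_rep t)),
      lact = \<lambda>a t. tensor_class A E F (map (\<lambda>(e, f). (a \<rhd>\<^bsub>E\<^esub> e, f)) (tensor_rep t)),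
      ract = \<lambda>t a. tensor_class A E F (map (\<lambda>(e, f). (e, f \<lhd>\<^bsub>F\<^esub> a)) (tensor_rep t))\<rparr>"

definition tensor_elt :: "'u::infinite star_alg \<Rightarrow> 'u bimod \<Rightarrow> 'u bimod \<Rightarrow> 'u \<Rightarrow> 'u \<Rightarrow> 'u" where
  "tensor_elt A E F e f = tensor_class A E F [(e, f)]"

text \<open>
  For \<open>h\<close> biadditive and balanced with values in \<open>T\<close>, \<open>tensor_lift A E F T h\<close> is the additive map
  that sends the elementary tensor of \<open>e\<close> and \<open>f\<close> to \<open>h e f\<close>.
\<close>

definition tensor_lift ::
    "'u::infinite star_alg \<Rightarrow> 'u bimod \<Rightarrow> 'u bimod \<Rightarrow> 'u bimod \<Rightarrow> ('u \<Rightarrow> 'u \<Rightarrow> 'u) \<Rightarrow> 'u \<Rightarrow> 'u" where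
  "tensor_lift A E F T h =
     (\<lambda>t\<in>carrier (tensor_bimod A E F). foldr (\<lambda>(e, f) s. h e f \<oplus>\<^bsub>T\<^esub> s) (tensor_rep t) \<zero>\<^bsub>T\<^esub>)"

definition tensor_map :: "'u::infinite star_alg \<Rightarrow> 'u bimod \<Rightarrow> 'u bimod \<Rightarrow> 'u bimod \<Rightarrow> 'u bimod
    \<Rightarrow> ('u \<Rightarrow> 'u) \<Rightarrow> ('u \<Rightarrow> 'u) \<Rightarrow> 'u \<Rightarrow> 'u" where
  "tensor_map A E E' F F' \<theta> \<phi> =
     tensor_lift A E F (tensor_bimod A E' F') (\<lambda>e f. tensor_elt A E' F' (\<theta> e) (\<phi> f))"

definition bimod_assoc ::
    "'u::infinite star_alg \<Rightarrow> 'u bimod \<Rightarrow> 'u bimod \<Rightarrow> 'u bimod \<Rightarrow> 'u \<Rightarrow> 'u" where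
  "bimod_assoc A E F G =
     (let T = tensor_bimod A E (tensor_bimod A F G) in
      tensor_lift A (tensor_bimod A E F) G T
        (\<lambda>t g. tensor_lift A E F T
          (\<lambda>e f. tensor_elt A E (tensor_bimod A F G) e (tensor_elt A F G f g)) t))"

definition bimod_lunit :: "'u::infinite star_alg \<Rightarrow> 'u bimod \<Rightarrow> 'u \<Rightarrow> 'u" where
  "bimod_lunit A E = tensor_lift A (regular_bimod A) E E (\<lambda>a e. a \<rhd>\<^bsub>E\<^esub> e)"

definition bimod_runit :: "'u::infinite star_alg \<Rightarrow> 'u bimod \<Rightarrow> 'u \<Rightarrow> 'u" where
  "bimod_runit A E = tensor_lift A E (regular_bimod A) E (\<lambda>e a. e \<lhd>\<^bsub>E\<^esub> a)"

definition bimod_Upsilon :: "'u::infinite star_alg \<Rightarrow> 'u bimod \<Rightarrow> 'u bimod \<Rightarrow> 'u \<Rightarrow> 'u" where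
  "bimod_Upsilon A E F =
     tensor_lift A E F (tensor_bimod A (conj_bimod A F) (conj_bimod A E))
       (\<lambda>e f. tensor_elt A (conj_bimod A F) (conj_bimod A E) f e)"

definition map_inverse :: "'u bimod \<Rightarrow> 'u bimod \<Rightarrow> ('u \<Rightarrow> 'u) \<Rightarrow> 'u \<Rightarrow> 'u" where
  "map_inverse E F \<theta> = (\<lambda>f\<in>carrier F. inv_into (carrier E) \<theta> f)"

definition id_map :: "'u bimod \<Rightarrow> 'u \<Rightarrow> 'u" where
  "id_map E = (\<lambda>e\<in>carrier E. e)"

definition bimod_category :: "'u::infinite star_alg \<Rightarrow> ('u bimod, 'u \<Rightarrow> 'u) bar_data" where
  "bimod_category A =
     \<lparr>Obj = {E. bimodule A E},
      Hom = bimod_hom A,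
      ident = id_map,
      comp = \<lambda>E F G \<phi> \<theta>. compose (carrier E) \<phi> \<theta>,
      tensor_ob = tensor_bimod A,
      tensor_mor = tensor_map A,
      unit_ob = regular_bimod A,
      associator = bimod_assoc A,
      lunitor = bimod_lunit A,
      runitor = bimod_runit A,
      bar_ob = conj_bimod A,
      bar_mor = \<lambda>E F \<theta>. \<theta>,
      Upsilon = bimod_Upsilon A,
      bb = id_map,
      unit_star = (\<lambda>a\<in>carrier A. star A a)\<rparr>"


section \<open>Bimodule covariant derivatives\<close>

locale differential_structure =
  fixes A :: "'u star_alg" (structure) and \<Omega> :: "'u bimod" and d :: "'u \<Rightarrow> 'u"
  assumes bimodule: "bimodule A \<Omega>"
    and d_closed: "a \<in> carrier A \<Longrightarrow> d a \<in> carrier \<Omega>"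
    and d_add: "\<lbrakk>a \<in> carrier A; b \<in> carrier A\<rbrakk> \<Longrightarrow> d (a \<oplus> b) = d a \<oplus>\<^bsub>\<Omega>\<^esub> d b"
    and d_smult: "a \<in> carrier A \<Longrightarrow> d (c \<odot> a) = c \<odot>\<^bsub>\<Omega>\<^esub> d a"
    and d_mult: "\<lbrakk>a \<in> carrier A; b \<in> carrier A\<rbrakk>
      \<Longrightarrow> d (a \<otimes> b) = (d a \<lhd>\<^bsub>\<Omega>\<^esub> b) \<oplus>\<^bsub>\<Omega>\<^esub> (a \<rhd>\<^bsub>\<Omega>\<^esub> d b)"
    and spanned: "\<lbrakk>submodule S complex_field \<Omega>; {x \<rhd>\<^bsub>\<Omega>\<^esub> d y | x y. x \<in> carrier A \<and> y \<in> carrier A} \<subseteq> S\<rbrakk>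
      \<Longrightarrow> S = carrier \<Omega>"

record 'u conn =
  bim :: "'u bimod"
  nabla :: "'u \<Rightarrow> 'u"
  sigma :: "'u \<Rightarrow> 'u"

definition bimodule_connection ::
    "'u::infinite star_alg \<Rightarrow> 'u bimod \<Rightarrow> ('u \<Rightarrow> 'u) \<Rightarrow> 'u conn \<Rightarrow> bool" where
  "bimodule_connection A \<Omega> d X \<longleftrightarrow>
     (let E = bim X; D = nabla X; \<sigma> = sigma X;
          OE = tensor_bimod A \<Omega> E; EO = tensor_bimod A E \<Omega>
      in bimodule A E \<and>
         D \<in> carrier E \<rightarrow>\<^sub>E carrier OE \<and>
         (\<forall>e\<in>carrier E. \<forall>e'\<in>carrier E. D (e \<oplus>\<^bsub>E\<^esub> e') = D e \<oplus>\<^bsub>OE\<^esub> D e') \<and>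
         (\<forall>c. \<forall>e\<in>carrier E. D (c \<odot>\<^bsub>E\<^esub> e) = c \<odot>\<^bsub>OE\<^esub> D e) \<and>
         (\<forall>a\<in>carrier A. \<forall>e\<in>carrier E.
            D (a \<rhd>\<^bsub>E\<^esub> e) = tensor_elt A \<Omega> E (d a) e \<oplus>\<^bsub>OE\<^esub> (a \<rhd>\<^bsub>OE\<^esub> D e)) \<and>
         \<sigma> \<in> bimod_hom A EO OE \<and> bij_betw \<sigma> (carrier EO) (carrier OE) \<and>
         (\<forall>a\<in>carrier A. \<forall>e\<in>carrier E.
            D (e \<lhd>\<^bsub>E\<^esub> a) = (D e \<lhd>\<^bsub>OE\<^esub> a) \<oplus>\<^bsub>OE\<^esub> \<sigma> (tensor_elt A E \<Omega> e (d a))))"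

definition conn_hom ::
    "'u::infinite star_alg \<Rightarrow> 'u bimod \<Rightarrow> 'u conn \<Rightarrow> 'u conn \<Rightarrow> ('u \<Rightarrow> 'u) set" where
  "conn_hom A \<Omega> X Y = {\<theta> \<in> bimod_hom A (bim X) (bim Y).
     \<forall>e\<in>carrier (bim X). nabla Y (\<theta> e) = tensor_map A \<Omega> \<Omega> (bim X) (bim Y) (id_map \<Omega>) \<theta> (nabla X e)}"

definition conn_unit :: "'u::infinite star_alg \<Rightarrow> 'u bimod \<Rightarrow> ('u \<Rightarrow> 'u) \<Rightarrow> 'u conn" where
  "conn_unit A \<Omega> d =
     (let R = regular_bimod A;
          runit_inv = map_inverse (tensor_bimod A \<Omega> R) \<Omega> (bimod_runit A \<Omega>)
      in \<lparr>bim = R,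
          nabla = (\<lambda>a\<in>carrier A. runit_inv (d a)),
          sigma = compose (carrier (tensor_bimod A R \<Omega>)) runit_inv (bimod_lunit A \<Omega>)\<rparr>)"

text \<open>
  Of the two terms of the derivative on a tensor product only the sum is balanced over the algebra,
  so it is their sum that is lifted.
\<close>

definition conn_tensor :: "'u::infinite star_alg \<Rightarrow> 'u bimod \<Rightarrow> 'u conn \<Rightarrow> 'u conn \<Rightarrow> 'u conn" where
  "conn_tensor A \<Omega> X Y =
     (let E = bim X; F = bim Y;
          EF = tensor_bimod A E F;
          EO = tensor_bimod A E \<Omega>; OE = tensor_bimod A \<Omega> E;
          FO = tensor_bimod A F \<Omega>; OF = tensor_bimod A \<Omega> F;
          sigmaE_id = tensor_map A EO OE F F (sigma X) (id_map F);
          id_sigmaF = tensor_map A E E FO OF (id_map E) (sigma Y);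
          assoc_inv = map_inverse (tensor_bimod A EO F) (tensor_bimod A E OF) (bimod_assoc A E \<Omega> F)
      in \<lparr>bim = EF,
          nabla = tensor_lift A E F (tensor_bimod A \<Omega> EF)
            (\<lambda>e f. bimod_assoc A \<Omega> E F (tensor_elt A OE F (nabla X e) f)
               \<oplus>\<^bsub>tensor_bimod A \<Omega> EF\<^esub>
               bimod_assoc A \<Omega> E F (sigmaE_id (assoc_inv (tensor_elt A E OF e (nabla Y f))))),
          sigma = (\<lambda>t\<in>carrier (tensor_bimod A EF \<Omega>).
            bimod_assoc A \<Omega> E F (sigmaE_id (assoc_inv (id_sigmaF (bimod_assoc A E F \<Omega> t)))))\<rparr>)"

definition conn_bar ::
    "'u::infinite star_alg \<Rightarrow> 'u bimod \<Rightarrow> ('u \<Rightarrow> 'u) \<Rightarrow> 'u conn \<Rightarrow> 'u conn" where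
  "conn_bar A \<Omega> st X =
     (let E = bim X;
          cE = conj_bimod A E; cO = conj_bimod A \<Omega>;
          EO = tensor_bimod A E \<Omega>; OE = tensor_bimod A \<Omega> E;
          sigma_inv = map_inverse EO OE (sigma X);
          st_inv = map_inverse \<Omega> cO st;
          st_inv_id = tensor_map A cO \<Omega> cE cE st_inv (id_map cE);
          id_st = tensor_map A cE cE \<Omega> cO (id_map cE) st;
          Ups = bimod_Upsilon A E \<Omega>;
          Ups_inv = map_inverse (conj_bimod A OE) (tensor_bimod A cE cO) (bimod_Upsilon A \<Omega> E)
      in \<lparr>bim = cE,
          nabla = (\<lambda>e\<in>carrier cE. st_inv_id (Ups (sigma_inv (nabla X e)))),
          sigma = (\<lambda>t\<in>carrier (tensor_bimod A cE \<Omega>).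
            st_inv_id (Ups (sigma_inv (Ups_inv (id_st t)))))\<rparr>)"

text \<open>
  The underlying bimodules of the tensor product, the unit and the bar of objects are those in
  \<open>bimod_category A\<close>, and all the data that are morphisms are taken from there.
\<close>

definition conn_category ::
    "'u::infinite star_alg \<Rightarrow> 'u bimod \<Rightarrow> ('u \<Rightarrow> 'u) \<Rightarrow> ('u \<Rightarrow> 'u) \<Rightarrow> ('u conn, 'u \<Rightarrow> 'u) bar_data" where
  "conn_category A \<Omega> d st =
     (let M = bimod_category A in
      \<lparr>Obj = {X. bimodule_connection A \<Omega> d X},
       Hom = conn_hom A \<Omega>,
       ident = \<lambda>X. ident M (bim X),
       comp = \<lambda>X Y Z. comp M (bim X) (bim Y) (bim Z),
       tensor_ob = conn_tensor A \<Omega>,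
       tensor_mor = \<lambda>X X' Y Y'. tensor_mor M (bim X) (bim X') (bim Y) (bim Y'),
       unit_ob = conn_unit A \<Omega> d,
       associator = \<lambda>X Y Z. associator M (bim X) (bim Y) (bim Z),
       lunitor = \<lambda>X. lunitor M (bim X),
       runitor = \<lambda>X. runitor M (bim X),
       bar_ob = conn_bar A \<Omega> st,
       bar_mor = \<lambda>X Y. bar_mor M (bim X) (bim Y),
       Upsilon = \<lambda>X Y. Upsilon M (bim X) (bim Y),
       bb = \<lambda>X. bb M (bim X),
       unit_star = unit_star M\<rparr>)"

end

theory Submission
  imports Defs
begin

text \<open>
  Elements of a tensor product are sums of elementary tensors, so every identity between its maps is
  checked on these; in this way all coherence laws are those of the bimodule category, and what
  remains is that the objects and structure maps are compatible with the derivatives. Write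
  \<open>\<Phi>(e \<otimes> \<omega>) = \<omega>\<^sup>* \<otimes> e\<close> for the semilinear bijection from \<open>E \<otimes> \<Omega>\<close> to \<open>\<Omega> \<otimes> E\<close> with the conjugate of
  \<open>E\<close> on the right, so that the derivative on the conjugate is \<open>\<Phi> \<sigma>\<^sup>-\<^sup>1 \<nabla>\<close>. Applying \<open>\<Phi> \<sigma>\<^sup>-\<^sup>1\<close> to
  \<open>\<nabla>(e a) = \<nabla>(e) a + \<sigma>(e \<otimes> da)\<close> turns the right Leibniz rule into the left one for the conjugate,
  and conversely.
\<close>

section \<open>Codes of lists\<close>

text \<open>A morphism is only asked to commute with the derivatives, whereas \<sigma> enters the
  derivative on a tensor product and, inverted, the derivative on a conjugate. Functoriality of both
  constructions therefore rests on morphisms commuting with \<sigma>. This is automatic because the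
  right Leibniz rule determines \<sigma>(e \<otimes> da), and e \<otimes> x dy = ex \<otimes> dy
  with \<Omega> spanned by the x dy.

  The least evident structure map is Upsilon: it exchanges the two summands of the derivative of e
  \<otimes> f. In the summand with \<nabla>f the inverse \<sigma> of the tensor product cancels the
  \<sigma> of E, and the flip turns what remains into the derivative on the conjugate of F, now in
  first place.

  Two choices keep the work small. A conjugate has the elements and the addition of the original, so
  maps are compared merely as additive maps, whether linear or semilinear. And since composition and
  identities do not see the derivatives, a morphism of connections that is invertible as a bimodule
  map is invertible among connections.\<close>

lemma inj_list_code: "inj (list_code :: ('u::infinite \<times> 'u) list \<Rightarrow> 'u)"
proof -
  have "\<exists>p :: 'u \<times> 'u \<Rightarrow> 'u. bij_betw p (UNIV \<times> UNIV) UNIV"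
    using card_of_Times_same_infinite[of "UNIV :: 'u set"] infinite_UNIV card_of_ordIso by blast
  then obtain p :: "'u \<times> 'u \<Rightarrow> 'u" where p: "inj p"
    by (auto simp: bij_betw_def)
  obtain c :: "nat \<Rightarrow> 'u" where c: "inj c"
    using infinite_countable_subset[OF infinite_UNIV] by blast
  \<comment> \<open>\<open>enc\<close> alone separates only lists of equal length, since the start
    value \<open>c 0\<close> may itself be of the form \<open>p (p x, r)\<close>; the length is
    therefore coded separately through \<open>c\<close>.\<close>
  define enc where "enc = rec_list (c 0) (\<lambda>x _ r. p (p x, r))"
  have enc: "l = k" if "length l = length k" "enc l = enc k" for l k
    using that by (induct l k rule: list_induct2) (auto simp: enc_def dest!: injD[OF p])
  have "inj (\<lambda>l. p (c (length l), enc l))"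
    by (auto intro!: injI enc dest!: injD[OF p] injD[OF c])
  then show ?thesis
    unfolding list_code_def by (rule someI[of inj])
qed

lemma tensor_rep_list_code: "tensor_rep (list_code l) = l"
  by (simp add: tensor_rep_def inj_list_code)

section \<open>Bimodules\<close>

lemma carrier_complex_field [simp]: "carrier complex_field = UNIV"
  and complex_field_simps: "add complex_field = (+)" "mult complex_field = (*)"
    "one complex_field = 1" "zero complex_field = 0"
  by (simp_all add: complex_field_def)

lemma cring_complex_field: "cring complex_field"
proof (rule cringI)
  show "abelian_group complex_field"
    by (rule abelian_groupI) (auto simp: complex_field_simps intro!: exI[of _ "- x" for x])
  show "comm_monoid complex_field"
    by (rule comm_monoidI) (auto simp: complex_field_simps)
qed (auto simp: complex_field_simps algebra_simps)

context star_algebra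
begin

lemmas bimodule_simps [simp] =
  bimodule.lact_closed[of A] bimodule.lact_add_left[of A] bimodule.lact_add_right[of A] bimodule.lact_smult_left[of A]
  bimodule.lact_smult_right[of A] bimodule.lact_mult[of A] bimodule.lact_one[of A] bimodule.ract_closed[of A]
  bimodule.ract_add_right[of A] bimodule.ract_add_left[of A] bimodule.ract_smult_right[of A]
  bimodule.ract_smult_left[of A] bimodule.ract_mult[of A] bimodule.ract_one[of A] bimodule.lact_ract[of A]

lemma bimodule_abelian_group: "bimodule A E \<Longrightarrow> abelian_group E"
  using bimodule.vector_space module.axioms by blast

lemma bimodule_abelian_monoid: "bimodule A E \<Longrightarrow> abelian_monoid E"
  using bimodule_abelian_group abelian_group.axioms by blast

lemmas bimodule_add_simps [simp] =
  abelian_monoid.a_closed[OF bimodule_abelian_monoid]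
  abelian_monoid.zero_closed[OF bimodule_abelian_monoid]
  abelian_monoid.l_zero[OF bimodule_abelian_monoid]
  abelian_monoid.r_zero[OF bimodule_abelian_monoid]
  abelian_group.a_inv_closed[OF bimodule_abelian_group]

lemmas bimodule_add_ac =
  abelian_monoid.a_assoc[OF bimodule_abelian_monoid]
  abelian_monoid.a_comm[OF bimodule_abelian_monoid]
  abelian_monoid.a_lcomm[OF bimodule_abelian_monoid]

lemma bimodule_add_cancel:
  assumes "bimodule A E" "x \<in> carrier E" "y \<in> carrier E" "z \<in> carrier E"
  shows "x \<oplus>\<^bsub>E\<^esub> y = x \<oplus>\<^bsub>E\<^esub> z \<longleftrightarrow> y = z"
  using assms abelian_group.a_comm_group[OF bimodule_abelian_group[OF assms(1)]]
  by (metis abelian_group.r_neg1 bimodule_abelian_group)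

lemma bimodule_smult_simps [simp]:
  assumes "bimodule A E" "e \<in> carrier E"
  shows "c \<odot>\<^bsub>E\<^esub> e \<in> carrier E"
    and "(c + c') \<odot>\<^bsub>E\<^esub> e = c \<odot>\<^bsub>E\<^esub> e \<oplus>\<^bsub>E\<^esub> c' \<odot>\<^bsub>E\<^esub> e"
    and "f \<in> carrier E \<Longrightarrow> c \<odot>\<^bsub>E\<^esub> (e \<oplus>\<^bsub>E\<^esub> f) = c \<odot>\<^bsub>E\<^esub> e \<oplus>\<^bsub>E\<^esub> c \<odot>\<^bsub>E\<^esub> f"
    and "(c * c') \<odot>\<^bsub>E\<^esub> e = c \<odot>\<^bsub>E\<^esub> (c' \<odot>\<^bsub>E\<^esub> e)"
    and "1 \<odot>\<^bsub>E\<^esub> e = e"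
proof -
  interpret module complex_field E
    by (rule bimodule.vector_space[OF assms(1)])
  show "c \<odot>\<^bsub>E\<^esub> e \<in> carrier E"
    "(c + c') \<odot>\<^bsub>E\<^esub> e = c \<odot>\<^bsub>E\<^esub> e \<oplus>\<^bsub>E\<^esub> c' \<odot>\<^bsub>E\<^esub> e"
    "f \<in> carrier E \<Longrightarrow> c \<odot>\<^bsub>E\<^esub> (e \<oplus>\<^bsub>E\<^esub> f) = c \<odot>\<^bsub>E\<^esub> e \<oplus>\<^bsub>E\<^esub> c \<odot>\<^bsub>E\<^esub> f"
    "(c * c') \<odot>\<^bsub>E\<^esub> e = c \<odot>\<^bsub>E\<^esub> (c' \<odot>\<^bsub>E\<^esub> e)" "1 \<odot>\<^bsub>E\<^esub> e = e"
    using assms(2) smult_closed[of c] smult_l_distr[of c c'] smult_r_distr[of c]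
      smult_assoc1[of c c'] smult_one
    by (auto simp: complex_field_simps)
qed

text \<open>Cancellation leaves zero as the only idempotent. Hence a map known only to be additive
  preserves zero, its value there being its own double.\<close>

lemma zero_unique:
  assumes "bimodule A E" "x \<in> carrier E" "x \<oplus>\<^bsub>E\<^esub> x = x"
  shows "x = \<zero>\<^bsub>E\<^esub>"
  using assms bimodule_add_cancel[OF assms(1,2,2), of "\<zero>\<^bsub>E\<^esub>"] by simp

sublocale ring A
  by (rule ring)

lemmas star_simps [simp] = star_closed star_add star_mult star_star star_smult

lemma star_one [simp]: "star A \<one> = \<one>"
  by (metis l_one one_closed r_one star_closed star_mult star_star)

lemma smult_A_closed [simp]: "a \<in> carrier A \<Longrightarrow> c \<odot> a \<in> carrier A"
  using module.smult_closed[OF vector_space] by simp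

lemma regular_bimod_simps [simp]:
  "carrier (regular_bimod A) = carrier A" "zero (regular_bimod A) = \<zero>"
  "add (regular_bimod A) = add A" "smult (regular_bimod A) = smult A"
  "lact (regular_bimod A) = mult A" "ract (regular_bimod A) = mult A"
  by (simp_all add: regular_bimod_def)

lemma conj_bimod_simps [simp]:
  "carrier (conj_bimod A E) = carrier E" "zero (conj_bimod A E) = zero E"
  "add (conj_bimod A E) = add E"
  "c \<odot>\<^bsub>conj_bimod A E\<^esub> e = cnj c \<odot>\<^bsub>E\<^esub> e"
  "a \<rhd>\<^bsub>conj_bimod A E\<^esub> e = e \<lhd>\<^bsub>E\<^esub> star A a"
  "e \<lhd>\<^bsub>conj_bimod A E\<^esub> a = star A a \<rhd>\<^bsub>E\<^esub> e"
  by (simp_all add: conj_bimod_def)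

text \<open>Regular and conjugate bimodules keep a given additive group and at most twist the
  scalars by a unital ring endomorphism \<open>g\<close> of the complex numbers: the identity in one
  case, \<open>cnj\<close> in the other.\<close>

lemma module_change_add:
  assumes "module complex_field E" "carrier F = carrier E" "add F = add E" "zero F = zero E"
    "\<And>c e. e \<in> carrier E \<Longrightarrow> smult F c e = smult E (g c) e"
    "\<And>c c'. g (c + c') = g c + g c'" "\<And>c c'. g (c * c') = g c * g c'" "g 1 = 1"
  shows "module complex_field F"
proof -
  interpret module complex_field E by fact
  show ?thesis
  proof (rule moduleI)
    show "abelian_group F"
      by (rule abelian_groupI)
        (use assms a_assoc a_comm M.l_neg M.a_inv_closed in \<open>auto intro!: bexI[of _ "\<ominus>\<^bsub>E\<^esub> x" for x]\<close>)
  qed (use assms smult_l_distr smult_r_distr smult_assoc1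
      smult_closed smult_one in \<open>auto simp: cring_complex_field complex_field_simps\<close>)
qed

lemma regular_bimodule [simp]: "bimodule A (regular_bimod A)"
proof (rule bimodule.intro)
  show "module complex_field (regular_bimod A)"
    by (rule module_change_add[where g = id, OF vector_space]) auto
qed (auto simp: l_distr r_distr smult_mult_left smult_mult_right m_assoc)

lemma conj_bimodule [simp]:
  assumes "bimodule A E"
  shows "bimodule A (conj_bimod A E)"
proof (rule bimodule.intro)
  show "module complex_field (conj_bimod A E)"
    by (rule module_change_add[where g = cnj, OF bimodule.vector_space[OF assms]]) auto
qed (use assms in auto)

end

section \<open>Tensor products\<close>

text \<open>Hilbert choice depends only on the set of candidates. Equivalent lists have the same
  candidates, and every list is equivalent to the one chosen for it, so the injective code turns
  congruence into equality.\<close>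

lemma tensor_eq_class: "tensor_class A E F l = tensor_class A E F k \<longleftrightarrow> tensor_eq A E F l k"
proof
  assume "tensor_class A E F l = tensor_class A E F k"
  then have "(SOME j. tensor_eq A E F l j) = (SOME j. tensor_eq A E F k j)"
    by (simp add: tensor_class_def inj_eq inj_list_code)
  moreover have "tensor_eq A E F l (SOME j. tensor_eq A E F l j)" for l
    by (rule someI[of _ l]) (rule tensor_eq.refl)
  ultimately show "tensor_eq A E F l k"
    by (metis tensor_eq.sym tensor_eq.trans)
next
  assume "tensor_eq A E F l k"
  then have "tensor_eq A E F l = tensor_eq A E F k"
    by (intro ext) (blast intro: tensor_eq.sym tensor_eq.trans)
  then show "tensor_class A E F l = tensor_class A E F k"
    by (simp add: tensor_class_def)
qed

lemma tensor_eq_rep: "tensor_eq A E F l (tensor_rep (tensor_class A E F l))"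
  unfolding tensor_class_def tensor_rep_list_code by (rule someI[of _ l]) (rule tensor_eq.refl)

lemma tensor_eq_append:
  assumes "tensor_eq A E F l l'" "tensor_eq A E F k k'"
  shows "tensor_eq A E F (l @ k) (l' @ k')"
  using tensor_eq.cong[OF assms(1), of "[]" k] tensor_eq.cong[OF assms(2), of l' "[]"]
  by (auto intro: tensor_eq.trans)

lemma tensor_eq_append_comm: "tensor_eq A E F (l @ k) (k @ l)"
proof (induct l)
  case (Cons x l)
  have "tensor_eq A E F (x # k) (k @ [x])"
  proof (induct k)
    case (Cons y k)
    have "tensor_eq A E F ([x, y] @ k) ([y, x] @ k)"
      by (intro tensor_eq_append tensor_eq.comm tensor_eq.refl)
    moreover have "tensor_eq A E F ([y] @ x # k) ([y] @ k @ [x])"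
      by (intro tensor_eq_append Cons tensor_eq.refl)
    ultimately show ?case by (auto intro: tensor_eq.trans)
  qed (simp add: tensor_eq.refl)
  then have "tensor_eq A E F ((x # k) @ l) ((k @ [x]) @ l)"
    by (intro tensor_eq_append tensor_eq.refl)
  moreover have "tensor_eq A E F ([x] @ l @ k) ([x] @ k @ l)"
    by (intro tensor_eq_append Cons tensor_eq.refl)
  ultimately show ?case by (auto intro: tensor_eq.trans)
qed (simp add: tensor_eq.refl)

text \<open>This makes scalars and actions, which the definitions apply to a chosen list,
  independent of the choice. Preservation of zero is asked of \<theta> alone because the relation
  that discards a summand looks at the left factor.\<close>

lemma tensor_eq_map:
  assumes "tensor_eq A E F l k"
    and "\<And>e. e \<in> carrier E \<Longrightarrow> \<theta> e \<in> carrier E'" "\<And>f. f \<in> carrier F \<Longrightarrow> \<phi> f \<in> carrier F'"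
    and "\<theta> \<zero>\<^bsub>E\<^esub> = \<zero>\<^bsub>E'\<^esub>"
    and "\<And>e e'. \<lbrakk>e \<in> carrier E; e' \<in> carrier E\<rbrakk> \<Longrightarrow> \<theta> (e \<oplus>\<^bsub>E\<^esub> e') = \<theta> e \<oplus>\<^bsub>E'\<^esub> \<theta> e'"
    and "\<And>f f'. \<lbrakk>f \<in> carrier F; f' \<in> carrier F\<rbrakk> \<Longrightarrow> \<phi> (f \<oplus>\<^bsub>F\<^esub> f') = \<phi> f \<oplus>\<^bsub>F'\<^esub> \<phi> f'"
    and "\<And>e a. \<lbrakk>e \<in> carrier E; a \<in> carrier A\<rbrakk> \<Longrightarrow> \<theta> (e \<lhd>\<^bsub>E\<^esub> a) = \<theta> e \<lhd>\<^bsub>E'\<^esub> a"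
    and "\<And>f a. \<lbrakk>f \<in> carrier F; a \<in> carrier A\<rbrakk> \<Longrightarrow> \<phi> (a \<rhd>\<^bsub>F\<^esub> f) = a \<rhd>\<^bsub>F'\<^esub> \<phi> f"
  shows "tensor_eq A E' F' (map (\<lambda>(e, f). (\<theta> e, \<phi> f)) l) (map (\<lambda>(e, f). (\<theta> e, \<phi> f)) k)"
  using assms
proof (induct rule: tensor_eq.induct)
  case (cong l k p q)
  then show ?case by (simp add: tensor_eq.cong)
next
  case (trans j k l)
  then show ?case by (blast intro: tensor_eq.trans)
qed (auto intro: tensor_eq.refl tensor_eq.sym tensor_eq.comm tensor_eq.zero tensor_eq.add_left
    tensor_eq.add_right tensor_eq.balanced)

section \<open>Bimodule structure on the tensor product\<close>

locale infinite_star_algebra = star_algebra A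
  for A :: "'u::infinite star_alg" (structure)
begin

abbreviation tensor_product (infixr \<open>\<boxtimes>\<close> 75) where
  "E \<boxtimes> F \<equiv> tensor_bimod A E F"

abbreviation elementary (\<open>(1elt _ _ _ _)\<close> [1000, 1000, 1000, 1000] 999) where
  "elt E F e f \<equiv> tensor_elt A E F e f"

lemma tensor_carrier: "carrier (E \<boxtimes> F) = tensor_class A E F ` lists (carrier E \<times> carrier F)"
  and tensor_zero: "\<zero>\<^bsub>E \<boxtimes> F\<^esub> = tensor_class A E F []"
  by (simp_all add: tensor_bimod_def)

lemma tensor_class_closed: "l \<in> lists (carrier E \<times> carrier F) \<Longrightarrow> tensor_class A E F l \<in> carrier (E \<boxtimes> F)"
  by (auto simp: tensor_carrier)

text \<open>The congruence relates arbitrary lists, including those with entries outside the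
  carriers. No rule leads out of the carriers or into them, so the representative chosen for an
  admissible list is admissible.\<close>

lemma tensor_eq_lists:
  assumes "tensor_eq A E F l k" "bimodule A E" "bimodule A F"
  shows "l \<in> lists (carrier E \<times> carrier F) \<longleftrightarrow> k \<in> lists (carrier E \<times> carrier F)"
  using assms by (induct rule: tensor_eq.induct) auto

lemma tensor_add_class:
  "tensor_class A E F l \<oplus>\<^bsub>E \<boxtimes> F\<^esub> tensor_class A E F k = tensor_class A E F (l @ k)"
  by (simp add: tensor_bimod_def tensor_eq_class tensor_eq.sym tensor_eq_append tensor_eq_rep)

lemma tensor_class_Cons: "tensor_class A E F ((e, f) # l) = elt E F e f \<oplus>\<^bsub>E \<boxtimes> F\<^esub> tensor_class A E F l"
  by (simp add: tensor_elt_def tensor_add_class)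

lemma tensor_smult_class:
  assumes "bimodule A E"
  shows "c \<odot>\<^bsub>E \<boxtimes> F\<^esub> tensor_class A E F l = tensor_class A E F (map (\<lambda>(e, f). (c \<odot>\<^bsub>E\<^esub> e, f)) l)"
proof -
  have "c \<odot>\<^bsub>E\<^esub> \<zero>\<^bsub>E\<^esub> = \<zero>\<^bsub>E\<^esub>"
    using assms by (intro zero_unique) (auto simp flip: bimodule_smult_simps(3))
  with assms show ?thesis
    by (auto simp: tensor_bimod_def tensor_eq_class
        intro!: tensor_eq_map[OF tensor_eq.sym[OF tensor_eq_rep], where \<phi> = "\<lambda>f. f"])
qed

lemma tensor_lact_class:
  assumes "bimodule A E" "a \<in> carrier A"
  shows "a \<rhd>\<^bsub>E \<boxtimes> F\<^esub> tensor_class A E F l = tensor_class A E F (map (\<lambda>(e, f). (a \<rhd>\<^bsub>E\<^esub> e, f)) l)"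
proof -
  have "a \<rhd>\<^bsub>E\<^esub> \<zero>\<^bsub>E\<^esub> = \<zero>\<^bsub>E\<^esub>"
    using assms by (intro zero_unique) (auto simp flip: bimodule.lact_add_right)
  with assms show ?thesis
    by (auto simp: tensor_bimod_def tensor_eq_class
        intro!: tensor_eq_map[OF tensor_eq.sym[OF tensor_eq_rep], where \<phi> = "\<lambda>f. f"])
qed

lemma tensor_ract_class:
  assumes "bimodule A F" "a \<in> carrier A"
  shows "tensor_class A E F l \<lhd>\<^bsub>E \<boxtimes> F\<^esub> a = tensor_class A E F (map (\<lambda>(e, f). (e, f \<lhd>\<^bsub>F\<^esub> a)) l)"
  using assms by (auto simp: tensor_bimod_def tensor_eq_class
      intro!: tensor_eq_map[OF tensor_eq.sym[OF tensor_eq_rep], where \<theta> = "\<lambda>e. e"])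

lemma tensor_elt_closed [simp]:
  "e \<in> carrier E \<Longrightarrow> f \<in> carrier F \<Longrightarrow> elt E F e f \<in> carrier (E \<boxtimes> F)"
  by (simp add: tensor_elt_def tensor_class_closed)

lemma tensor_elt_add_left [simp]:
  "\<lbrakk>e \<in> carrier E; e' \<in> carrier E; f \<in> carrier F\<rbrakk>
    \<Longrightarrow> elt E F (e \<oplus>\<^bsub>E\<^esub> e') f = elt E F e f \<oplus>\<^bsub>E \<boxtimes> F\<^esub> elt E F e' f"
  by (simp add: tensor_elt_def tensor_add_class tensor_eq_class tensor_eq.add_left)

lemma tensor_elt_add_right [simp]:
  "\<lbrakk>e \<in> carrier E; f \<in> carrier F; f' \<in> carrier F\<rbrakk>
    \<Longrightarrow> elt E F e (f \<oplus>\<^bsub>F\<^esub> f') = elt E F e f \<oplus>\<^bsub>E \<boxtimes> F\<^esub> elt E F e f'"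
  by (simp add: tensor_elt_def tensor_add_class tensor_eq_class tensor_eq.add_right)

lemma tensor_elt_balanced:
  "\<lbrakk>a \<in> carrier A; e \<in> carrier E; f \<in> carrier F\<rbrakk>
    \<Longrightarrow> elt E F (e \<lhd>\<^bsub>E\<^esub> a) f = elt E F e (a \<rhd>\<^bsub>F\<^esub> f)"
  by (simp add: tensor_elt_def tensor_eq_class tensor_eq.balanced)

lemma tensor_elt_smult_left:
  "\<lbrakk>bimodule A E; e \<in> carrier E; f \<in> carrier F\<rbrakk>
    \<Longrightarrow> elt E F (c \<odot>\<^bsub>E\<^esub> e) f = c \<odot>\<^bsub>E \<boxtimes> F\<^esub> elt E F e f"
  by (simp add: tensor_elt_def tensor_smult_class)

lemma tensor_elt_smult_right:
  assumes "bimodule A E" "bimodule A F" "e \<in> carrier E" "f \<in> carrier F"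
  shows "elt E F e (c \<odot>\<^bsub>F\<^esub> f) = c \<odot>\<^bsub>E \<boxtimes> F\<^esub> elt E F e f"
proof -
  have "elt E F (e \<lhd>\<^bsub>E\<^esub> (c \<odot> \<one>)) f = elt E F e ((c \<odot> \<one>) \<rhd>\<^bsub>F\<^esub> f)"
    by (rule tensor_elt_balanced) (use assms in auto)
  then show ?thesis
    using assms by (simp add: tensor_elt_smult_left)
qed

lemma tensor_elt_lact:
  "\<lbrakk>bimodule A E; a \<in> carrier A; e \<in> carrier E; f \<in> carrier F\<rbrakk>
    \<Longrightarrow> elt E F (a \<rhd>\<^bsub>E\<^esub> e) f = a \<rhd>\<^bsub>E \<boxtimes> F\<^esub> elt E F e f"
  by (simp add: tensor_elt_def tensor_lact_class)

lemma tensor_elt_ract: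
  "\<lbrakk>bimodule A F; a \<in> carrier A; e \<in> carrier E; f \<in> carrier F\<rbrakk>
    \<Longrightarrow> elt E F e (f \<lhd>\<^bsub>F\<^esub> a) = elt E F e f \<lhd>\<^bsub>E \<boxtimes> F\<^esub> a"
  by (simp add: tensor_elt_def tensor_ract_class)

lemma tensor_elt_zero [simp]: "f \<in> carrier F \<Longrightarrow> elt E F \<zero>\<^bsub>E\<^esub> f = \<zero>\<^bsub>E \<boxtimes> F\<^esub>"
  by (simp add: tensor_elt_def tensor_zero tensor_eq_class tensor_eq.zero)

lemma tensor_add_zero: "t \<in> carrier (E \<boxtimes> F) \<Longrightarrow> t \<oplus>\<^bsub>E \<boxtimes> F\<^esub> \<zero>\<^bsub>E \<boxtimes> F\<^esub> = t"
  by (auto simp: tensor_carrier tensor_zero tensor_add_class)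

lemma tensor_add_closed:
  "\<lbrakk>s \<in> carrier (E \<boxtimes> F); t \<in> carrier (E \<boxtimes> F)\<rbrakk> \<Longrightarrow> s \<oplus>\<^bsub>E \<boxtimes> F\<^esub> t \<in> carrier (E \<boxtimes> F)"
  unfolding tensor_carrier
  by (elim imageE) (metis append_in_lists_conv imageI tensor_add_class)

lemma tensor_induct [consumes 3, case_names elt add]:
  assumes "t \<in> carrier (E \<boxtimes> F)" "bimodule A E" "bimodule A F"
    and "\<And>e f. \<lbrakk>e \<in> carrier E; f \<in> carrier F\<rbrakk> \<Longrightarrow> P (elt E F e f)"
    and "\<And>s t. \<lbrakk>s \<in> carrier (E \<boxtimes> F); t \<in> carrier (E \<boxtimes> F); P s; P t\<rbrakk> \<Longrightarrow> P (s \<oplus>\<^bsub>E \<boxtimes> F\<^esub> t)"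
  shows "P t"
proof -
  have "l \<in> lists (carrier E \<times> carrier F) \<Longrightarrow> P (tensor_class A E F l)" for l
  proof (induct l)
    case Nil
    \<comment> \<open>Zero is 0 \<otimes> 0, so the induction principle needs no case for the empty
      sum.\<close>
    have "P (elt E F \<zero>\<^bsub>E\<^esub> \<zero>\<^bsub>F\<^esub>)"
      using assms(2,3) by (intro assms(4)) auto
    then show ?case
      using assms(3) by (simp flip: tensor_zero)
  qed (auto simp: tensor_class_Cons simp del: in_lists_conv_set intro!: assms(4,5) tensor_class_closed)
  with assms(1) show ?thesis
    by (auto simp: tensor_carrier)
qed

lemma tensor_abelian_group:
  assumes "bimodule A E" "bimodule A F"
  shows "abelian_group (E \<boxtimes> F)"
proof (rule abelian_groupI)
  have comm: "s \<oplus>\<^bsub>E \<boxtimes> F\<^esub> t = t \<oplus>\<^bsub>E \<boxtimes> F\<^esub> s"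
    if "s \<in> carrier (E \<boxtimes> F)" "t \<in> carrier (E \<boxtimes> F)" for s t
    using that by (auto simp: tensor_carrier tensor_add_class tensor_eq_class tensor_eq_append_comm)
  have assoc: "(s \<oplus>\<^bsub>E \<boxtimes> F\<^esub> t) \<oplus>\<^bsub>E \<boxtimes> F\<^esub> u = s \<oplus>\<^bsub>E \<boxtimes> F\<^esub> (t \<oplus>\<^bsub>E \<boxtimes> F\<^esub> u)"
    if "s \<in> carrier (E \<boxtimes> F)" "t \<in> carrier (E \<boxtimes> F)" "u \<in> carrier (E \<boxtimes> F)" for s t u
    using that by (auto simp: tensor_carrier tensor_add_class)
  show "s \<oplus>\<^bsub>E \<boxtimes> F\<^esub> t = t \<oplus>\<^bsub>E \<boxtimes> F\<^esub> s"
    if "s \<in> carrier (E \<boxtimes> F)" "t \<in> carrier (E \<boxtimes> F)" for s t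
    using that by (rule comm)
  show "(s \<oplus>\<^bsub>E \<boxtimes> F\<^esub> t) \<oplus>\<^bsub>E \<boxtimes> F\<^esub> u = s \<oplus>\<^bsub>E \<boxtimes> F\<^esub> (t \<oplus>\<^bsub>E \<boxtimes> F\<^esub> u)"
    if "s \<in> carrier (E \<boxtimes> F)" "t \<in> carrier (E \<boxtimes> F)" "u \<in> carrier (E \<boxtimes> F)" for s t u
    using that by (rule assoc)
  show zero: "\<zero>\<^bsub>E \<boxtimes> F\<^esub> \<in> carrier (E \<boxtimes> F)"
    by (simp add: tensor_zero tensor_class_closed)
  show "\<zero>\<^bsub>E \<boxtimes> F\<^esub> \<oplus>\<^bsub>E \<boxtimes> F\<^esub> t = t" if "t \<in> carrier (E \<boxtimes> F)" for t
    using that comm[OF that zero] by (simp add: tensor_add_zero)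
  show "\<exists>s\<in>carrier (E \<boxtimes> F). s \<oplus>\<^bsub>E \<boxtimes> F\<^esub> t = \<zero>\<^bsub>E \<boxtimes> F\<^esub>" if "t \<in> carrier (E \<boxtimes> F)" for t
    using that assms
  proof (induct rule: tensor_induct)
    case (elt e f)
    \<comment> \<open>The negative of e \<otimes> f is (-e) \<otimes> f: their sum is 0 \<otimes> f,
      which the relation \<open>zero\<close> discards.\<close>
    have "elt E F (\<ominus>\<^bsub>E\<^esub> e \<oplus>\<^bsub>E\<^esub> e) f = elt E F (\<ominus>\<^bsub>E\<^esub> e) f \<oplus>\<^bsub>E \<boxtimes> F\<^esub> elt E F e f"
      using elt assms by (intro tensor_elt_add_left) auto
    then show ?case
      using elt assms abelian_group.l_neg[OF bimodule_abelian_group[OF assms(1)]]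
      by (intro bexI[of _ "elt E F (\<ominus>\<^bsub>E\<^esub> e) f"]) auto
  next
    case (add s t)
    then obtain s' t' where *: "s' \<in> carrier (E \<boxtimes> F)" "t' \<in> carrier (E \<boxtimes> F)"
      "s' \<oplus>\<^bsub>E \<boxtimes> F\<^esub> s = \<zero>\<^bsub>E \<boxtimes> F\<^esub>" "t' \<oplus>\<^bsub>E \<boxtimes> F\<^esub> t = \<zero>\<^bsub>E \<boxtimes> F\<^esub>"
      by blast
    have "(t' \<oplus>\<^bsub>E \<boxtimes> F\<^esub> s') \<oplus>\<^bsub>E \<boxtimes> F\<^esub> (s \<oplus>\<^bsub>E \<boxtimes> F\<^esub> t)
        = t' \<oplus>\<^bsub>E \<boxtimes> F\<^esub> ((s' \<oplus>\<^bsub>E \<boxtimes> F\<^esub> s) \<oplus>\<^bsub>E \<boxtimes> F\<^esub> t)"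
      using *(1,2) add(1,2) by (simp add: assoc tensor_add_closed)
    also have "\<dots> = t' \<oplus>\<^bsub>E \<boxtimes> F\<^esub> (t \<oplus>\<^bsub>E \<boxtimes> F\<^esub> \<zero>\<^bsub>E \<boxtimes> F\<^esub>)"
      using * add comm zero by simp
    also have "\<dots> = \<zero>\<^bsub>E \<boxtimes> F\<^esub>"
      using * add by (simp add: tensor_add_zero)
    finally show ?case
      using * tensor_add_closed by blast
  qed
qed (rule tensor_add_closed)

lemma tensor_smult_add:
  assumes "bimodule A E" "s \<in> carrier (E \<boxtimes> F)" "t \<in> carrier (E \<boxtimes> F)"
  shows "c \<odot>\<^bsub>E \<boxtimes> F\<^esub> (s \<oplus>\<^bsub>E \<boxtimes> F\<^esub> t) = c \<odot>\<^bsub>E \<boxtimes> F\<^esub> s \<oplus>\<^bsub>E \<boxtimes> F\<^esub> c \<odot>\<^bsub>E \<boxtimes> F\<^esub> t"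
  using assms by (auto simp: tensor_carrier tensor_add_class tensor_smult_class)

lemma tensor_lact_add:
  assumes "bimodule A E" "s \<in> carrier (E \<boxtimes> F)" "t \<in> carrier (E \<boxtimes> F)" "a \<in> carrier A"
  shows "a \<rhd>\<^bsub>E \<boxtimes> F\<^esub> (s \<oplus>\<^bsub>E \<boxtimes> F\<^esub> t) = (a \<rhd>\<^bsub>E \<boxtimes> F\<^esub> s) \<oplus>\<^bsub>E \<boxtimes> F\<^esub> (a \<rhd>\<^bsub>E \<boxtimes> F\<^esub> t)"
  using assms by (auto simp: tensor_carrier tensor_add_class tensor_lact_class)

lemma tensor_ract_add:
  assumes "bimodule A F" "s \<in> carrier (E \<boxtimes> F)" "t \<in> carrier (E \<boxtimes> F)" "a \<in> carrier A"
  shows "(s \<oplus>\<^bsub>E \<boxtimes> F\<^esub> t) \<lhd>\<^bsub>E \<boxtimes> F\<^esub> a = (s \<lhd>\<^bsub>E \<boxtimes> F\<^esub> a) \<oplus>\<^bsub>E \<boxtimes> F\<^esub> (t \<lhd>\<^bsub>E \<boxtimes> F\<^esub> a)"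
  using assms by (auto simp: tensor_carrier tensor_add_class tensor_ract_class)

lemma tensor_bimodule [simp]:
  assumes E: "bimodule A E" and F: "bimodule A F"
  shows "bimodule A (E \<boxtimes> F)"
proof -
  interpret abelian_group "E \<boxtimes> F"
    using assms by (rule tensor_abelian_group)
  have smult_closed: "c \<odot>\<^bsub>E \<boxtimes> F\<^esub> t \<in> carrier (E \<boxtimes> F)" if "t \<in> carrier (E \<boxtimes> F)" for c t
    using that assms
    by (induct rule: tensor_induct) (use assms in \<open>auto simp: tensor_smult_add tensor_add_closed simp flip: tensor_elt_smult_left\<close>)
  have lact_closed: "a \<rhd>\<^bsub>E \<boxtimes> F\<^esub> t \<in> carrier (E \<boxtimes> F)" if "t \<in> carrier (E \<boxtimes> F)" "a \<in> carrier A" for a t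
    using that(1) assms
    by (induct rule: tensor_induct) (use that(2) assms in \<open>auto simp: tensor_lact_add tensor_add_closed simp flip: tensor_elt_lact\<close>)
  have ract_closed: "t \<lhd>\<^bsub>E \<boxtimes> F\<^esub> a \<in> carrier (E \<boxtimes> F)" if "t \<in> carrier (E \<boxtimes> F)" "a \<in> carrier A" for a t
    using that(1) assms
    by (induct rule: tensor_induct) (use that(2) assms in \<open>auto simp: tensor_ract_add tensor_add_closed simp flip: tensor_elt_ract\<close>)
  note closed = smult_closed lact_closed ract_closed
  note adds = tensor_smult_add[OF E] tensor_lact_add[OF E] tensor_ract_add[OF F]
  note elts = tensor_elt_smult_left tensor_elt_lact tensor_elt_ract
  note elts_right = tensor_elt_smult_right
  show ?thesis
  proof (rule bimodule.intro)
    show "module complex_field (E \<boxtimes> F)"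
    proof (rule moduleI[OF cring_complex_field tensor_abelian_group[OF E F]])
      fix c c' t
      assume t: "t \<in> carrier (E \<boxtimes> F)"
      show "(c \<oplus>\<^bsub>complex_field\<^esub> c') \<odot>\<^bsub>E \<boxtimes> F\<^esub> t = (c \<odot>\<^bsub>E \<boxtimes> F\<^esub> t) \<oplus>\<^bsub>E \<boxtimes> F\<^esub> (c' \<odot>\<^bsub>E \<boxtimes> F\<^esub> t)"
        using t E F by (induct rule: tensor_induct)
          (use E F in \<open>auto simp: a_ac closed adds complex_field_simps simp flip: elts\<close>)
      show "(c \<otimes>\<^bsub>complex_field\<^esub> c') \<odot>\<^bsub>E \<boxtimes> F\<^esub> t = c \<odot>\<^bsub>E \<boxtimes> F\<^esub> (c' \<odot>\<^bsub>E \<boxtimes> F\<^esub> t)"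
        using t E F by (induct rule: tensor_induct)
          (use E F in \<open>auto simp: closed adds complex_field_simps simp flip: elts\<close>)
      show "\<one>\<^bsub>complex_field\<^esub> \<odot>\<^bsub>E \<boxtimes> F\<^esub> t = t"
        using t E F by (induct rule: tensor_induct)
          (use E F in \<open>auto simp: closed adds complex_field_simps simp flip: elts\<close>)
    qed (use closed adds in auto)
  next
    fix a t c
    assume t: "a \<in> carrier A" "t \<in> carrier (E \<boxtimes> F)"
    \<comment> \<open>Scalars act on the left factor and the right action of A on the right one, so
      here the scalar has to cross from F to E; that is
      \<open>tensor_elt_smult_right\<close>.\<close>
    show "t \<lhd>\<^bsub>E \<boxtimes> F\<^esub> (c \<odot> a) = c \<odot>\<^bsub>E \<boxtimes> F\<^esub> (t \<lhd>\<^bsub>E \<boxtimes> F\<^esub> a)"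
      using t(2) E F by (induct rule: tensor_induct)
        (use E F t(1) in \<open>auto simp: closed adds elts_right simp flip: tensor_elt_ract\<close>)
    show "(c \<odot>\<^bsub>E \<boxtimes> F\<^esub> t) \<lhd>\<^bsub>E \<boxtimes> F\<^esub> a = c \<odot>\<^bsub>E \<boxtimes> F\<^esub> (t \<lhd>\<^bsub>E \<boxtimes> F\<^esub> a)"
      using t(2) E F by (induct rule: tensor_induct)
        (use E F t(1) in \<open>auto simp: closed adds simp flip: elts\<close>)
    show "(c \<odot> a) \<rhd>\<^bsub>E \<boxtimes> F\<^esub> t = c \<odot>\<^bsub>E \<boxtimes> F\<^esub> (a \<rhd>\<^bsub>E \<boxtimes> F\<^esub> t)"
      using t(2) E F by (induct rule: tensor_induct)
        (use E F t(1) in \<open>auto simp: closed adds simp flip: elts\<close>)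
    show "a \<rhd>\<^bsub>E \<boxtimes> F\<^esub> (c \<odot>\<^bsub>E \<boxtimes> F\<^esub> t) = c \<odot>\<^bsub>E \<boxtimes> F\<^esub> (a \<rhd>\<^bsub>E \<boxtimes> F\<^esub> t)"
      using t(2) E F by (induct rule: tensor_induct)
        (use E F t(1) in \<open>auto simp: closed adds simp flip: elts\<close>)
    fix b
    assume b: "b \<in> carrier A"
    show "(a \<oplus> b) \<rhd>\<^bsub>E \<boxtimes> F\<^esub> t = (a \<rhd>\<^bsub>E \<boxtimes> F\<^esub> t) \<oplus>\<^bsub>E \<boxtimes> F\<^esub> (b \<rhd>\<^bsub>E \<boxtimes> F\<^esub> t)"
      using t(2) E F by (induct rule: tensor_induct)
        (use E F t(1) b in \<open>auto simp: a_ac closed adds simp flip: elts\<close>)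
    show "t \<lhd>\<^bsub>E \<boxtimes> F\<^esub> (a \<oplus> b) = (t \<lhd>\<^bsub>E \<boxtimes> F\<^esub> a) \<oplus>\<^bsub>E \<boxtimes> F\<^esub> (t \<lhd>\<^bsub>E \<boxtimes> F\<^esub> b)"
      using t(2) E F by (induct rule: tensor_induct)
        (use E F t(1) b in \<open>auto simp: a_ac closed adds simp flip: elts\<close>)
    show "(a \<otimes> b) \<rhd>\<^bsub>E \<boxtimes> F\<^esub> t = a \<rhd>\<^bsub>E \<boxtimes> F\<^esub> (b \<rhd>\<^bsub>E \<boxtimes> F\<^esub> t)"
      using t(2) E F by (induct rule: tensor_induct)
        (use E F t(1) b in \<open>auto simp: closed adds simp flip: elts\<close>)
    show "t \<lhd>\<^bsub>E \<boxtimes> F\<^esub> (a \<otimes> b) = (t \<lhd>\<^bsub>E \<boxtimes> F\<^esub> a) \<lhd>\<^bsub>E \<boxtimes> F\<^esub> b"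
      using t(2) E F by (induct rule: tensor_induct)
        (use E F t(1) b in \<open>auto simp: closed adds simp flip: elts\<close>)
    show "(a \<rhd>\<^bsub>E \<boxtimes> F\<^esub> t) \<lhd>\<^bsub>E \<boxtimes> F\<^esub> b = a \<rhd>\<^bsub>E \<boxtimes> F\<^esub> (t \<lhd>\<^bsub>E \<boxtimes> F\<^esub> b)"
      using t(2) E F by (induct rule: tensor_induct)
        (use E F t(1) b in \<open>auto simp: closed adds simp flip: elts\<close>)
  next
    fix t
    assume t: "t \<in> carrier (E \<boxtimes> F)"
    show "\<one> \<rhd>\<^bsub>E \<boxtimes> F\<^esub> t = t"
      using t E F by (induct rule: tensor_induct)
        (use E F in \<open>auto simp: closed adds simp flip: elts\<close>)
    show "t \<lhd>\<^bsub>E \<boxtimes> F\<^esub> \<one> = t"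
      using t E F by (induct rule: tensor_induct)
        (use E F in \<open>auto simp: closed adds simp flip: elts\<close>)
  qed (use closed adds in auto)
qed

text \<open>From here on actions are moved out of elementary tensors, the reverse of the direction
  used so far, so that linear maps can be evaluated around them. An action that faces the other
  factor has no preferred side, and \<open>tensor_elt_balanced\<close> is invoked case by
  case.\<close>

lemmas tensor_elt_simps [simp] =
  tensor_elt_smult_left tensor_elt_smult_right tensor_elt_lact tensor_elt_ract

end

section \<open>Homomorphisms\<close>

context star_algebra
begin

text \<open>Without scalars and actions the notion does not distinguish a bimodule from its
  conjugate. Linear and semilinear maps can thus be compared by one criterion, and extensionality
  makes agreement on the carrier an equality of maps.\<close>

definition additive_map :: "'u bimod \<Rightarrow> 'u bimod \<Rightarrow> ('u \<Rightarrow> 'u) set" where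
  "additive_map E F = {\<theta> \<in> carrier E \<rightarrow>\<^sub>E carrier F.
     \<forall>e\<in>carrier E. \<forall>e'\<in>carrier E. \<theta> (e \<oplus>\<^bsub>E\<^esub> e') = \<theta> e \<oplus>\<^bsub>F\<^esub> \<theta> e'}"

lemma additive_mapD:
  assumes "\<theta> \<in> additive_map E F"
  shows "e \<in> carrier E \<Longrightarrow> \<theta> e \<in> carrier F"
    and "\<lbrakk>e \<in> carrier E; e' \<in> carrier E\<rbrakk> \<Longrightarrow> \<theta> (e \<oplus>\<^bsub>E\<^esub> e') = \<theta> e \<oplus>\<^bsub>F\<^esub> \<theta> e'"
    and "\<theta> \<in> extensional (carrier E)"
  using assms by (auto simp: additive_map_def PiE_iff)

lemma bimod_homI:
  assumes "\<theta> \<in> extensional (carrier E)" "\<And>e. e \<in> carrier E \<Longrightarrow> \<theta> e \<in> carrier F"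
    and "\<And>e e'. \<lbrakk>e \<in> carrier E; e' \<in> carrier E\<rbrakk> \<Longrightarrow> \<theta> (e \<oplus>\<^bsub>E\<^esub> e') = \<theta> e \<oplus>\<^bsub>F\<^esub> \<theta> e'"
    and "\<And>c e. e \<in> carrier E \<Longrightarrow> \<theta> (c \<odot>\<^bsub>E\<^esub> e) = c \<odot>\<^bsub>F\<^esub> \<theta> e"
    and "\<And>a e. \<lbrakk>a \<in> carrier A; e \<in> carrier E\<rbrakk> \<Longrightarrow> \<theta> (a \<rhd>\<^bsub>E\<^esub> e) = a \<rhd>\<^bsub>F\<^esub> \<theta> e"
    and "\<And>a e. \<lbrakk>a \<in> carrier A; e \<in> carrier E\<rbrakk> \<Longrightarrow> \<theta> (e \<lhd>\<^bsub>E\<^esub> a) = \<theta> e \<lhd>\<^bsub>F\<^esub> a"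
  shows "\<theta> \<in> bimod_hom A E F"
  using assms by (auto simp: bimod_hom_def PiE_iff)

lemma bimod_homD:
  assumes "\<theta> \<in> bimod_hom A E F"
  shows "e \<in> carrier E \<Longrightarrow> \<theta> e \<in> carrier F"
    and "\<lbrakk>e \<in> carrier E; e' \<in> carrier E\<rbrakk> \<Longrightarrow> \<theta> (e \<oplus>\<^bsub>E\<^esub> e') = \<theta> e \<oplus>\<^bsub>F\<^esub> \<theta> e'"
    and "e \<in> carrier E \<Longrightarrow> \<theta> (c \<odot>\<^bsub>E\<^esub> e) = c \<odot>\<^bsub>F\<^esub> \<theta> e"
    and "\<lbrakk>a \<in> carrier A; e \<in> carrier E\<rbrakk> \<Longrightarrow> \<theta> (a \<rhd>\<^bsub>E\<^esub> e) = a \<rhd>\<^bsub>F\<^esub> \<theta> e"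
    and "\<lbrakk>a \<in> carrier A; e \<in> carrier E\<rbrakk> \<Longrightarrow> \<theta> (e \<lhd>\<^bsub>E\<^esub> a) = \<theta> e \<lhd>\<^bsub>F\<^esub> a"
  using assms by (auto simp: bimod_hom_def)

lemma bimod_hom_extensional: "\<theta> \<in> bimod_hom A E F \<Longrightarrow> \<theta> \<in> extensional (carrier E)"
  by (auto simp: bimod_hom_def PiE_iff)

lemma bimod_hom_additive: "\<theta> \<in> bimod_hom A E F \<Longrightarrow> \<theta> \<in> additive_map E F"
  by (auto simp: bimod_hom_def additive_map_def)

lemma bimod_hom_conj_additive: "\<theta> \<in> bimod_hom A (conj_bimod A E) F \<Longrightarrow> \<theta> \<in> additive_map E F"
  by (auto simp: bimod_hom_def additive_map_def)

lemma id_map_apply [simp]: "e \<in> carrier E \<Longrightarrow> id_map E e = e"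
  by (simp add: id_map_def)

lemma id_map_hom: "bimodule A E \<Longrightarrow> id_map E \<in> bimod_hom A E E"
  by (rule bimod_homI) (auto simp: id_map_def)

lemma id_map_conj [simp]: "id_map (conj_bimod A E) = id_map E"
  by (simp add: id_map_def)

lemma bimod_hom_compose:
  assumes "\<theta> \<in> bimod_hom A E F" "\<phi> \<in> bimod_hom A F G" "bimodule A E"
  shows "compose (carrier E) \<phi> \<theta> \<in> bimod_hom A E G"
  using assms(3)
  by (intro bimod_homI) (auto simp: compose_eq bimod_homD[OF assms(1)] bimod_homD[OF assms(2)])

lemma bimod_hom_conj:
  assumes "\<theta> \<in> bimod_hom A E F"
  shows "\<theta> \<in> bimod_hom A (conj_bimod A E) (conj_bimod A F)"
  by (intro bimod_homI) (use bimod_homD[OF assms] bimod_hom_extensional[OF assms] in auto)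

text \<open>Simplification unfolds the operations of a conjugate, after which
  \<open>bimod_homD\<close> no longer matches. These versions speak of E itself; they are the
  instances at \<open>cnj c\<close> and \<open>star A a\<close>, where the second conjugation
  cancels.\<close>

lemma bimod_hom_conjD:
  assumes "\<theta> \<in> bimod_hom A (conj_bimod A E) F" "bimodule A E"
  shows "e \<in> carrier E \<Longrightarrow> \<theta> e \<in> carrier F"
    and "\<lbrakk>e \<in> carrier E; e' \<in> carrier E\<rbrakk> \<Longrightarrow> \<theta> (e \<oplus>\<^bsub>E\<^esub> e') = \<theta> e \<oplus>\<^bsub>F\<^esub> \<theta> e'"
    and "e \<in> carrier E \<Longrightarrow> \<theta> (c \<odot>\<^bsub>E\<^esub> e) = cnj c \<odot>\<^bsub>F\<^esub> \<theta> e"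
    and "\<lbrakk>a \<in> carrier A; e \<in> carrier E\<rbrakk> \<Longrightarrow> \<theta> (a \<rhd>\<^bsub>E\<^esub> e) = \<theta> e \<lhd>\<^bsub>F\<^esub> star A a"
    and "\<lbrakk>a \<in> carrier A; e \<in> carrier E\<rbrakk> \<Longrightarrow> \<theta> (e \<lhd>\<^bsub>E\<^esub> a) = star A a \<rhd>\<^bsub>F\<^esub> \<theta> e"
  using bimod_homD(1,2)[OF assms(1)] bimod_homD(3)[OF assms(1), of e "cnj c"]
    bimod_homD(4)[OF assms(1), of "star A a"] bimod_homD(5)[OF assms(1), of "star A a"] by auto

definition bimod_iso :: "'u bimod \<Rightarrow> 'u bimod \<Rightarrow> ('u \<Rightarrow> 'u) \<Rightarrow> bool" where
  "bimod_iso E F \<theta> \<longleftrightarrow> \<theta> \<in> bimod_hom A E F \<and> bij_betw \<theta> (carrier E) (carrier F)"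

lemma bimod_isoI:
  assumes "\<theta> \<in> bimod_hom A E F" "\<And>f. f \<in> carrier F \<Longrightarrow> \<phi> f \<in> carrier E"
    and "\<And>e. e \<in> carrier E \<Longrightarrow> \<phi> (\<theta> e) = e" "\<And>f. f \<in> carrier F \<Longrightarrow> \<theta> (\<phi> f) = f"
  shows "bimod_iso E F \<theta>"
  unfolding bimod_iso_def using assms bimod_homD(1)[OF assms(1)]
  by (auto intro!: bij_betw_byWitness[where f' = \<phi>])

lemma bimod_iso_hom: "bimod_iso E F \<theta> \<Longrightarrow> \<theta> \<in> bimod_hom A E F"
  by (simp add: bimod_iso_def)

lemma map_inverse_simps:
  assumes "bimod_iso E F \<theta>"
  shows "e \<in> carrier E \<Longrightarrow> map_inverse E F \<theta> (\<theta> e) = e"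
    and "f \<in> carrier F \<Longrightarrow> \<theta> (map_inverse E F \<theta> f) = f"
    and "f \<in> carrier F \<Longrightarrow> map_inverse E F \<theta> f \<in> carrier E"
  using assms unfolding bimod_iso_def map_inverse_def
  by (auto simp: bij_betw_def f_inv_into_f inv_into_into)

lemma map_inverse_eqI:
  assumes "bimod_iso E F \<theta>" "e \<in> carrier E" "\<theta> e = f"
  shows "map_inverse E F \<theta> f = e"
  using assms map_inverse_simps(1) by blast

lemma map_inverse_iso:
  assumes "bimod_iso E F \<theta>" "bimodule A E"
  shows "bimod_iso F E (map_inverse E F \<theta>)"
proof (rule bimod_isoI)
  note inv = map_inverse_simps[OF assms(1)] map_inverse_eqI[OF assms(1)]
  show "map_inverse E F \<theta> \<in> bimod_hom A F E"
    by (rule bimod_homI)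
      (use assms(2) inv bimod_homD[OF bimod_iso_hom[OF assms(1)]] in \<open>auto simp: map_inverse_def[of _ _ _] intro!: inv(4)\<close>)
qed (use map_inverse_simps[OF assms(1)] bimod_homD(1)[OF bimod_iso_hom[OF assms(1)]] in auto)

lemmas map_inverse_hom = bimod_iso_hom[OF map_inverse_iso]

lemma bimod_iso_compose:
  assumes "bimod_iso E F \<theta>" "bimod_iso F G \<phi>" "bimodule A E"
  shows "bimod_iso E G (compose (carrier E) \<phi> \<theta>)"
  using assms bij_betw_compose bimod_hom_compose unfolding bimod_iso_def by blast

lemma bimod_iso_conj: "bimod_iso E F \<theta> \<Longrightarrow> bimod_iso (conj_bimod A E) (conj_bimod A F) \<theta>"
  by (simp add: bimod_iso_def bimod_hom_conj)

lemma id_map_iso: "bimodule A E \<Longrightarrow> bimod_iso E E (id_map E)"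
  by (rule bimod_isoI[where \<phi> = id]) (auto intro: id_map_hom)

end

section \<open>Universal property of the tensor product\<close>

context infinite_star_algebra
begin

text \<open>These are the conditions imposed by the congruence. Linearity is kept apart because the
  maps to be lifted include the semilinear flip and the derivative, which does not commute with the
  actions of A.\<close>

definition balanced_map :: "'u bimod \<Rightarrow> 'u bimod \<Rightarrow> 'u bimod \<Rightarrow> ('u \<Rightarrow> 'u \<Rightarrow> 'u) \<Rightarrow> bool" where
  "balanced_map E F T h \<longleftrightarrow>
     (\<forall>e\<in>carrier E. \<forall>f\<in>carrier F. h e f \<in> carrier T) \<and>
     (\<forall>e\<in>carrier E. \<forall>e'\<in>carrier E. \<forall>f\<in>carrier F. h (e \<oplus>\<^bsub>E\<^esub> e') f = h e f \<oplus>\<^bsub>T\<^esub> h e' f) \<and>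
     (\<forall>e\<in>carrier E. \<forall>f\<in>carrier F. \<forall>f'\<in>carrier F. h e (f \<oplus>\<^bsub>F\<^esub> f') = h e f \<oplus>\<^bsub>T\<^esub> h e f') \<and>
     (\<forall>a\<in>carrier A. \<forall>e\<in>carrier E. \<forall>f\<in>carrier F. h (e \<lhd>\<^bsub>E\<^esub> a) f = h e (a \<rhd>\<^bsub>F\<^esub> f))"

context
  fixes E F T h
  assumes E: "bimodule A E" and F: "bimodule A F" and T: "bimodule A T"
    and h: "balanced_map E F T h"
begin

abbreviation (input) list_value where
  "list_value l \<equiv> foldr (\<lambda>(e, f) s. h e f \<oplus>\<^bsub>T\<^esub> s) l \<zero>\<^bsub>T\<^esub>"

lemma list_value_closed:
  assumes "l \<in> lists (carrier E \<times> carrier F)"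
  shows "list_value l \<in> carrier T"
  using assms by induct (use T h in \<open>auto simp: balanced_map_def\<close>)

lemma list_value_append:
  assumes "l \<in> lists (carrier E \<times> carrier F)" "k \<in> lists (carrier E \<times> carrier F)"
  shows "list_value (l @ k) = list_value l \<oplus>\<^bsub>T\<^esub> list_value k"
  using assms(1)
proof induct
  case Nil
  then show ?case using list_value_closed[OF assms(2)] T by simp
next
  case (Cons x l)
  then show ?case using list_value_closed[OF assms(2)] list_value_closed[OF Cons(2)] T h
    by (auto simp: balanced_map_def bimodule_add_ac)
qed

text \<open>Well-definedness of the lift: every rule of the congruence mirrors a property of
  \<open>h\<close> or a law of addition in T. Symmetry and transitivity pass through other lists,
  whose entries stay in the carriers by \<open>tensor_eq_lists\<close>.\<close>

lemma list_value_cong: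
  assumes "tensor_eq A E F l k" "l \<in> lists (carrier E \<times> carrier F)"
  shows "list_value l = list_value k"
  using assms
proof (induct rule: tensor_eq.induct)
  case (sym l k)
  then show ?case using tensor_eq_lists E F by metis
next
  case (trans j k l)
  then show ?case using tensor_eq_lists E F by metis
next
  case (cong l k p q)
  then have "p \<in> lists (carrier E \<times> carrier F)" "q \<in> lists (carrier E \<times> carrier F)"
    "l \<in> lists (carrier E \<times> carrier F)" "k \<in> lists (carrier E \<times> carrier F)"
    using tensor_eq_lists[OF cong(1) E F] by auto
  then show ?case
    using cong(2) by (simp add: list_value_append del: foldr_append in_lists_conv_set)
next
  case (comm x y)
  then show ?case using T h by (auto simp: balanced_map_def bimodule_add_ac)
next
  case (zero f)
  have "h \<zero>\<^bsub>E\<^esub> f \<oplus>\<^bsub>T\<^esub> h \<zero>\<^bsub>E\<^esub> f = h (\<zero>\<^bsub>E\<^esub> \<oplus>\<^bsub>E\<^esub> \<zero>\<^bsub>E\<^esub>) f"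
    using h zero bimodule_add_simps(2)[OF E] unfolding balanced_map_def by metis
  then have "h \<zero>\<^bsub>E\<^esub> f = \<zero>\<^bsub>T\<^esub>"
    using h zero E T by (intro zero_unique[OF T]) (auto simp: balanced_map_def)
  then show ?case using T by simp
qed (use E F T h in \<open>auto simp: balanced_map_def\<close>)

lemma tensor_lift_class:
  assumes "l \<in> lists (carrier E \<times> carrier F)"
  shows "tensor_lift A E F T h (tensor_class A E F l) = list_value l"
  using list_value_cong[OF tensor_eq_rep assms] tensor_class_closed[OF assms]
  by (simp add: tensor_lift_def)

lemma tensor_lift_elt:
  "e \<in> carrier E \<Longrightarrow> f \<in> carrier F \<Longrightarrow> tensor_lift A E F T h (elt E F e f) = h e f"
  using h T by (simp add: tensor_elt_def tensor_lift_class balanced_map_def)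

lemma tensor_lift_additive: "tensor_lift A E F T h \<in> additive_map (E \<boxtimes> F) T"
proof -
  have "tensor_lift A E F T h (s \<oplus>\<^bsub>E \<boxtimes> F\<^esub> t) = tensor_lift A E F T h s \<oplus>\<^bsub>T\<^esub> tensor_lift A E F T h t"
    if st: "s \<in> carrier (E \<boxtimes> F)" "t \<in> carrier (E \<boxtimes> F)" for s t
  proof -
    obtain l k where "l \<in> lists (carrier E \<times> carrier F)" "k \<in> lists (carrier E \<times> carrier F)"
      "s = tensor_class A E F l" "t = tensor_class A E F k"
      using st by (auto simp: tensor_carrier)
    then show ?thesis
      by (simp add: tensor_add_class tensor_lift_class list_value_append
          del: foldr_append in_lists_conv_set)
  qed
  moreover have "tensor_lift A E F T h t \<in> carrier T" if "t \<in> carrier (E \<boxtimes> F)" for t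
    using that tensor_lift_class list_value_closed unfolding tensor_carrier by force
  ultimately show ?thesis
    by (auto simp: additive_map_def tensor_lift_def)
qed

lemma tensor_lift_hom:
  assumes "\<And>c e f. \<lbrakk>e \<in> carrier E; f \<in> carrier F\<rbrakk> \<Longrightarrow> h (c \<odot>\<^bsub>E\<^esub> e) f = c \<odot>\<^bsub>T\<^esub> h e f"
    and "\<And>a e f. \<lbrakk>a \<in> carrier A; e \<in> carrier E; f \<in> carrier F\<rbrakk> \<Longrightarrow> h (a \<rhd>\<^bsub>E\<^esub> e) f = a \<rhd>\<^bsub>T\<^esub> h e f"
    and "\<And>a e f. \<lbrakk>a \<in> carrier A; e \<in> carrier E; f \<in> carrier F\<rbrakk> \<Longrightarrow> h e (f \<lhd>\<^bsub>F\<^esub> a) = h e f \<lhd>\<^bsub>T\<^esub> a"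
  shows "tensor_lift A E F T h \<in> bimod_hom A (E \<boxtimes> F) T"
proof (rule bimod_homI)
  note add = additive_mapD[OF tensor_lift_additive]
  show "tensor_lift A E F T h \<in> extensional (carrier (E \<boxtimes> F))"
    by (rule add(3))
  fix t
  assume t: "t \<in> carrier (E \<boxtimes> F)"
  show "tensor_lift A E F T h t \<in> carrier T"
    using t by (rule add(1))
  show "tensor_lift A E F T h (c \<odot>\<^bsub>E \<boxtimes> F\<^esub> t) = c \<odot>\<^bsub>T\<^esub> tensor_lift A E F T h t" for c
    using t E F
  proof (induct rule: tensor_induct)
    case (elt e f)
    then show ?case
      using E assms by (simp add: tensor_lift_elt flip: tensor_elt_smult_left)
  qed (use E F T add in simp)
  show "tensor_lift A E F T h (a \<rhd>\<^bsub>E \<boxtimes> F\<^esub> t) = a \<rhd>\<^bsub>T\<^esub> tensor_lift A E F T h t"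
    if "a \<in> carrier A" for a
    using t E F
  proof (induct rule: tensor_induct)
    case (elt e f)
    then show ?case
      using E assms that by (simp add: tensor_lift_elt flip: tensor_elt_lact)
  qed (use E F T add that in simp)
  show "tensor_lift A E F T h (t \<lhd>\<^bsub>E \<boxtimes> F\<^esub> a) = tensor_lift A E F T h t \<lhd>\<^bsub>T\<^esub> a"
    if "a \<in> carrier A" for a
    using t E F
  proof (induct rule: tensor_induct)
    case (elt e f)
    then show ?case
      using F assms that by (simp add: tensor_lift_elt flip: tensor_elt_ract)
  qed (use E F T add that in simp)
qed (use additive_mapD[OF tensor_lift_additive] in auto)

end

text \<open>A lift evaluates \<open>h\<close> on the entries of a chosen list; agreement on the
  carriers suffices because that list has its entries there.\<close>

lemma tensor_lift_cong:
  assumes "bimodule A E" "bimodule A F"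
    and "\<And>e f. \<lbrakk>e \<in> carrier E; f \<in> carrier F\<rbrakk> \<Longrightarrow> h e f = h' e f"
  shows "tensor_lift A E F T h = tensor_lift A E F T h'"
proof -
  have "foldr (\<lambda>(e, f) s. h e f \<oplus>\<^bsub>T\<^esub> s) (tensor_rep t) \<zero>\<^bsub>T\<^esub>
      = foldr (\<lambda>(e, f) s. h' e f \<oplus>\<^bsub>T\<^esub> s) (tensor_rep t) \<zero>\<^bsub>T\<^esub>"
    if t: "t \<in> carrier (E \<boxtimes> F)" for t
  proof -
    have "tensor_rep t \<in> lists (carrier E \<times> carrier F)"
      using t tensor_eq_lists[OF tensor_eq_rep assms(1,2)] by (auto simp: tensor_carrier)
    then show ?thesis
      by (intro foldr_cong) (auto simp: assms(3))
  qed
  then show ?thesis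
    by (auto simp: tensor_lift_def)
qed

section \<open>Equality of maps tested on elementary tensors\<close>

lemma tensor_eqI:
  assumes "\<theta> \<in> additive_map (E \<boxtimes> F) T" "\<phi> \<in> additive_map (E \<boxtimes> F) T" "bimodule A E" "bimodule A F"
    and "\<And>e f. \<lbrakk>e \<in> carrier E; f \<in> carrier F\<rbrakk> \<Longrightarrow> \<theta> (elt E F e f) = \<phi> (elt E F e f)"
  shows "\<theta> = \<phi>"
proof (rule extensionalityI)
  fix t
  assume "t \<in> carrier (E \<boxtimes> F)"
  then show "\<theta> t = \<phi> t"
    using assms(3,4)
    by (induct rule: tensor_induct)
      (simp_all add: assms(5) additive_mapD[OF assms(1)] additive_mapD[OF assms(2)])
qed (use assms additive_mapD(3) in blast)+

text \<open>For a fixed last entry both maps are additive in the inner tensor, so a further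
  induction decomposes that as well. The bracketing to the left is that of the sources of the
  coherence laws.\<close>

lemma tensor3_eqI:
  assumes maps: "\<theta> \<in> additive_map ((E \<boxtimes> F) \<boxtimes> G) T" "\<phi> \<in> additive_map ((E \<boxtimes> F) \<boxtimes> G) T"
    and bims: "bimodule A E" "bimodule A F" "bimodule A G"
    and elts: "\<And>e f g. \<lbrakk>e \<in> carrier E; f \<in> carrier F; g \<in> carrier G\<rbrakk>
      \<Longrightarrow> \<theta> (elt (E \<boxtimes> F) G (elt E F e f) g) = \<phi> (elt (E \<boxtimes> F) G (elt E F e f) g)"
  shows "\<theta> = \<phi>"
proof (rule tensor_eqI[OF maps])
  fix t g
  assume t: "t \<in> carrier (E \<boxtimes> F)" and g: "g \<in> carrier G"
  show "\<theta> (elt (E \<boxtimes> F) G t g) = \<phi> (elt (E \<boxtimes> F) G t g)"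
    using t bims(1,2)
    by (induct rule: tensor_induct)
      (use g in \<open>simp_all add: elts additive_mapD[OF maps(1)] additive_mapD[OF maps(2)]\<close>)
qed (use bims in simp_all)

lemma tensor4_eqI:
  assumes maps: "\<theta> \<in> additive_map (((D \<boxtimes> E) \<boxtimes> F) \<boxtimes> G) T" "\<phi> \<in> additive_map (((D \<boxtimes> E) \<boxtimes> F) \<boxtimes> G) T"
    and bims: "bimodule A D" "bimodule A E" "bimodule A F" "bimodule A G"
    and elts: "\<And>d e f g. \<lbrakk>d \<in> carrier D; e \<in> carrier E; f \<in> carrier F; g \<in> carrier G\<rbrakk>
      \<Longrightarrow> \<theta> (elt ((D \<boxtimes> E) \<boxtimes> F) G (elt (D \<boxtimes> E) F (elt D E d e) f) g)
        = \<phi> (elt ((D \<boxtimes> E) \<boxtimes> F) G (elt (D \<boxtimes> E) F (elt D E d e) f) g)"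
  shows "\<theta> = \<phi>"
proof (rule tensor3_eqI[OF maps])
  fix t f g
  assume t: "t \<in> carrier (D \<boxtimes> E)" and fg: "f \<in> carrier F" "g \<in> carrier G"
  show "\<theta> (elt ((D \<boxtimes> E) \<boxtimes> F) G (elt (D \<boxtimes> E) F t f) g) = \<phi> (elt ((D \<boxtimes> E) \<boxtimes> F) G (elt (D \<boxtimes> E) F t f) g)"
    using t bims(1,2)
    by (induct rule: tensor_induct)
      (use fg in \<open>simp_all add: elts additive_mapD[OF maps(1)] additive_mapD[OF maps(2)]\<close>)
qed (use bims in simp_all)

end

section \<open>The structure maps of the bar category of bimodules\<close>

context infinite_star_algebra
begin

text \<open>Once the operations of a conjugate are unfolded, the general rules for elementary
  tensors no longer match; these are the same rules in unfolded form. The right action of E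
  reappears as the left action of its conjugate.\<close>

lemma tensor_elt_conj_simps [simp]:
  assumes "bimodule A E" "bimodule A F" "e \<in> carrier E" "f \<in> carrier F"
  shows "e' \<in> carrier E \<Longrightarrow> elt (conj_bimod A E) F (e \<oplus>\<^bsub>E\<^esub> e') f
      = elt (conj_bimod A E) F e f \<oplus>\<^bsub>conj_bimod A E \<boxtimes> F\<^esub> elt (conj_bimod A E) F e' f"
    and "f' \<in> carrier F \<Longrightarrow> elt E (conj_bimod A F) e (f \<oplus>\<^bsub>F\<^esub> f')
      = elt E (conj_bimod A F) e f \<oplus>\<^bsub>E \<boxtimes> conj_bimod A F\<^esub> elt E (conj_bimod A F) e f'"
    and "elt (conj_bimod A E) F (c \<odot>\<^bsub>E\<^esub> e) f = cnj c \<odot>\<^bsub>conj_bimod A E \<boxtimes> F\<^esub> elt (conj_bimod A E) F e f"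
    and "elt E (conj_bimod A F) e (c \<odot>\<^bsub>F\<^esub> f) = cnj c \<odot>\<^bsub>E \<boxtimes> conj_bimod A F\<^esub> elt E (conj_bimod A F) e f"
    and "a \<in> carrier A \<Longrightarrow> elt (conj_bimod A E) F (e \<lhd>\<^bsub>E\<^esub> a) f
      = star A a \<rhd>\<^bsub>conj_bimod A E \<boxtimes> F\<^esub> elt (conj_bimod A E) F e f"
    and "a \<in> carrier A \<Longrightarrow> elt E (conj_bimod A F) e (a \<rhd>\<^bsub>F\<^esub> f)
      = elt E (conj_bimod A F) e f \<lhd>\<^bsub>E \<boxtimes> conj_bimod A F\<^esub> star A a"
  using assms tensor_elt_add_left[of e "conj_bimod A E" e' f F]
    tensor_elt_add_right[of e E f "conj_bimod A F" f']
    tensor_elt_smult_left[of "conj_bimod A E" e f F "cnj c"]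
    tensor_elt_smult_right[of E "conj_bimod A F" e f "cnj c"]
    tensor_elt_lact[of "conj_bimod A E" "star A a" e f F]
    tensor_elt_ract[of "conj_bimod A F" "star A a" e E f]
  by simp_all

lemma tensor_elt_conj_balanced:
  assumes "bimodule A E" "bimodule A F" "e \<in> carrier E" "f \<in> carrier F" "a \<in> carrier A"
  shows "elt (conj_bimod A E) F (a \<rhd>\<^bsub>E\<^esub> e) f = elt (conj_bimod A E) F e (star A a \<rhd>\<^bsub>F\<^esub> f)"
    and "elt (conj_bimod A E) (conj_bimod A F) (a \<rhd>\<^bsub>E\<^esub> e) f
      = elt (conj_bimod A E) (conj_bimod A F) e (f \<lhd>\<^bsub>F\<^esub> a)"
  using assms tensor_elt_balanced[of "star A a" e "conj_bimod A E" f F]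
    tensor_elt_balanced[of "star A a" e "conj_bimod A E" f "conj_bimod A F"]
  by (simp_all del: tensor_elt_conj_simps)

lemma tensor_elt_regular_simps [simp]:
  assumes "bimodule A E" "e \<in> carrier E" "a \<in> carrier A" "b \<in> carrier A"
  shows "elt E (regular_bimod A) e (a \<oplus> b)
      = elt E (regular_bimod A) e a \<oplus>\<^bsub>E \<boxtimes> regular_bimod A\<^esub> elt E (regular_bimod A) e b"
    and "elt (regular_bimod A) E (a \<otimes> b) e = a \<rhd>\<^bsub>regular_bimod A \<boxtimes> E\<^esub> elt (regular_bimod A) E b e"
    and "elt E (regular_bimod A) e (a \<otimes> b) = elt E (regular_bimod A) e a \<lhd>\<^bsub>E \<boxtimes> regular_bimod A\<^esub> b"
    and "elt (regular_bimod A) E (c \<odot> a) e = c \<odot>\<^bsub>regular_bimod A \<boxtimes> E\<^esub> elt (regular_bimod A) E a e"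
    and "elt E (regular_bimod A) e (c \<odot> a) = c \<odot>\<^bsub>E \<boxtimes> regular_bimod A\<^esub> elt E (regular_bimod A) e a"
  using assms tensor_elt_add_right[of e E a "regular_bimod A" b]
    tensor_elt_lact[of "regular_bimod A" a b e E] tensor_elt_ract[of "regular_bimod A" b e E a]
    tensor_elt_smult_left[of "regular_bimod A" a e E c]
    tensor_elt_smult_right[of E "regular_bimod A" e a c]
  by simp_all

context
  fixes E E' F F' \<theta> \<phi>
  assumes bims: "bimodule A E" "bimodule A E'" "bimodule A F" "bimodule A F'"
    and homs: "\<theta> \<in> bimod_hom A E E'" "\<phi> \<in> bimod_hom A F F'"
begin

lemma tensor_map_balanced:
  "balanced_map E F (E' \<boxtimes> F') (\<lambda>e f. elt E' F' (\<theta> e) (\<phi> f))"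
  using bims bimod_homD[OF homs(1)] bimod_homD[OF homs(2)] tensor_elt_balanced[of _ _ E' _ F']
  by (simp add: balanced_map_def del: tensor_elt_simps)

lemma tensor_map_elt [simp]:
  "\<lbrakk>e \<in> carrier E; f \<in> carrier F\<rbrakk>
    \<Longrightarrow> tensor_map A E E' F F' \<theta> \<phi> (elt E F e f) = elt E' F' (\<theta> e) (\<phi> f)"
  unfolding tensor_map_def using bims tensor_map_balanced by (simp add: tensor_lift_elt)

lemma tensor_map_hom: "tensor_map A E E' F F' \<theta> \<phi> \<in> bimod_hom A (E \<boxtimes> F) (E' \<boxtimes> F')"
  unfolding tensor_map_def using bims tensor_map_balanced bimod_homD[OF homs(1)] bimod_homD[OF homs(2)]
  by (intro tensor_lift_hom) auto

lemmas tensor_map_simps [simp] = bimod_homD[OF tensor_map_hom]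

end

lemma tensor_map_iso:
  assumes "bimodule A E" "bimodule A E'" "bimodule A F" "bimodule A F'"
    and "bimod_iso E E' \<theta>" "bimod_iso F F' \<phi>"
  shows "bimod_iso (E \<boxtimes> F) (E' \<boxtimes> F') (tensor_map A E E' F F' \<theta> \<phi>)"
proof (rule bimod_isoI)
  let ?\<theta>' = "map_inverse E E' \<theta>" and ?\<phi>' = "map_inverse F F' \<phi>"
  let ?\<psi> = "tensor_map A E' E F' F ?\<theta>' ?\<phi>'"
  note homs = assms(5,6)[THEN bimod_iso_hom] map_inverse_hom[OF assms(5,1)] map_inverse_hom[OF assms(6,3)]
  note inv = map_inverse_simps[OF assms(5)] map_inverse_simps[OF assms(6)]
    bimod_homD(1)[OF homs(1)] bimod_homD(1)[OF homs(2)]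
  show "tensor_map A E E' F F' \<theta> \<phi> \<in> bimod_hom A (E \<boxtimes> F) (E' \<boxtimes> F')"
    using assms homs by (intro tensor_map_hom)
  show "?\<psi> t \<in> carrier (E \<boxtimes> F)" if "t \<in> carrier (E' \<boxtimes> F')" for t
    using that assms homs by simp
  show "?\<psi> (tensor_map A E E' F F' \<theta> \<phi> t) = t" if "t \<in> carrier (E \<boxtimes> F)" for t
    using that assms(1,3)
    by (induct rule: tensor_induct) (use assms homs inv in simp_all)
  show "tensor_map A E E' F F' \<theta> \<phi> (?\<psi> t) = t" if "t \<in> carrier (E' \<boxtimes> F')" for t
    using that assms(2,4)
    by (induct rule: tensor_induct) (use assms homs inv in simp_all)
qed

section \<open>The associator\<close>

context
  fixes E F G
  assumes bims [simp]: "bimodule A E" "bimodule A F" "bimodule A G"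
begin

lemma assoc_inner_elt:
  assumes "e \<in> carrier E" "f \<in> carrier F" "g \<in> carrier G"
  shows "tensor_lift A E F (E \<boxtimes> F \<boxtimes> G) (\<lambda>e f. elt E (F \<boxtimes> G) e (elt F G f g)) (elt E F e f)
    = elt E (F \<boxtimes> G) e (elt F G f g)"
  using assms tensor_elt_balanced[of _ _ E _ "F \<boxtimes> G"]
  by (intro tensor_lift_elt) (simp_all add: balanced_map_def flip: tensor_elt_lact)

lemma assoc_inner_additive:
  assumes "g \<in> carrier G"
  shows "tensor_lift A E F (E \<boxtimes> F \<boxtimes> G) (\<lambda>e f. elt E (F \<boxtimes> G) e (elt F G f g))
    \<in> additive_map (E \<boxtimes> F) (E \<boxtimes> F \<boxtimes> G)"
  using assms tensor_elt_balanced[of _ _ E _ "F \<boxtimes> G"]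
  by (intro tensor_lift_additive) (simp_all add: balanced_map_def flip: tensor_elt_lact)

private abbreviation (input) "outer t g \<equiv>
  tensor_lift A E F (E \<boxtimes> F \<boxtimes> G) (\<lambda>e f. elt E (F \<boxtimes> G) e (elt F G f g)) t"

lemma assoc_outer_simps:
  assumes "t \<in> carrier (E \<boxtimes> F)" "g \<in> carrier G"
  shows "outer t g \<in> carrier (E \<boxtimes> F \<boxtimes> G)"
    and "s \<in> carrier (E \<boxtimes> F) \<Longrightarrow> outer (s \<oplus>\<^bsub>E \<boxtimes> F\<^esub> t) g = outer s g \<oplus>\<^bsub>E \<boxtimes> F \<boxtimes> G\<^esub> outer t g"
  using assms additive_mapD[OF assoc_inner_additive] by auto

text \<open>In the inner lift g is a mere parameter, so the behaviour in g does not come from the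
  lifting and is obtained by induction on t. Only then can the map be lifted in the pair of t and
  g.\<close>

lemma assoc_outer_linear:
  assumes t: "t \<in> carrier (E \<boxtimes> F)" and g: "g \<in> carrier G"
  shows "g' \<in> carrier G \<Longrightarrow> outer t (g \<oplus>\<^bsub>G\<^esub> g') = outer t g \<oplus>\<^bsub>E \<boxtimes> F \<boxtimes> G\<^esub> outer t g'"
    and "outer (c \<odot>\<^bsub>E \<boxtimes> F\<^esub> t) g = c \<odot>\<^bsub>E \<boxtimes> F \<boxtimes> G\<^esub> outer t g"
    and "a \<in> carrier A \<Longrightarrow> outer (t \<lhd>\<^bsub>E \<boxtimes> F\<^esub> a) g = outer t (a \<rhd>\<^bsub>G\<^esub> g)"
    and "a \<in> carrier A \<Longrightarrow> outer (a \<rhd>\<^bsub>E \<boxtimes> F\<^esub> t) g = a \<rhd>\<^bsub>E \<boxtimes> F \<boxtimes> G\<^esub> outer t g"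
    and "a \<in> carrier A \<Longrightarrow> outer t (g \<lhd>\<^bsub>G\<^esub> a) = outer t g \<lhd>\<^bsub>E \<boxtimes> F \<boxtimes> G\<^esub> a"
proof -
  note simps = assoc_inner_elt assoc_outer_simps
  show "outer t (g \<oplus>\<^bsub>G\<^esub> g') = outer t g \<oplus>\<^bsub>E \<boxtimes> F \<boxtimes> G\<^esub> outer t g'" if "g' \<in> carrier G"
    using t bims(1,2) by (induct rule: tensor_induct)
      (use g that in \<open>simp_all add: simps bimodule_add_ac\<close>)
  show "outer (c \<odot>\<^bsub>E \<boxtimes> F\<^esub> t) g = c \<odot>\<^bsub>E \<boxtimes> F \<boxtimes> G\<^esub> outer t g"
    using t bims(1,2)
  proof (induct rule: tensor_induct)
    case (elt e f)
    then show ?case using g by (simp add: simps flip: tensor_elt_smult_left)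
  qed (use g in \<open>simp_all add: simps\<close>)
  show "outer (t \<lhd>\<^bsub>E \<boxtimes> F\<^esub> a) g = outer t (a \<rhd>\<^bsub>G\<^esub> g)" if "a \<in> carrier A"
    using t bims(1,2)
  proof (induct rule: tensor_induct)
    case (elt e f)
    then show ?case using g that
      by (simp add: simps tensor_elt_balanced flip: tensor_elt_ract)
  qed (use g that in \<open>simp_all add: simps\<close>)
  show "outer (a \<rhd>\<^bsub>E \<boxtimes> F\<^esub> t) g = a \<rhd>\<^bsub>E \<boxtimes> F \<boxtimes> G\<^esub> outer t g" if "a \<in> carrier A"
    using t bims(1,2)
  proof (induct rule: tensor_induct)
    case (elt e f)
    then show ?case using g that by (simp add: simps flip: tensor_elt_lact)
  qed (use g that in \<open>simp_all add: simps\<close>)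
  show "outer t (g \<lhd>\<^bsub>G\<^esub> a) = outer t g \<lhd>\<^bsub>E \<boxtimes> F \<boxtimes> G\<^esub> a" if "a \<in> carrier A"
    using t bims(1,2) by (induct rule: tensor_induct)
      (use g that in \<open>simp_all add: simps\<close>)
qed

lemma bimod_assoc_elt [simp]:
  assumes "e \<in> carrier E" "f \<in> carrier F" "g \<in> carrier G"
  shows "bimod_assoc A E F G (elt (E \<boxtimes> F) G (elt E F e f) g) = elt E (F \<boxtimes> G) e (elt F G f g)"
  unfolding bimod_assoc_def Let_def using assms assoc_inner_elt
  by (subst tensor_lift_elt) (auto simp: balanced_map_def assoc_outer_simps assoc_outer_linear)

lemma bimod_assoc_hom: "bimod_assoc A E F G \<in> bimod_hom A ((E \<boxtimes> F) \<boxtimes> G) (E \<boxtimes> (F \<boxtimes> G))"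
  unfolding bimod_assoc_def Let_def
  by (intro tensor_lift_hom) (auto simp: balanced_map_def assoc_outer_simps assoc_outer_linear)

lemmas bimod_assoc_simps [simp] = bimod_homD[OF bimod_assoc_hom]

end

section \<open>The flip and its inverse\<close>

context
  fixes E F
  assumes bims [simp]: "bimodule A E" "bimodule A F"
begin

text \<open>In the conjugates \<open>e \<lhd> a\<close> and \<open>a \<rhd> f\<close> are actions of
  \<open>star A a\<close> from the opposite sides. After the flip, balance at \<open>a\<close> is
  therefore balance at \<open>star A a\<close>.\<close>

lemma Upsilon_balanced:
  "balanced_map E F (conj_bimod A F \<boxtimes> conj_bimod A E) (\<lambda>e f. elt (conj_bimod A F) (conj_bimod A E) f e)"
  by (simp add: balanced_map_def tensor_elt_conj_balanced del: tensor_elt_conj_simps(5,6))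

lemma bimod_Upsilon_elt [simp]:
  "\<lbrakk>e \<in> carrier E; f \<in> carrier F\<rbrakk>
    \<Longrightarrow> bimod_Upsilon A E F (elt E F e f) = elt (conj_bimod A F) (conj_bimod A E) f e"
  unfolding bimod_Upsilon_def using Upsilon_balanced by (simp add: tensor_lift_elt)

text \<open>\<open>tensor_lift_hom\<close> does not apply, the map being semilinear on E \<boxtimes>
  F itself. Only additivity comes from the lifting; conjugated scalars and exchanged actions are
  handled by induction.\<close>

lemma bimod_Upsilon_hom:
  "bimod_Upsilon A E F \<in> bimod_hom A (conj_bimod A (E \<boxtimes> F)) (conj_bimod A F \<boxtimes> conj_bimod A E)"
proof (rule bimod_homI)
  note add = additive_mapD[OF tensor_lift_additive[OF _ _ _ Upsilon_balanced, folded bimod_Upsilon_def], simplified]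
  show "bimod_Upsilon A E F \<in> extensional (carrier (conj_bimod A (E \<boxtimes> F)))"
    using add by simp
  fix t
  assume "t \<in> carrier (conj_bimod A (E \<boxtimes> F))"
  then have t: "t \<in> carrier (E \<boxtimes> F)" by simp
  show "bimod_Upsilon A E F t \<in> carrier (conj_bimod A F \<boxtimes> conj_bimod A E)"
    using t add by simp
  show "bimod_Upsilon A E F (t \<oplus>\<^bsub>conj_bimod A (E \<boxtimes> F)\<^esub> s)
      = bimod_Upsilon A E F t \<oplus>\<^bsub>conj_bimod A F \<boxtimes> conj_bimod A E\<^esub> bimod_Upsilon A E F s"
    if "s \<in> carrier (conj_bimod A (E \<boxtimes> F))" for s
    using t that add by simp
  show "bimod_Upsilon A E F (c \<odot>\<^bsub>conj_bimod A (E \<boxtimes> F)\<^esub> t)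
      = c \<odot>\<^bsub>conj_bimod A F \<boxtimes> conj_bimod A E\<^esub> bimod_Upsilon A E F t" for c
    using t bims
  proof (induct rule: tensor_induct)
    case (elt e f)
    then show ?case by (simp del: tensor_elt_smult_left flip: tensor_elt_smult_left[of E])
  qed (use add in simp)
  fix a assume a: "a \<in> carrier A"
  show "bimod_Upsilon A E F (a \<rhd>\<^bsub>conj_bimod A (E \<boxtimes> F)\<^esub> t)
      = a \<rhd>\<^bsub>conj_bimod A F \<boxtimes> conj_bimod A E\<^esub> bimod_Upsilon A E F t"
    using t bims
  proof (induct rule: tensor_induct)
    case (elt e f)
    then show ?case using a by (simp del: tensor_elt_ract flip: tensor_elt_ract[of F])
  qed (use a add in simp)
  show "bimod_Upsilon A E F (t \<lhd>\<^bsub>conj_bimod A (E \<boxtimes> F)\<^esub> a)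
      = bimod_Upsilon A E F t \<lhd>\<^bsub>conj_bimod A F \<boxtimes> conj_bimod A E\<^esub> a"
    using t bims
  proof (induct rule: tensor_induct)
    case (elt e f)
    then show ?case using a by (simp del: tensor_elt_lact flip: tensor_elt_lact[of E])
  qed (use a add in simp)
qed

lemmas bimod_Upsilon_simps [simp] = bimod_hom_conjD[OF bimod_Upsilon_hom, OF tensor_bimodule, OF bims]

end

lemma bimod_Upsilon_iso:
  assumes [simp]: "bimodule A E" "bimodule A F"
  shows "bimod_iso (conj_bimod A (E \<boxtimes> F)) (conj_bimod A F \<boxtimes> conj_bimod A E) (bimod_Upsilon A E F)"
proof (rule bimod_isoI[OF bimod_Upsilon_hom])
  let ?h = "\<lambda>f e. elt E F e f"
  \<comment> \<open>The flip of the conjugates would end in a tensor product of double conjugates,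
    so the inverse is lifted anew with values in E \<boxtimes> F.\<close>
  let ?\<psi> = "tensor_lift A (conj_bimod A F) (conj_bimod A E) (E \<boxtimes> F) ?h"
  have balanced: "balanced_map (conj_bimod A F) (conj_bimod A E) (E \<boxtimes> F) ?h"
    by (auto simp: balanced_map_def tensor_elt_balanced simp del: tensor_elt_lact tensor_elt_ract)
  have elt: "?\<psi> (elt (conj_bimod A F) (conj_bimod A E) f e) = elt E F e f"
    if "e \<in> carrier E" "f \<in> carrier F" for e f
    using that by (simp add: tensor_lift_elt[OF _ _ _ balanced])
  note add = additive_mapD[OF tensor_lift_additive[OF _ _ _ balanced], simplified]
  show "?\<psi> t \<in> carrier (conj_bimod A (E \<boxtimes> F))" if "t \<in> carrier (conj_bimod A F \<boxtimes> conj_bimod A E)" for t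
    using that add by simp
  show "?\<psi> (bimod_Upsilon A E F t) = t" if "t \<in> carrier (conj_bimod A (E \<boxtimes> F))" for t
    using that[simplified] assms by (induct rule: tensor_induct) (simp_all add: elt add)
  show "bimod_Upsilon A E F (?\<psi> t) = t" if "t \<in> carrier (conj_bimod A F \<boxtimes> conj_bimod A E)" for t
    using that conj_bimodule[OF assms(2)] conj_bimodule[OF assms(1)]
    by (induct rule: tensor_induct) (simp_all add: elt add)
qed simp_all

abbreviation Upsilon_inv where
  "Upsilon_inv E F \<equiv> map_inverse (conj_bimod A (E \<boxtimes> F)) (conj_bimod A F \<boxtimes> conj_bimod A E) (bimod_Upsilon A E F)"

context
  fixes E F
  assumes bims [simp]: "bimodule A E" "bimodule A F"
begin

lemma Upsilon_inv_elt [simp]: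
  "\<lbrakk>e \<in> carrier E; f \<in> carrier F\<rbrakk> \<Longrightarrow> Upsilon_inv E F (elt (conj_bimod A F) (conj_bimod A E) f e) = elt E F e f"
  by (rule map_inverse_eqI[OF bimod_Upsilon_iso]) simp_all

lemma Upsilon_inv_hom:
  "Upsilon_inv E F \<in> bimod_hom A (conj_bimod A F \<boxtimes> conj_bimod A E) (conj_bimod A (E \<boxtimes> F))"
  by (intro map_inverse_hom bimod_Upsilon_iso) simp_all

lemmas Upsilon_inv_simps [simp] = bimod_homD[OF Upsilon_inv_hom, simplified]

end

text \<open>Conjugation exchanges the two ways of bracketing, so the inverse of the associator is obtained
  from the associator of the conjugate bimodules.\<close>

lemma bimod_assoc_iso:
  assumes [simp]: "bimodule A E" "bimodule A F" "bimodule A G"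
  shows "bimod_iso ((E \<boxtimes> F) \<boxtimes> G) (E \<boxtimes> (F \<boxtimes> G)) (bimod_assoc A E F G)"
proof (rule bimod_isoI[OF bimod_assoc_hom])
  let ?E = "conj_bimod A E" and ?F = "conj_bimod A F" and ?G = "conj_bimod A G"
  let ?\<alpha> = "tensor_map A (conj_bimod A (F \<boxtimes> G)) (?G \<boxtimes> ?F) ?E ?E (bimod_Upsilon A F G) (id_map ?E)"
  let ?\<beta> = "tensor_map A ?G ?G (?F \<boxtimes> ?E) (conj_bimod A (E \<boxtimes> F)) (id_map ?G) (Upsilon_inv E F)"
  let ?\<psi> = "\<lambda>t. Upsilon_inv (E \<boxtimes> F) G (?\<beta> (bimod_assoc A ?G ?F ?E (?\<alpha> (bimod_Upsilon A E (F \<boxtimes> G) t))))"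
  have [simp]: "bimod_Upsilon A F G \<in> bimod_hom A (conj_bimod A (F \<boxtimes> G)) (?G \<boxtimes> ?F)"
    "Upsilon_inv E F \<in> bimod_hom A (?F \<boxtimes> ?E) (conj_bimod A (E \<boxtimes> F))"
    "id_map E \<in> bimod_hom A ?E ?E" "id_map G \<in> bimod_hom A ?G ?G"
    using id_map_hom[of ?E] id_map_hom[of ?G] by (simp_all add: bimod_Upsilon_hom Upsilon_inv_hom)
  have [simp]: "?\<psi> (elt E (F \<boxtimes> G) e (elt F G f g)) = elt (E \<boxtimes> F) G (elt E F e f) g"
    if "e \<in> carrier E" "f \<in> carrier F" "g \<in> carrier G" for e f g
    using that by simp
  have closed: "?\<psi> t \<in> carrier ((E \<boxtimes> F) \<boxtimes> G)" if "t \<in> carrier (E \<boxtimes> (F \<boxtimes> G))" for t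
    using that by simp
  then show "?\<psi> t \<in> carrier ((E \<boxtimes> F) \<boxtimes> G)" if "t \<in> carrier (E \<boxtimes> (F \<boxtimes> G))" for t
    using that .
  have add: "?\<psi> (s \<oplus>\<^bsub>E \<boxtimes> (F \<boxtimes> G)\<^esub> t) = ?\<psi> s \<oplus>\<^bsub>(E \<boxtimes> F) \<boxtimes> G\<^esub> ?\<psi> t"
    if "s \<in> carrier (E \<boxtimes> (F \<boxtimes> G))" "t \<in> carrier (E \<boxtimes> (F \<boxtimes> G))" for s t
    using that by simp
  show "?\<psi> (bimod_assoc A E F G t) = t" if "t \<in> carrier ((E \<boxtimes> F) \<boxtimes> G)" for t
    using that tensor_bimodule[OF assms(1,2)] assms(3)
  proof (induct rule: tensor_induct)
    case (elt s g)
    from elt(1) assms(1,2) show ?case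
      by (induct rule: tensor_induct) (use elt(2) in simp_all)
  qed simp
  show "bimod_assoc A E F G (?\<psi> t) = t" if "t \<in> carrier (E \<boxtimes> (F \<boxtimes> G))" for t
    using that assms(1) tensor_bimodule[OF assms(2,3)]
  proof (induct rule: tensor_induct)
    case (elt e s)
    from elt(2) assms(2,3) show ?case
      by (induct rule: tensor_induct) (use elt(1) in simp_all)
  qed simp
qed simp_all

abbreviation assoc_inv where
  "assoc_inv E F G \<equiv> map_inverse ((E \<boxtimes> F) \<boxtimes> G) (E \<boxtimes> (F \<boxtimes> G)) (bimod_assoc A E F G)"

context
  fixes E F G
  assumes bims [simp]: "bimodule A E" "bimodule A F" "bimodule A G"
begin

lemma assoc_inv_elt [simp]:
  "\<lbrakk>e \<in> carrier E; f \<in> carrier F; g \<in> carrier G\<rbrakk>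
    \<Longrightarrow> assoc_inv E F G (elt E (F \<boxtimes> G) e (elt F G f g)) = elt (E \<boxtimes> F) G (elt E F e f) g"
  by (rule map_inverse_eqI[OF bimod_assoc_iso]) simp_all

lemma assoc_inv_hom: "assoc_inv E F G \<in> bimod_hom A (E \<boxtimes> (F \<boxtimes> G)) ((E \<boxtimes> F) \<boxtimes> G)"
  by (intro map_inverse_hom bimod_assoc_iso) simp_all

lemmas assoc_inv_simps [simp] = bimod_homD[OF assoc_inv_hom]
  map_inverse_simps(1,2)[OF bimod_assoc_iso, OF bims]

end

section \<open>Unit isomorphisms\<close>

context
  fixes E
  assumes bims [simp]: "bimodule A E"
begin

lemma bimod_lunit_elt [simp]:
  "\<lbrakk>a \<in> carrier A; e \<in> carrier E\<rbrakk> \<Longrightarrow> bimod_lunit A E (elt (regular_bimod A) E a e) = a \<rhd>\<^bsub>E\<^esub> e"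
  unfolding bimod_lunit_def by (subst tensor_lift_elt) (simp_all add: balanced_map_def)

lemma bimod_lunit_hom: "bimod_lunit A E \<in> bimod_hom A (regular_bimod A \<boxtimes> E) E"
  unfolding bimod_lunit_def by (rule tensor_lift_hom) (simp_all add: balanced_map_def)

lemmas bimod_lunit_simps [simp] = bimod_homD[OF bimod_lunit_hom]

lemma bimod_lunit_iso: "bimod_iso (regular_bimod A \<boxtimes> E) E (bimod_lunit A E)"
proof (rule bimod_isoI[OF bimod_lunit_hom])
  show "elt (regular_bimod A) E \<one> (bimod_lunit A E t) = t" if "t \<in> carrier (regular_bimod A \<boxtimes> E)" for t
    using that regular_bimodule bims
  proof (induct rule: tensor_induct)
    case (elt a e)
    then show ?case
      using tensor_elt_balanced[of a \<one> "regular_bimod A" e E] by simp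
  qed simp
qed simp_all

lemma bimod_runit_elt [simp]:
  "\<lbrakk>a \<in> carrier A; e \<in> carrier E\<rbrakk> \<Longrightarrow> bimod_runit A E (elt E (regular_bimod A) e a) = e \<lhd>\<^bsub>E\<^esub> a"
  unfolding bimod_runit_def by (subst tensor_lift_elt) (simp_all add: balanced_map_def)

lemma bimod_runit_hom: "bimod_runit A E \<in> bimod_hom A (E \<boxtimes> regular_bimod A) E"
  unfolding bimod_runit_def by (rule tensor_lift_hom) (simp_all add: balanced_map_def)

lemmas bimod_runit_simps [simp] = bimod_homD[OF bimod_runit_hom]

lemma bimod_runit_iso: "bimod_iso (E \<boxtimes> regular_bimod A) E (bimod_runit A E)"
proof (rule bimod_isoI[OF bimod_runit_hom])
  show "elt E (regular_bimod A) (bimod_runit A E t) \<one> = t" if "t \<in> carrier (E \<boxtimes> regular_bimod A)" for t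
    using that bims regular_bimodule
  proof (induct rule: tensor_induct)
    case (elt e a)
    then show ?case
      using tensor_elt_balanced[of a e E \<one> "regular_bimod A"] by simp
  qed simp
qed simp_all

abbreviation runit_inv where
  "runit_inv \<equiv> map_inverse (E \<boxtimes> regular_bimod A) E (bimod_runit A E)"

lemma runit_inv_apply [simp]: "e \<in> carrier E \<Longrightarrow> runit_inv e = elt E (regular_bimod A) e \<one>"
  by (rule map_inverse_eqI[OF bimod_runit_iso]) simp_all

end

lemma restrict_star_iso:
  "bimod_iso (regular_bimod A) (conj_bimod A (regular_bimod A)) (\<lambda>a\<in>carrier A. star A a)"
  by (rule bimod_isoI[where \<phi> = "star A"], rule bimod_homI) auto

text \<open>\<open>star A\<close> is an involution on the carrier of A, so the double conjugate has
  the operations of E there, but as a record it may differ from E. Hence \<open>bb\<close> is the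
  identity of the underlying set between two possibly different objects.\<close>

lemma id_map_bb_iso: "bimodule A E \<Longrightarrow> bimod_iso E (conj_bimod A (conj_bimod A E)) (id_map E)"
  by (rule bimod_isoI[where \<phi> = id], rule bimod_homI) (auto simp: id_map_def)

end

section \<open>The bar category of bimodules\<close>

context category
begin

lemma is_inverse_unique:
  assumes "X \<in> Obj C" "Y \<in> Obj C" "is_inverse C X Y f g" "is_inverse C X Y f h"
  shows "g = h"
proof -
  have "g = comp C Y X X (comp C X Y X h f) g"
    using assms by (simp add: is_inverse_def comp_ident_left)
  also have "\<dots> = comp C Y Y X h (comp C Y X Y f g)"
    using assms unfolding is_inverse_def by (intro comp_assoc[symmetric]) auto
  also have "\<dots> = h"
    using assms by (simp add: is_inverse_def comp_ident_right)
  finally show ?thesis .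
qed

lemma inverse_mor_eqI:
  assumes "X \<in> Obj C" "Y \<in> Obj C" "is_inverse C X Y f g"
  shows "inverse_mor C X Y f = g"
  unfolding inverse_mor_def using assms is_inverse_unique by blast

end

context infinite_star_algebra
begin

lemma bimod_category_simps [simp]:
  "Obj (bimod_category A) = {E. bimodule A E}" "Hom (bimod_category A) = bimod_hom A"
  "ident (bimod_category A) = id_map"
  "comp (bimod_category A) E F G \<phi> \<theta> = compose (carrier E) \<phi> \<theta>"
  "tensor_ob (bimod_category A) = tensor_bimod A" "tensor_mor (bimod_category A) = tensor_map A"
  "unit_ob (bimod_category A) = regular_bimod A" "associator (bimod_category A) = bimod_assoc A"
  "lunitor (bimod_category A) = bimod_lunit A" "runitor (bimod_category A) = bimod_runit A"
  "bar_ob (bimod_category A) = conj_bimod A" "bar_mor (bimod_category A) E F \<theta> = \<theta>"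
  "Upsilon (bimod_category A) = bimod_Upsilon A" "bb (bimod_category A) = id_map"
  "unit_star (bimod_category A) = (\<lambda>a\<in>carrier A. star A a)"
  by (simp_all add: bimod_category_def)

lemma bimod_category: "category (bimod_category A)"
proof (rule category.intro, simp_all)
  show "compose (carrier X) (id_map Y) f = f" if "f \<in> bimod_hom A X Y" for X Y f
    using that by (auto simp: compose_def bimod_homD(1)[OF that] dest: bimod_hom_extensional
        intro!: extensionalityI[of _ "carrier X"])
  show "compose (carrier X) f (id_map X) = f" if "f \<in> bimod_hom A X Y" for X Y f
    using that by (auto simp: compose_def dest: bimod_hom_extensional
        intro!: extensionalityI[of _ "carrier X"])
  show "compose (carrier W) h (compose (carrier W) g f) = compose (carrier W) (compose (carrier X) h g) f"
    if "f \<in> bimod_hom A W X" for W X f g h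
    using bimod_homD(1)[OF that] by (auto simp: compose_def)
qed (auto intro: id_map_hom bimod_hom_compose)

lemma bimod_iso_is_inverse:
  assumes "bimod_iso E F \<theta>" "bimodule A E" "bimodule A F"
  shows "is_inverse (bimod_category A) E F \<theta> (map_inverse E F \<theta>)"
  using assms map_inverse_simps[OF assms(1)] bimod_homD(1)[OF bimod_iso_hom[OF assms(1)]]
  by (auto simp: is_inverse_def compose_def id_map_def bimod_iso_hom map_inverse_hom)

lemma bimod_iso_is_iso:
  "\<lbrakk>bimod_iso E F \<theta>; bimodule A E; bimodule A F\<rbrakk> \<Longrightarrow> is_iso (bimod_category A) E F \<theta>"
  using bimod_iso_is_inverse is_iso_def by metis

lemma bimod_is_iso_iff:
  assumes "bimodule A E" "bimodule A F"
  shows "is_iso (bimod_category A) E F \<theta> \<longleftrightarrow> bimod_iso E F \<theta>"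
proof
  assume "is_iso (bimod_category A) E F \<theta>"
  then obtain \<phi> where "\<theta> \<in> bimod_hom A E F" "\<phi> \<in> bimod_hom A F E"
    "compose (carrier E) \<phi> \<theta> = id_map E" "compose (carrier F) \<theta> \<phi> = id_map F"
    by (auto simp: is_iso_def is_inverse_def)
  then show "bimod_iso E F \<theta>"
    by (intro bimod_isoI[where \<phi> = \<phi>]) (auto simp: bimod_homD(1) id_map_def compose_def fun_eq_iff split: if_splits)
qed (use assms bimod_iso_is_iso in simp)

lemmas structure_homs =
  bimod_hom_compose tensor_map_hom bimod_assoc_hom bimod_Upsilon_hom bimod_lunit_hom bimod_runit_hom
  id_map_hom restrict_star_iso[THEN bimod_iso_hom] map_inverse_hom[OF restrict_star_iso]

lemma bimod_monoidal_category: "monoidal_category (bimod_category A)"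
proof (intro monoidal_category.intro monoidal_category_axioms.intro bimod_category, simp_all)
  show "tensor_map A X X' Y Y' f g \<in> bimod_hom A (X \<boxtimes> Y) (X' \<boxtimes> Y')"
    if "bimodule A X" "bimodule A X'" "bimodule A Y" "bimodule A Y'"
      "f \<in> bimod_hom A X X'" "g \<in> bimod_hom A Y Y'" for X X' Y Y' f g
    using that by (rule tensor_map_hom)
  show "tensor_map A X X Y Y (id_map X) (id_map Y) = id_map (X \<boxtimes> Y)"
    if [simp]: "bimodule A X" "bimodule A Y" for X Y
    by (rule tensor_eqI[of _ X Y "X \<boxtimes> Y"]; (rule bimod_hom_additive, (rule structure_homs | simp)+)?)
      (simp_all add: id_map_hom)
  show "tensor_map A X X'' Y Y'' (compose (carrier X) f' f) (compose (carrier Y) g' g)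
      = compose (carrier (X \<boxtimes> Y)) (tensor_map A X' X'' Y' Y'' f' g') (tensor_map A X X' Y Y' f g)"
    if [simp]: "bimodule A X" "bimodule A X'" "bimodule A X''" "bimodule A Y" "bimodule A Y'" "bimodule A Y''"
      and homs [simp]: "f \<in> bimod_hom A X X'" "f' \<in> bimod_hom A X' X''" "g \<in> bimod_hom A Y Y'" "g' \<in> bimod_hom A Y' Y''"
    for X X' X'' Y Y' Y'' f f' g g'
  proof -
    note [simp] = bimod_hom_compose[OF homs(1,2)] bimod_hom_compose[OF homs(3,4)]
    show ?thesis
      by (rule tensor_eqI[of _ X Y "X'' \<boxtimes> Y''"]; (rule bimod_hom_additive, (rule structure_homs homs | simp)+)?)
        (simp_all add: compose_eq bimod_homD(1)[OF homs(1)] bimod_homD(1)[OF homs(3)])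
  qed
  show "is_iso (bimod_category A) ((X \<boxtimes> Y) \<boxtimes> Z) (X \<boxtimes> Y \<boxtimes> Z) (bimod_assoc A X Y Z)"
    if "bimodule A X" "bimodule A Y" "bimodule A Z" for X Y Z
    using that by (simp add: bimod_is_iso_iff bimod_assoc_iso)
  show "is_iso (bimod_category A) (regular_bimod A \<boxtimes> X) X (bimod_lunit A X)"
    "is_iso (bimod_category A) (X \<boxtimes> regular_bimod A) X (bimod_runit A X)" if "bimodule A X" for X
    using that by (simp_all add: bimod_is_iso_iff bimod_lunit_iso bimod_runit_iso)
  show "compose (carrier ((X \<boxtimes> Y) \<boxtimes> Z)) (bimod_assoc A X' Y' Z')
         (tensor_map A (X \<boxtimes> Y) (X' \<boxtimes> Y') Z Z' (tensor_map A X X' Y Y' f g) h)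
      = compose (carrier ((X \<boxtimes> Y) \<boxtimes> Z))
         (tensor_map A X X' (Y \<boxtimes> Z) (Y' \<boxtimes> Z') f (tensor_map A Y Y' Z Z' g h)) (bimod_assoc A X Y Z)"
    if [simp]: "bimodule A X" "bimodule A X'" "bimodule A Y" "bimodule A Y'" "bimodule A Z" "bimodule A Z'"
      and homs [simp]: "f \<in> bimod_hom A X X'" "g \<in> bimod_hom A Y Y'" "h \<in> bimod_hom A Z Z'"
    for X X' Y Y' Z Z' f g h
    by (rule tensor3_eqI[of _ X Y Z "X' \<boxtimes> Y' \<boxtimes> Z'"]; (rule bimod_hom_additive, (rule structure_homs homs | simp)+)?)
      (simp_all add: compose_eq tensor_map_hom bimod_homD(1)[OF homs(1)] bimod_homD(1)[OF homs(2)] bimod_homD(1)[OF homs(3)])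
  show "compose (carrier (regular_bimod A \<boxtimes> X)) (bimod_lunit A X')
         (tensor_map A (regular_bimod A) (regular_bimod A) X X' (id_map (regular_bimod A)) f)
      = compose (carrier (regular_bimod A \<boxtimes> X)) f (bimod_lunit A X)"
    if [simp]: "bimodule A X" "bimodule A X'" and homs [simp]: "f \<in> bimod_hom A X X'" for X X' f
    by (rule tensor_eqI[of _ "regular_bimod A" X X']; (rule bimod_hom_additive, (rule structure_homs homs | simp)+)?)
      (simp_all add: compose_eq id_map_hom bimod_homD[OF homs])
  show "compose (carrier (X \<boxtimes> regular_bimod A)) (bimod_runit A X')
         (tensor_map A X X' (regular_bimod A) (regular_bimod A) f (id_map (regular_bimod A)))
      = compose (carrier (X \<boxtimes> regular_bimod A)) f (bimod_runit A X)"
    if [simp]: "bimodule A X" "bimodule A X'" and homs [simp]: "f \<in> bimod_hom A X X'" for X X' f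
    by (rule tensor_eqI[of _ X "regular_bimod A" X']; (rule bimod_hom_additive, (rule structure_homs homs | simp)+)?)
      (simp_all add: compose_eq id_map_hom bimod_homD[OF homs])
  show "compose (carrier (((W \<boxtimes> X) \<boxtimes> Y) \<boxtimes> Z)) (bimod_assoc A W X (Y \<boxtimes> Z)) (bimod_assoc A (W \<boxtimes> X) Y Z)
      = compose (carrier (((W \<boxtimes> X) \<boxtimes> Y) \<boxtimes> Z))
         (tensor_map A W W ((X \<boxtimes> Y) \<boxtimes> Z) (X \<boxtimes> Y \<boxtimes> Z) (id_map W) (bimod_assoc A X Y Z))
         (compose (carrier (((W \<boxtimes> X) \<boxtimes> Y) \<boxtimes> Z)) (bimod_assoc A W (X \<boxtimes> Y) Z)
           (tensor_map A ((W \<boxtimes> X) \<boxtimes> Y) (W \<boxtimes> X \<boxtimes> Y) Z Z (bimod_assoc A W X Y) (id_map Z)))"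
    if [simp]: "bimodule A W" "bimodule A X" "bimodule A Y" "bimodule A Z" for W X Y Z
    by (rule tensor4_eqI[of _ W X Y Z "W \<boxtimes> X \<boxtimes> Y \<boxtimes> Z"]; (rule bimod_hom_additive, (rule structure_homs | simp)+)?)
      (simp_all add: compose_eq id_map_hom bimod_assoc_hom)
  \<comment> \<open>On (x \<otimes> a) \<otimes> y the triangle says x \<otimes> ay = xa \<otimes>
    y, which is balance; the rules that move actions outwards are withheld.\<close>
  show "compose (carrier ((X \<boxtimes> regular_bimod A) \<boxtimes> Y))
         (tensor_map A X X (regular_bimod A \<boxtimes> Y) Y (id_map X) (bimod_lunit A Y))
         (bimod_assoc A X (regular_bimod A) Y)
      = tensor_map A (X \<boxtimes> regular_bimod A) X Y Y (bimod_runit A X) (id_map Y)"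
    if [simp]: "bimodule A X" "bimodule A Y" for X Y
    by (rule tensor3_eqI[of _ X "regular_bimod A" Y "X \<boxtimes> Y"]; (rule bimod_hom_additive, (rule structure_homs | simp)+)?)
      (simp_all add: compose_eq id_map_hom bimod_lunit_hom bimod_runit_hom tensor_elt_balanced
        del: tensor_elt_lact tensor_elt_ract)
qed

lemma restrict_star_hom:
  "(\<lambda>a\<in>carrier A. star A a) \<in> bimod_hom A (conj_bimod A (regular_bimod A)) (regular_bimod A)"
  by (rule bimod_homI) auto

text \<open>The involution is also a bimodule map out of the conjugate, hence its own inverse;
  \<open>inverse_mor\<close>, a definite description, is then evaluated by uniqueness.\<close>

lemma inverse_restrict_star:
  "inverse_mor (bimod_category A) (regular_bimod A) (conj_bimod A (regular_bimod A))
    (\<lambda>a\<in>carrier A. star A a) = (\<lambda>a\<in>carrier A. star A a)"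
proof (rule category.inverse_mor_eqI[OF bimod_category])
  show "is_inverse (bimod_category A) (regular_bimod A) (conj_bimod A (regular_bimod A))
      (\<lambda>a\<in>carrier A. star A a) (\<lambda>a\<in>carrier A. star A a)"
    using bimod_iso_hom[OF restrict_star_iso] restrict_star_hom
    by (auto simp: is_inverse_def compose_def id_map_def)
qed simp_all

theorem bimod_bar_category: "bar_category (bimod_category A)"
proof (intro bar_category.intro bar_category_axioms.intro bimod_monoidal_category,
    simp_all add: inverse_restrict_star)
  let ?R = "regular_bimod A" and ?c = "conj_bimod A"
  show "f \<in> bimod_hom A (?c X) (?c Y)" if "f \<in> bimod_hom A X Y" for X Y f
    using that by (rule bimod_hom_conj)
  show "is_iso (bimod_category A) (?c (X \<boxtimes> Y)) (?c Y \<boxtimes> ?c X) (bimod_Upsilon A X Y)"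
    if "bimodule A X" "bimodule A Y" for X Y
    using that by (simp add: bimod_is_iso_iff bimod_Upsilon_iso)
  \<comment> \<open>Upsilon starts at a conjugate, whereas the criterion concerns maps on X
    \<boxtimes> Y. A bimodule map on the conjugate is additive on X \<boxtimes> Y itself, and that
    is all the criterion asks.\<close>
  show "compose (carrier (X \<boxtimes> Y)) (bimod_Upsilon A X' Y') (tensor_map A X X' Y Y' f g)
      = compose (carrier (X \<boxtimes> Y)) (tensor_map A (?c Y) (?c Y') (?c X) (?c X') g f) (bimod_Upsilon A X Y)"
    if [simp]: "bimodule A X" "bimodule A X'" "bimodule A Y" "bimodule A Y'"
      and homs [simp]: "f \<in> bimod_hom A X X'" "g \<in> bimod_hom A Y Y'"
    for X X' Y Y' f g
  proof (intro tensor_eqI[of _ X Y "?c Y' \<boxtimes> ?c X'"] bimod_hom_conj_additive)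
    note [simp] = homs[THEN bimod_hom_conj]
    show "compose (carrier (X \<boxtimes> Y)) (bimod_Upsilon A X' Y') (tensor_map A X X' Y Y' f g)
        \<in> bimod_hom A (?c (X \<boxtimes> Y)) (?c Y' \<boxtimes> ?c X')"
      using bimod_hom_compose[OF bimod_hom_conj[OF tensor_map_hom[of X X' Y Y']] bimod_Upsilon_hom]
      by simp
    show "compose (carrier (X \<boxtimes> Y)) (tensor_map A (?c Y) (?c Y') (?c X) (?c X') g f) (bimod_Upsilon A X Y)
        \<in> bimod_hom A (?c (X \<boxtimes> Y)) (?c Y' \<boxtimes> ?c X')"
      using bimod_hom_compose[OF bimod_Upsilon_hom tensor_map_hom[of "?c Y" "?c Y'" "?c X" "?c X'"]]
      by simp
  qed (simp_all add: compose_eq bimod_hom_conj bimod_homD(1)[OF homs(1)] bimod_homD(1)[OF homs(2)])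
  show "is_iso (bimod_category A) X (?c (?c X)) (id_map X)" if "bimodule A X" for X
    using that by (simp add: bimod_is_iso_iff id_map_bb_iso)
  show "compose (carrier X) (id_map Y) f = compose (carrier X) f (id_map X)"
    if "f \<in> bimod_hom A X Y" for X Y f
    using bimod_homD(1)[OF that] by (auto simp: compose_def)
  show "is_iso (bimod_category A) ?R (?c ?R) (\<lambda>a\<in>carrier A. star A a)"
    by (simp add: bimod_is_iso_iff restrict_star_iso)
  show "compose (carrier ((X \<boxtimes> Y) \<boxtimes> Z))
         (tensor_map A (?c Z) (?c Z) (?c (X \<boxtimes> Y)) (?c Y \<boxtimes> ?c X) (id_map Z) (bimod_Upsilon A X Y))
         (bimod_Upsilon A (X \<boxtimes> Y) Z)
      = compose (carrier ((X \<boxtimes> Y) \<boxtimes> Z)) (bimod_assoc A (?c Z) (?c Y) (?c X))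
         (compose (carrier ((X \<boxtimes> Y) \<boxtimes> Z))
           (tensor_map A (?c (Y \<boxtimes> Z)) (?c Z \<boxtimes> ?c Y) (?c X) (?c X) (bimod_Upsilon A Y Z) (id_map X))
           (compose (carrier ((X \<boxtimes> Y) \<boxtimes> Z)) (bimod_Upsilon A X (Y \<boxtimes> Z)) (bimod_assoc A X Y Z)))"
    (is "?l = ?r")
    if [simp]: "bimodule A X" "bimodule A Y" "bimodule A Z" for X Y Z
  proof (intro tensor3_eqI[of _ X Y Z "?c Z \<boxtimes> ?c Y \<boxtimes> ?c X"] bimod_hom_conj_additive)
    let ?XYZ = "?c ((X \<boxtimes> Y) \<boxtimes> Z)"
    have ids: "id_map X \<in> bimod_hom A (?c X) (?c X)" "id_map Z \<in> bimod_hom A (?c Z) (?c Z)"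
      using id_map_hom[of "?c X"] id_map_hom[of "?c Z"] by simp_all
    have "compose (carrier ?XYZ) (tensor_map A (?c Z) (?c Z) (?c (X \<boxtimes> Y)) (?c Y \<boxtimes> ?c X) (id_map Z) (bimod_Upsilon A X Y))
         (bimod_Upsilon A (X \<boxtimes> Y) Z) \<in> bimod_hom A ?XYZ (?c Z \<boxtimes> ?c Y \<boxtimes> ?c X)"
      by (rule bimod_hom_compose[OF bimod_Upsilon_hom tensor_map_hom]) (simp_all add: bimod_Upsilon_hom ids)
    then show "?l \<in> bimod_hom A ?XYZ (?c Z \<boxtimes> ?c Y \<boxtimes> ?c X)" by simp
    have "compose (carrier ?XYZ) (bimod_assoc A (?c Z) (?c Y) (?c X))
         (compose (carrier ?XYZ)
           (tensor_map A (?c (Y \<boxtimes> Z)) (?c Z \<boxtimes> ?c Y) (?c X) (?c X) (bimod_Upsilon A Y Z) (id_map X))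
           (compose (carrier ?XYZ) (bimod_Upsilon A X (Y \<boxtimes> Z)) (bimod_assoc A X Y Z)))
         \<in> bimod_hom A ?XYZ (?c Z \<boxtimes> ?c Y \<boxtimes> ?c X)"
      by (rule bimod_hom_compose[OF bimod_hom_compose[OF bimod_hom_compose[OF bimod_hom_conj[OF bimod_assoc_hom]
          bimod_Upsilon_hom] tensor_map_hom] bimod_assoc_hom]) (simp_all add: bimod_Upsilon_hom ids)
    then show "?r \<in> bimod_hom A ?XYZ (?c Z \<boxtimes> ?c Y \<boxtimes> ?c X)" by simp
  qed (use id_map_hom[of "?c X"] id_map_hom[of "?c Z"] in \<open>simp_all add: compose_eq bimod_Upsilon_hom\<close>)
  show "compose (carrier (X \<boxtimes> ?R)) (bimod_lunit A (?c X))
         (compose (carrier (X \<boxtimes> ?R)) (tensor_map A (?c ?R) ?R (?c X) (?c X) (\<lambda>a\<in>carrier A. star A a) (id_map X))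
           (bimod_Upsilon A X ?R)) = bimod_runit A X" (is "?l = ?r")
    if [simp]: "bimodule A X" for X
  proof (intro tensor_eqI[of _ X ?R "?c X"] bimod_hom_conj_additive)
    have ids: "id_map X \<in> bimod_hom A (?c X) (?c X)"
      using id_map_hom[of "?c X"] by simp
    have "compose (carrier (?c (X \<boxtimes> ?R))) (bimod_lunit A (?c X))
         (compose (carrier (?c (X \<boxtimes> ?R))) (tensor_map A (?c ?R) ?R (?c X) (?c X) (\<lambda>a\<in>carrier A. star A a) (id_map X))
           (bimod_Upsilon A X ?R)) \<in> bimod_hom A (?c (X \<boxtimes> ?R)) (?c X)"
      by (rule bimod_hom_compose[OF bimod_hom_compose[OF bimod_Upsilon_hom tensor_map_hom] bimod_lunit_hom])
         (simp_all add: ids restrict_star_hom)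
    then show "?l \<in> bimod_hom A (?c (X \<boxtimes> ?R)) (?c X)" by simp
    show "?r \<in> bimod_hom A (?c (X \<boxtimes> ?R)) (?c X)"
      by (simp add: bimod_hom_conj bimod_runit_hom)
  qed (use id_map_hom[of "?c X"] in \<open>simp_all add: compose_eq restrict_star_hom\<close>)
  show "compose (carrier (?R \<boxtimes> X)) (bimod_runit A (?c X))
         (compose (carrier (?R \<boxtimes> X)) (tensor_map A (?c X) (?c X) (?c ?R) ?R (id_map X) (\<lambda>a\<in>carrier A. star A a))
           (bimod_Upsilon A ?R X)) = bimod_lunit A X" (is "?l = ?r")
    if [simp]: "bimodule A X" for X
  proof (intro tensor_eqI[of _ ?R X "?c X"] bimod_hom_conj_additive)
    have ids: "id_map X \<in> bimod_hom A (?c X) (?c X)"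
      using id_map_hom[of "?c X"] by simp
    have "compose (carrier (?c (?R \<boxtimes> X))) (bimod_runit A (?c X))
         (compose (carrier (?c (?R \<boxtimes> X))) (tensor_map A (?c X) (?c X) (?c ?R) ?R (id_map X) (\<lambda>a\<in>carrier A. star A a))
           (bimod_Upsilon A ?R X)) \<in> bimod_hom A (?c (?R \<boxtimes> X)) (?c X)"
      by (rule bimod_hom_compose[OF bimod_hom_compose[OF bimod_Upsilon_hom tensor_map_hom] bimod_runit_hom])
         (simp_all add: ids restrict_star_hom)
    then show "?l \<in> bimod_hom A (?c (?R \<boxtimes> X)) (?c X)" by simp
    show "?r \<in> bimod_hom A (?c (?R \<boxtimes> X)) (?c X)"
      by (simp add: bimod_hom_conj bimod_lunit_hom)
  qed (use id_map_hom[of "?c X"] in \<open>simp_all add: compose_eq restrict_star_hom\<close>)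
  show "compose (carrier A) (\<lambda>a\<in>carrier A. star A a) (\<lambda>a\<in>carrier A. star A a) = id_map ?R"
    by (auto simp: compose_def id_map_def)
qed

end

section \<open>Bimodule connections\<close>

locale star_calculus = infinite_star_algebra A + differential_structure A \<Omega> d
  for A :: "'u::infinite star_alg" (structure) and \<Omega> :: "'u bimod" and d +
  fixes st :: "'u \<Rightarrow> 'u"
  assumes star_object: "star_object (bimod_category A) \<Omega> st"
    and st_d: "\<forall>a\<in>carrier A. st (d a) = d (star A a)"
begin

abbreviation "is_conn \<equiv> bimodule_connection A \<Omega> d"

lemma Omega_bimodule [simp]: "bimodule A \<Omega>"
  by (rule bimodule)

lemmas d_simps [simp] = d_closed d_add d_smult d_mult

lemma st_d' [simp]: "a \<in> carrier A \<Longrightarrow> st (d a) = d (star A a)"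
  using st_d by blast

lemma st_hom: "st \<in> bimod_hom A \<Omega> (conj_bimod A \<Omega>)"
  using star_object by (simp add: star_object_def)

lemmas st_simps [simp] = bimod_homD[OF st_hom, simplified]

text \<open>On underlying sets the bar of \<open>st\<close> is \<open>st\<close> and
  \<open>bb\<close> is the identity, so the axiom of a star object says that \<open>st\<close> is an
  involution. The inverse of \<open>st\<close> in the bar connection is therefore \<open>st\<close>
  again.\<close>

lemma st_st [simp]: "w \<in> carrier \<Omega> \<Longrightarrow> st (st w) = w"
proof -
  assume "w \<in> carrier \<Omega>"
  moreover have "compose (carrier \<Omega>) st st = id_map \<Omega>"
    using star_object by (simp add: star_object_def)
  ultimately show ?thesis
    by (metis compose_eq id_map_apply)
qed

lemma st_iso: "bimod_iso \<Omega> (conj_bimod A \<Omega>) st"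
  by (rule bimod_isoI[OF st_hom, where \<phi> = st]) auto

lemma st_inv [simp]: "w \<in> carrier \<Omega> \<Longrightarrow> map_inverse \<Omega> (conj_bimod A \<Omega>) st w = st w"
  by (rule map_inverse_eqI[OF st_iso]) auto

lemma is_conn_bimodule [simp]: "is_conn X \<Longrightarrow> bimodule A (bim X)"
  by (simp add: bimodule_connection_def Let_def)

lemma is_conn_sigma_iso: "is_conn X \<Longrightarrow> bimod_iso (bim X \<boxtimes> \<Omega>) (\<Omega> \<boxtimes> bim X) (sigma X)"
  by (simp add: bimodule_connection_def Let_def bimod_iso_def)

lemmas is_conn_sigma_hom = bimod_iso_hom[OF is_conn_sigma_iso]

lemmas sigma_simps [simp] = bimod_homD[OF is_conn_sigma_hom]

abbreviation "sigma_inv X \<equiv> map_inverse (bim X \<boxtimes> \<Omega>) (\<Omega> \<boxtimes> bim X) (sigma X)"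

lemma sigma_inv_iso: "is_conn X \<Longrightarrow> bimod_iso (\<Omega> \<boxtimes> bim X) (bim X \<boxtimes> \<Omega>) (sigma_inv X)"
  by (rule map_inverse_iso[OF is_conn_sigma_iso]) simp_all

lemmas sigma_inv_simps [simp] = bimod_homD[OF bimod_iso_hom[OF sigma_inv_iso]]
  map_inverse_simps(1,2)[OF is_conn_sigma_iso]

lemma nabla_simps [simp]:
  assumes "is_conn X" "e \<in> carrier (bim X)"
  shows "nabla X e \<in> carrier (\<Omega> \<boxtimes> bim X)"
    and "e' \<in> carrier (bim X) \<Longrightarrow> nabla X (e \<oplus>\<^bsub>bim X\<^esub> e') = nabla X e \<oplus>\<^bsub>\<Omega> \<boxtimes> bim X\<^esub> nabla X e'"
    and "nabla X (c \<odot>\<^bsub>bim X\<^esub> e) = c \<odot>\<^bsub>\<Omega> \<boxtimes> bim X\<^esub> nabla X e"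
    and "a \<in> carrier A \<Longrightarrow> nabla X (a \<rhd>\<^bsub>bim X\<^esub> e)
      = elt \<Omega> (bim X) (d a) e \<oplus>\<^bsub>\<Omega> \<boxtimes> bim X\<^esub> (a \<rhd>\<^bsub>\<Omega> \<boxtimes> bim X\<^esub> nabla X e)"
    and "a \<in> carrier A \<Longrightarrow> nabla X (e \<lhd>\<^bsub>bim X\<^esub> a)
      = (nabla X e \<lhd>\<^bsub>\<Omega> \<boxtimes> bim X\<^esub> a) \<oplus>\<^bsub>\<Omega> \<boxtimes> bim X\<^esub> sigma X (elt (bim X) \<Omega> e (d a))"
  using assms unfolding bimodule_connection_def Let_def by blast+

lemma is_connI:
  assumes "bimodule A (bim X)" "nabla X \<in> extensional (carrier (bim X))"
    and "bimod_iso (bim X \<boxtimes> \<Omega>) (\<Omega> \<boxtimes> bim X) (sigma X)"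
    and "\<And>e. e \<in> carrier (bim X) \<Longrightarrow> nabla X e \<in> carrier (\<Omega> \<boxtimes> bim X)"
    and "\<And>e e'. \<lbrakk>e \<in> carrier (bim X); e' \<in> carrier (bim X)\<rbrakk>
      \<Longrightarrow> nabla X (e \<oplus>\<^bsub>bim X\<^esub> e') = nabla X e \<oplus>\<^bsub>\<Omega> \<boxtimes> bim X\<^esub> nabla X e'"
    and "\<And>c e. e \<in> carrier (bim X) \<Longrightarrow> nabla X (c \<odot>\<^bsub>bim X\<^esub> e) = c \<odot>\<^bsub>\<Omega> \<boxtimes> bim X\<^esub> nabla X e"
    and "\<And>a e. \<lbrakk>a \<in> carrier A; e \<in> carrier (bim X)\<rbrakk> \<Longrightarrow> nabla X (a \<rhd>\<^bsub>bim X\<^esub> e)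
      = elt \<Omega> (bim X) (d a) e \<oplus>\<^bsub>\<Omega> \<boxtimes> bim X\<^esub> (a \<rhd>\<^bsub>\<Omega> \<boxtimes> bim X\<^esub> nabla X e)"
    and "\<And>a e. \<lbrakk>a \<in> carrier A; e \<in> carrier (bim X)\<rbrakk> \<Longrightarrow> nabla X (e \<lhd>\<^bsub>bim X\<^esub> a)
      = (nabla X e \<lhd>\<^bsub>\<Omega> \<boxtimes> bim X\<^esub> a) \<oplus>\<^bsub>\<Omega> \<boxtimes> bim X\<^esub> sigma X (elt (bim X) \<Omega> e (d a))"
  shows "is_conn X"
  using assms unfolding bimodule_connection_def Let_def bimod_iso_def PiE_iff by blast

subsection \<open>The unit object\<close>

lemma conn_unit_simps [simp]:
  "bim (conn_unit A \<Omega> d) = regular_bimod A"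
  "a \<in> carrier A \<Longrightarrow> nabla (conn_unit A \<Omega> d) a = elt \<Omega> (regular_bimod A) (d a) \<one>"
  "\<lbrakk>a \<in> carrier A; w \<in> carrier \<Omega>\<rbrakk> \<Longrightarrow> sigma (conn_unit A \<Omega> d) (elt (regular_bimod A) \<Omega> a w)
    = elt \<Omega> (regular_bimod A) (a \<rhd>\<^bsub>\<Omega>\<^esub> w) \<one>"
  by (simp_all add: conn_unit_def Let_def compose_eq)

lemma conn_unit: "is_conn (conn_unit A \<Omega> d)"
proof (rule is_connI)
  show "bimod_iso (bim (conn_unit A \<Omega> d) \<boxtimes> \<Omega>) (\<Omega> \<boxtimes> bim (conn_unit A \<Omega> d)) (sigma (conn_unit A \<Omega> d))"
    unfolding conn_unit_def Let_def conn.simps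
    by (intro bimod_iso_compose[OF bimod_lunit_iso] map_inverse_iso bimod_runit_iso) simp_all
  show "nabla (conn_unit A \<Omega> d) \<in> extensional (carrier (bim (conn_unit A \<Omega> d)))"
    by (simp add: conn_unit_def Let_def)
next
  fix a e
  assume "a \<in> carrier A" "e \<in> carrier (bim (conn_unit A \<Omega> d))"
  then have ae: "a \<in> carrier A" "e \<in> carrier A" by simp_all
  \<comment> \<open>In \<Omega> \<otimes> A a right factor passes to the second place: (da)e
    \<otimes> 1 = da \<otimes> e. With this both Leibniz rules reduce to that of \<open>d\<close>,
    with \<sigma> the identity up to unit isomorphisms.\<close>
  then have *: "elt \<Omega> (regular_bimod A) (d a \<lhd>\<^bsub>\<Omega>\<^esub> e) \<one> = elt \<Omega> (regular_bimod A) (d a) e"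
    "elt \<Omega> (regular_bimod A) (d e \<lhd>\<^bsub>\<Omega>\<^esub> a) \<one> = elt \<Omega> (regular_bimod A) (d e) a"
    using tensor_elt_balanced[of e "d a" \<Omega> \<one> "regular_bimod A"]
      tensor_elt_balanced[of a "d e" \<Omega> \<one> "regular_bimod A"] by simp_all
  show "nabla (conn_unit A \<Omega> d) (a \<rhd>\<^bsub>bim (conn_unit A \<Omega> d)\<^esub> e)
      = elt \<Omega> (bim (conn_unit A \<Omega> d)) (d a) e \<oplus>\<^bsub>\<Omega> \<boxtimes> bim (conn_unit A \<Omega> d)\<^esub>
        (a \<rhd>\<^bsub>\<Omega> \<boxtimes> bim (conn_unit A \<Omega> d)\<^esub> nabla (conn_unit A \<Omega> d) e)"
    using ae * by simp
  show "nabla (conn_unit A \<Omega> d) (e \<lhd>\<^bsub>bim (conn_unit A \<Omega> d)\<^esub> a)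
      = (nabla (conn_unit A \<Omega> d) e \<lhd>\<^bsub>\<Omega> \<boxtimes> bim (conn_unit A \<Omega> d)\<^esub> a) \<oplus>\<^bsub>\<Omega> \<boxtimes> bim (conn_unit A \<Omega> d)\<^esub>
        sigma (conn_unit A \<Omega> d) (elt (bim (conn_unit A \<Omega> d)) \<Omega> e (d a))"
    using ae * tensor_elt_ract[of "regular_bimod A" a "d e" \<Omega> \<one>] by simp
qed simp_all

subsection \<open>Tensor products\<close>

text \<open>This is \<sigma> \<otimes> id with the bracketing absorbed: it carries a form leftwards
  past E. It is a bimodule isomorphism, and both the second summand of the tensor derivative and
  \<sigma> of a tensor product factor through it.\<close>

definition shift :: "'u conn \<Rightarrow> 'u bimod \<Rightarrow> 'u \<Rightarrow> 'u" where
  "shift X F = compose (carrier (bim X \<boxtimes> \<Omega> \<boxtimes> F)) (bimod_assoc A \<Omega> (bim X) F)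
     (compose (carrier (bim X \<boxtimes> \<Omega> \<boxtimes> F))
       (tensor_map A (bim X \<boxtimes> \<Omega>) (\<Omega> \<boxtimes> bim X) F F (sigma X) (id_map F)) (assoc_inv (bim X) \<Omega> F))"

lemma shift_iso:
  assumes "is_conn X" "bimodule A F"
  shows "bimod_iso (bim X \<boxtimes> \<Omega> \<boxtimes> F) (\<Omega> \<boxtimes> bim X \<boxtimes> F) (shift X F)"
  unfolding shift_def using assms
  by (intro bimod_iso_compose[OF bimod_iso_compose[OF map_inverse_iso[OF bimod_assoc_iso] tensor_map_iso]
        bimod_assoc_iso] is_conn_sigma_iso id_map_iso) simp_all

lemmas shift_simps [simp] = bimod_homD[OF bimod_iso_hom[OF shift_iso]]

lemma shift_elt [simp]:
  assumes "is_conn X" "bimodule A F" "e \<in> carrier (bim X)" "w \<in> carrier \<Omega>" "f \<in> carrier F"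
  shows "shift X F (elt (bim X) (\<Omega> \<boxtimes> F) e (elt \<Omega> F w f))
    = bimod_assoc A \<Omega> (bim X) F (elt (\<Omega> \<boxtimes> bim X) F (sigma X (elt (bim X) \<Omega> e w)) f)"
  using assms by (simp add: shift_def compose_eq is_conn_sigma_hom id_map_hom)

lemma bim_conn_tensor [simp]: "bim (conn_tensor A \<Omega> X Y) = bim X \<boxtimes> bim Y"
  by (simp add: conn_tensor_def Let_def)

context
  fixes X Y
  assumes X [simp]: "is_conn X" and Y [simp]: "is_conn Y"
begin

abbreviation (input) "nabla_elt e f \<equiv>
  bimod_assoc A \<Omega> (bim X) (bim Y) (elt (\<Omega> \<boxtimes> bim X) (bim Y) (nabla X e) f)
  \<oplus>\<^bsub>\<Omega> \<boxtimes> bim X \<boxtimes> bim Y\<^esub> shift X (bim Y) (elt (bim X) (\<Omega> \<boxtimes> bim Y) e (nabla Y f))"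

text \<open>The two summands fail to be balanced by terms that compensate each other: \<nabla>(ea)
  contributes \<sigma>(e \<otimes> da) \<otimes> f to the first on one side, and \<nabla>(af)
  contributes e \<otimes> da \<otimes> f to the second on the other, which \<open>shift\<close>
  turns into the same term.\<close>

lemma nabla_elt_balanced: "balanced_map (bim X) (bim Y) (\<Omega> \<boxtimes> bim X \<boxtimes> bim Y) (\<lambda>e f. nabla_elt e f)"
  unfolding balanced_map_def
  by (simp add: bimodule_add_ac tensor_elt_balanced)

lemma nabla_conn_tensor:
  "nabla (conn_tensor A \<Omega> X Y) = tensor_lift A (bim X) (bim Y) (\<Omega> \<boxtimes> bim X \<boxtimes> bim Y) (\<lambda>e f. nabla_elt e f)"
  unfolding conn_tensor_def Let_def conn.simps
  by (rule tensor_lift_cong) (simp_all add: shift_def compose_eq)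

lemma conn_tensor_nabla_elt:
  "\<lbrakk>e \<in> carrier (bim X); f \<in> carrier (bim Y)\<rbrakk>
    \<Longrightarrow> nabla (conn_tensor A \<Omega> X Y) (elt (bim X) (bim Y) e f) = nabla_elt e f"
  unfolding nabla_conn_tensor by (rule tensor_lift_elt[OF _ _ _ nabla_elt_balanced]) simp_all

lemmas conn_tensor_nabla_additive =
  additive_mapD[OF tensor_lift_additive[OF _ _ _ nabla_elt_balanced], folded nabla_conn_tensor,
    simplified]

lemma conn_tensor_sigma:
  "sigma (conn_tensor A \<Omega> X Y) = compose (carrier ((bim X \<boxtimes> bim Y) \<boxtimes> \<Omega>)) (shift X (bim Y))
    (compose (carrier ((bim X \<boxtimes> bim Y) \<boxtimes> \<Omega>))
      (tensor_map A (bim X) (bim X) (bim Y \<boxtimes> \<Omega>) (\<Omega> \<boxtimes> bim Y) (id_map (bim X)) (sigma Y))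
      (bimod_assoc A (bim X) (bim Y) \<Omega>))"
  by (rule ext) (simp add: conn_tensor_def Let_def compose_def shift_def id_map_hom is_conn_sigma_hom)

lemma conn_tensor_sigma_elt [simp]:
  "\<lbrakk>e \<in> carrier (bim X); f \<in> carrier (bim Y); w \<in> carrier \<Omega>\<rbrakk>
    \<Longrightarrow> sigma (conn_tensor A \<Omega> X Y) (elt (bim X \<boxtimes> bim Y) \<Omega> (elt (bim X) (bim Y) e f) w)
      = shift X (bim Y) (elt (bim X) (\<Omega> \<boxtimes> bim Y) e (sigma Y (elt (bim Y) \<Omega> f w)))"
  by (simp add: conn_tensor_sigma compose_eq id_map_hom is_conn_sigma_hom)

lemma conn_tensor_sigma_iso:
  "bimod_iso ((bim X \<boxtimes> bim Y) \<boxtimes> \<Omega>) (\<Omega> \<boxtimes> bim X \<boxtimes> bim Y) (sigma (conn_tensor A \<Omega> X Y))"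
  unfolding conn_tensor_sigma
  by (intro bimod_iso_compose[OF bimod_iso_compose[OF bimod_assoc_iso tensor_map_iso] shift_iso]
      is_conn_sigma_iso id_map_iso) simp_all

text \<open>The left Leibniz rule comes from the first summand, the second being linear from the
  left. The right rule comes from the second, because \<open>shift\<close> of e \<otimes> \<sigma>(f
  \<otimes> da) is \<sigma> of the tensor product at (e \<otimes> f) \<otimes> da.\<close>

lemma conn_tensor: "is_conn (conn_tensor A \<Omega> X Y)"
proof (rule is_connI; simp only: bim_conn_tensor)
  let ?E = "bim X" and ?F = "bim Y" and ?D = "nabla (conn_tensor A \<Omega> X Y)"
  note [simp] = conn_tensor_nabla_additive conn_tensor_nabla_elt bimod_homD[OF bimod_iso_hom[OF conn_tensor_sigma_iso]]
  show "bimod_iso ((?E \<boxtimes> ?F) \<boxtimes> \<Omega>) (\<Omega> \<boxtimes> ?E \<boxtimes> ?F) (sigma (conn_tensor A \<Omega> X Y))"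
    by (rule conn_tensor_sigma_iso)
  fix t
  assume t: "t \<in> carrier (?E \<boxtimes> ?F)"
  show "?D (c \<odot>\<^bsub>?E \<boxtimes> ?F\<^esub> t) = c \<odot>\<^bsub>\<Omega> \<boxtimes> ?E \<boxtimes> ?F\<^esub> ?D t" for c
    using t is_conn_bimodule[OF X] is_conn_bimodule[OF Y]
  proof (induct rule: tensor_induct)
    case (elt e f)
    \<comment> \<open>The formula is instantiated with the scalar inside the tensor; simplification
      moves it out and so yields the required equation. The actions below are treated in the same
      way.\<close>
    then show ?case
      using conn_tensor_nabla_elt[of "c \<odot>\<^bsub>?E\<^esub> e" f] by simp
  qed simp
  show "?D (a \<rhd>\<^bsub>?E \<boxtimes> ?F\<^esub> t)
      = elt \<Omega> (?E \<boxtimes> ?F) (d a) t \<oplus>\<^bsub>\<Omega> \<boxtimes> ?E \<boxtimes> ?F\<^esub> (a \<rhd>\<^bsub>\<Omega> \<boxtimes> ?E \<boxtimes> ?F\<^esub> ?D t)"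
    if a: "a \<in> carrier A" for a
    using t is_conn_bimodule[OF X] is_conn_bimodule[OF Y]
  proof (induct rule: tensor_induct)
    case (elt e f)
    then show ?case
      using a conn_tensor_nabla_elt[of "a \<rhd>\<^bsub>?E\<^esub> e" f] by (simp add: bimodule_add_ac)
  qed (use a in \<open>simp add: bimodule_add_ac\<close>)
  show "?D (t \<lhd>\<^bsub>?E \<boxtimes> ?F\<^esub> a)
      = (?D t \<lhd>\<^bsub>\<Omega> \<boxtimes> ?E \<boxtimes> ?F\<^esub> a) \<oplus>\<^bsub>\<Omega> \<boxtimes> ?E \<boxtimes> ?F\<^esub>
        sigma (conn_tensor A \<Omega> X Y) (elt (?E \<boxtimes> ?F) \<Omega> t (d a))"
    if a: "a \<in> carrier A" for a
    using t is_conn_bimodule[OF X] is_conn_bimodule[OF Y]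
  proof (induct rule: tensor_induct)
    case (elt e f)
    then show ?case
      using a conn_tensor_nabla_elt[of e "f \<lhd>\<^bsub>?F\<^esub> a"] by (simp add: bimodule_add_ac)
  qed (use a in \<open>simp add: bimodule_add_ac\<close>)
qed (use conn_tensor_nabla_additive in simp_all)

end

subsection \<open>The bar functor\<close>

text \<open>The \<Phi> of the overview, regarded as a bimodule map out of the conjugate of E
  \<boxtimes> \<Omega>.\<close>

definition swap :: "'u bimod \<Rightarrow> 'u \<Rightarrow> 'u" where
  "swap E = compose (carrier (E \<boxtimes> \<Omega>))
     (tensor_map A (conj_bimod A \<Omega>) \<Omega> (conj_bimod A E) (conj_bimod A E)
       (map_inverse \<Omega> (conj_bimod A \<Omega>) st) (id_map (conj_bimod A E))) (bimod_Upsilon A E \<Omega>)"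

text \<open>Up to \<open>bb\<close> this is \<open>swap\<close> for the conjugate of E: both send e
  \<otimes> w to \<open>st w\<close> \<otimes> e, but the second factor here is E rather than its
  double conjugate.\<close>

definition unswap :: "'u bimod \<Rightarrow> 'u \<Rightarrow> 'u" where
  "unswap E = compose (carrier (conj_bimod A E \<boxtimes> \<Omega>)) (Upsilon_inv \<Omega> E)
     (tensor_map A (conj_bimod A E) (conj_bimod A E) \<Omega> (conj_bimod A \<Omega>) (id_map (conj_bimod A E)) st)"

context
  fixes E
  assumes E [simp]: "bimodule A E"
begin

lemma swap_iso: "bimod_iso (conj_bimod A (E \<boxtimes> \<Omega>)) (\<Omega> \<boxtimes> conj_bimod A E) (swap E)"
proof -
  have "bimod_iso (conj_bimod A \<Omega> \<boxtimes> conj_bimod A E) (\<Omega> \<boxtimes> conj_bimod A E)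
      (tensor_map A (conj_bimod A \<Omega>) \<Omega> (conj_bimod A E) (conj_bimod A E)
        (map_inverse \<Omega> (conj_bimod A \<Omega>) st) (id_map (conj_bimod A E)))"
    by (intro tensor_map_iso map_inverse_iso st_iso id_map_iso) simp_all
  from bimod_iso_compose[OF bimod_Upsilon_iso this] show ?thesis
    by (simp add: swap_def)
qed

lemma unswap_iso: "bimod_iso (conj_bimod A E \<boxtimes> \<Omega>) (conj_bimod A (\<Omega> \<boxtimes> E)) (unswap E)"
  unfolding unswap_def
  by (intro bimod_iso_compose[OF tensor_map_iso map_inverse_iso[OF bimod_Upsilon_iso]] st_iso id_map_iso) simp_all

lemma id_map_conj_hom: "id_map E \<in> bimod_hom A (conj_bimod A E) (conj_bimod A E)"
  using id_map_hom[of "conj_bimod A E"] by simp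

lemma swap_elt [simp]:
  "\<lbrakk>e \<in> carrier E; w \<in> carrier \<Omega>\<rbrakk> \<Longrightarrow> swap E (elt E \<Omega> e w) = elt \<Omega> (conj_bimod A E) (st w) e"
  by (simp add: swap_def compose_eq map_inverse_hom[OF st_iso] id_map_conj_hom)

lemma unswap_elt [simp]:
  "\<lbrakk>e \<in> carrier E; w \<in> carrier \<Omega>\<rbrakk> \<Longrightarrow> unswap E (elt (conj_bimod A E) \<Omega> e w) = elt \<Omega> E (st w) e"
  by (simp add: unswap_def compose_eq st_hom id_map_conj_hom)

lemmas swap_simps [simp] = bimod_hom_conjD[OF bimod_iso_hom[OF swap_iso], OF tensor_bimodule, OF E Omega_bimodule]

lemmas unswap_simps [simp] = bimod_homD[OF bimod_iso_hom[OF unswap_iso], simplified]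

end

lemma conn_bar_simps [simp]:
  assumes [simp]: "is_conn X"
  shows "bim (conn_bar A \<Omega> st X) = conj_bimod A (bim X)"
    and "e \<in> carrier (bim X) \<Longrightarrow> nabla (conn_bar A \<Omega> st X) e = swap (bim X) (sigma_inv X (nabla X e))"
    and "t \<in> carrier (conj_bimod A (bim X) \<boxtimes> \<Omega>)
      \<Longrightarrow> sigma (conn_bar A \<Omega> st X) t = swap (bim X) (sigma_inv X (unswap (bim X) t))"
  by (simp_all add: conn_bar_def Let_def swap_def unswap_def compose_eq st_hom id_map_conj_hom)

lemma conn_bar_sigma_iso:
  assumes [simp]: "is_conn X"
  shows "bimod_iso (conj_bimod A (bim X) \<boxtimes> \<Omega>) (\<Omega> \<boxtimes> conj_bimod A (bim X)) (sigma (conn_bar A \<Omega> st X))"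
proof -
  have "sigma (conn_bar A \<Omega> st X) = compose (carrier (conj_bimod A (bim X) \<boxtimes> \<Omega>)) (swap (bim X))
      (compose (carrier (conj_bimod A (bim X) \<boxtimes> \<Omega>)) (sigma_inv X) (unswap (bim X)))"
    by (rule ext) (simp add: conn_bar_def Let_def compose_def swap_def unswap_def st_hom id_map_conj_hom)
  then show ?thesis
    using bimod_iso_compose[OF bimod_iso_compose[OF unswap_iso bimod_iso_conj[OF sigma_inv_iso]] swap_iso]
    by simp
qed

text \<open>Compatibility of \<open>st\<close> with \<open>d\<close> makes the exact forms match.
  For the left rule \<open>swap\<close> sends e \<otimes> \<open>d (star A a)\<close> to da
  \<otimes> e; for the right rule \<open>unswap\<close> sends e \<otimes> da to
  \<open>d (star A a)\<close> \<otimes> e, the term that the left rule of the original connection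
  produces at \<open>star A a\<close>.\<close>

lemma conn_bar:
  assumes [simp]: "is_conn X"
  shows "is_conn (conn_bar A \<Omega> st X)"
proof (rule is_connI)
  show "nabla (conn_bar A \<Omega> st X) \<in> extensional (carrier (bim (conn_bar A \<Omega> st X)))"
    by (simp add: conn_bar_def Let_def)
qed (simp_all add: conn_bar_sigma_iso bimodule_add_ac)

end

section \<open>Morphisms of connections\<close>

context star_calculus
begin

lemmas objects_simps [simp] = conn_unit conn_tensor conn_bar

lemma conn_homI:
  assumes "\<theta> \<in> bimod_hom A (bim X) (bim Y)"
    and "\<And>e. e \<in> carrier (bim X) \<Longrightarrow> nabla Y (\<theta> e)
      = tensor_map A \<Omega> \<Omega> (bim X) (bim Y) (id_map \<Omega>) \<theta> (nabla X e)"
  shows "\<theta> \<in> conn_hom A \<Omega> X Y"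
  using assms by (simp add: conn_hom_def)

lemma conn_homD:
  assumes "\<theta> \<in> conn_hom A \<Omega> X Y"
  shows "\<theta> \<in> bimod_hom A (bim X) (bim Y)"
    and "e \<in> carrier (bim X) \<Longrightarrow> nabla Y (\<theta> e)
      = tensor_map A \<Omega> \<Omega> (bim X) (bim Y) (id_map \<Omega>) \<theta> (nabla X e)"
  using assms by (simp_all add: conn_hom_def)

lemma id_map_Omega_hom [simp]: "id_map \<Omega> \<in> bimod_hom A \<Omega> \<Omega>"
  by (rule id_map_hom) simp

text \<open>Simplification leaves \<open>bim X\<close> in evaluated form when \<open>X\<close> is a tensor product, so the rules
  below match the evaluated bimodule and check it by a premise.\<close>

lemma evaluated_nabla_simps [simp]:
  assumes "is_conn X" "bim X = E" "e \<in> carrier E"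
  shows "nabla X e \<in> carrier (\<Omega> \<boxtimes> E)"
    and "e' \<in> carrier E \<Longrightarrow> nabla X (e \<oplus>\<^bsub>E\<^esub> e') = nabla X e \<oplus>\<^bsub>\<Omega> \<boxtimes> E\<^esub> nabla X e'"
  using assms by auto

lemma evaluated_sigma_simps [simp]:
  assumes "is_conn X" "bim X = E"
  shows "t \<in> carrier (E \<boxtimes> \<Omega>) \<Longrightarrow> sigma X t \<in> carrier (\<Omega> \<boxtimes> E)"
    and "\<lbrakk>s \<in> carrier (E \<boxtimes> \<Omega>); t \<in> carrier (E \<boxtimes> \<Omega>)\<rbrakk>
      \<Longrightarrow> sigma X (s \<oplus>\<^bsub>E \<boxtimes> \<Omega>\<^esub> t) = sigma X s \<oplus>\<^bsub>\<Omega> \<boxtimes> E\<^esub> sigma X t"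
    and "t \<in> carrier (\<Omega> \<boxtimes> E) \<Longrightarrow> map_inverse (E \<boxtimes> \<Omega>) (\<Omega> \<boxtimes> E) (sigma X) t \<in> carrier (E \<boxtimes> \<Omega>)"
    and "\<lbrakk>s \<in> carrier (\<Omega> \<boxtimes> E); t \<in> carrier (\<Omega> \<boxtimes> E)\<rbrakk>
      \<Longrightarrow> map_inverse (E \<boxtimes> \<Omega>) (\<Omega> \<boxtimes> E) (sigma X) (s \<oplus>\<^bsub>\<Omega> \<boxtimes> E\<^esub> t)
        = map_inverse (E \<boxtimes> \<Omega>) (\<Omega> \<boxtimes> E) (sigma X) s \<oplus>\<^bsub>E \<boxtimes> \<Omega>\<^esub>
          map_inverse (E \<boxtimes> \<Omega>) (\<Omega> \<boxtimes> E) (sigma X) t"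
  using assms sigma_inv_simps(1,2)[of X] by auto

lemma evaluated_shift_simps [simp]:
  assumes "is_conn X" "bimodule A F" "bim X = E"
  shows "t \<in> carrier (E \<boxtimes> \<Omega> \<boxtimes> F) \<Longrightarrow> shift X F t \<in> carrier (\<Omega> \<boxtimes> E \<boxtimes> F)"
    and "\<lbrakk>s \<in> carrier (E \<boxtimes> \<Omega> \<boxtimes> F); t \<in> carrier (E \<boxtimes> \<Omega> \<boxtimes> F)\<rbrakk>
      \<Longrightarrow> shift X F (s \<oplus>\<^bsub>E \<boxtimes> \<Omega> \<boxtimes> F\<^esub> t) = shift X F s \<oplus>\<^bsub>\<Omega> \<boxtimes> E \<boxtimes> F\<^esub> shift X F t"
    and "\<lbrakk>e \<in> carrier E; w \<in> carrier \<Omega>; f \<in> carrier F\<rbrakk>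
      \<Longrightarrow> shift X F (elt E (\<Omega> \<boxtimes> F) e (elt \<Omega> F w f))
        = bimod_assoc A \<Omega> E F (elt (\<Omega> \<boxtimes> E) F (sigma X (elt E \<Omega> e w)) f)"
  using assms shift_simps(1,2)[of X F] shift_elt[of X F] by auto

lemma evaluated_conn_tensor_simps [simp]:
  assumes "is_conn X" "is_conn Y" "bim X = E" "bim Y = F" "e \<in> carrier E" "f \<in> carrier F"
  shows "nabla (conn_tensor A \<Omega> X Y) (elt E F e f)
      = bimod_assoc A \<Omega> E F (elt (\<Omega> \<boxtimes> E) F (nabla X e) f)
        \<oplus>\<^bsub>\<Omega> \<boxtimes> E \<boxtimes> F\<^esub> shift X F (elt E (\<Omega> \<boxtimes> F) e (nabla Y f))"
    and "w \<in> carrier \<Omega> \<Longrightarrow> sigma (conn_tensor A \<Omega> X Y) (elt (E \<boxtimes> F) \<Omega> (elt E F e f) w)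
      = shift X F (elt E (\<Omega> \<boxtimes> F) e (sigma Y (elt F \<Omega> f w)))"
  using assms conn_tensor_nabla_elt[of X Y e f] conn_tensor_sigma_elt[of X Y e f w] by auto

text \<open>Two complex-linear maps agree on a subspace, and by \<open>spanned\<close> a subspace
  that contains all x dy is everything. Linearity is over the complex numbers only, since e
  \<otimes> w is in general not left linear over A in w.\<close>

lemma Omega_eqI:
  assumes T: "bimodule A T"
    and f: "\<And>w. w \<in> carrier \<Omega> \<Longrightarrow> f w \<in> carrier T"
      "\<And>v w. \<lbrakk>v \<in> carrier \<Omega>; w \<in> carrier \<Omega>\<rbrakk> \<Longrightarrow> f (v \<oplus>\<^bsub>\<Omega>\<^esub> w) = f v \<oplus>\<^bsub>T\<^esub> f w"
      "\<And>c w. w \<in> carrier \<Omega> \<Longrightarrow> f (c \<odot>\<^bsub>\<Omega>\<^esub> w) = c \<odot>\<^bsub>T\<^esub> f w"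
    and g: "\<And>w. w \<in> carrier \<Omega> \<Longrightarrow> g w \<in> carrier T"
      "\<And>v w. \<lbrakk>v \<in> carrier \<Omega>; w \<in> carrier \<Omega>\<rbrakk> \<Longrightarrow> g (v \<oplus>\<^bsub>\<Omega>\<^esub> w) = g v \<oplus>\<^bsub>T\<^esub> g w"
      "\<And>c w. w \<in> carrier \<Omega> \<Longrightarrow> g (c \<odot>\<^bsub>\<Omega>\<^esub> w) = c \<odot>\<^bsub>T\<^esub> g w"
    and eq: "\<And>x y. \<lbrakk>x \<in> carrier A; y \<in> carrier A\<rbrakk> \<Longrightarrow> f (x \<rhd>\<^bsub>\<Omega>\<^esub> d y) = g (x \<rhd>\<^bsub>\<Omega>\<^esub> d y)"
    and w: "w \<in> carrier \<Omega>"
  shows "f w = g w"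
proof -
  interpret M: module complex_field \<Omega>
    by (rule bimodule.vector_space[OF bimodule])
  have zero: "f \<zero>\<^bsub>\<Omega>\<^esub> = \<zero>\<^bsub>T\<^esub>" "g \<zero>\<^bsub>\<Omega>\<^esub> = \<zero>\<^bsub>T\<^esub>"
    by (rule zero_unique[OF T]; simp add: f(1) g(1) flip: f(2) g(2))+
  have "submodule {w \<in> carrier \<Omega>. f w = g w} complex_field \<Omega>"
  proof (rule M.submoduleI)
    fix v
    assume v: "v \<in> {w \<in> carrier \<Omega>. f w = g w}"
    then have "f v \<oplus>\<^bsub>T\<^esub> f (\<ominus>\<^bsub>\<Omega>\<^esub> v) = f v \<oplus>\<^bsub>T\<^esub> g (\<ominus>\<^bsub>\<Omega>\<^esub> v)"
      using f(2)[of v "\<ominus>\<^bsub>\<Omega>\<^esub> v"] g(2)[of v "\<ominus>\<^bsub>\<Omega>\<^esub> v"] zero by (simp add: M.r_neg)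
    then show "\<ominus>\<^bsub>\<Omega>\<^esub> v \<in> {w \<in> carrier \<Omega>. f w = g w}"
      using v f(1) g(1) by (simp add: bimodule_add_cancel[OF T])
  qed (use zero f g in auto)
  then have "{w \<in> carrier \<Omega>. f w = g w} = carrier \<Omega>"
    using eq by (intro spanned) auto
  with w show ?thesis by blast
qed

text \<open>Comparing the right Leibniz rules at \<open>e\<close> and \<open>\<theta> e\<close> shows that a morphism of connections
  also intertwines the maps \<open>sigma\<close>.\<close>

lemma sigma_natural:
  assumes [simp]: "is_conn X" "is_conn Y" and \<theta>: "\<theta> \<in> conn_hom A \<Omega> X Y"
    and t: "t \<in> carrier (bim X \<boxtimes> \<Omega>)"
  shows "sigma Y (tensor_map A (bim X) (bim Y) \<Omega> \<Omega> \<theta> (id_map \<Omega>) t)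
    = tensor_map A \<Omega> \<Omega> (bim X) (bim Y) (id_map \<Omega>) \<theta> (sigma X t)"
proof -
  let ?U = "tensor_map A \<Omega> \<Omega> (bim X) (bim Y) (id_map \<Omega>) \<theta>"
  note hom [simp] = conn_homD(1)[OF \<theta>]
  note [simp] = bimod_homD[OF hom]
  \<comment> \<open>The Leibniz rule involves \<sigma> at exact forms only; there the claim is what
    remains after cancelling the common summand.\<close>
  have exact: "sigma Y (elt (bim Y) \<Omega> (\<theta> e) (d y)) = ?U (sigma X (elt (bim X) \<Omega> e (d y)))"
    if "e \<in> carrier (bim X)" "y \<in> carrier A" for e y
  proof -
    have "nabla Y (\<theta> (e \<lhd>\<^bsub>bim X\<^esub> y)) = ?U (nabla X (e \<lhd>\<^bsub>bim X\<^esub> y))"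
      using that by (intro conn_homD(2)[OF \<theta>]) simp
    then show ?thesis
      using that by (simp add: conn_homD(2)[OF \<theta>] bimodule_add_cancel)
  qed
  have "sigma Y (elt (bim Y) \<Omega> (\<theta> e) w) = ?U (sigma X (elt (bim X) \<Omega> e w))"
    if e: "e \<in> carrier (bim X)" and w: "w \<in> carrier \<Omega>" for e w
  proof (rule Omega_eqI[where T = "\<Omega> \<boxtimes> bim Y", OF _ _ _ _ _ _ _ _ w])
    \<comment> \<open>The coefficient moves to the other factor, e \<otimes> x dy = ex \<otimes> dy,
      and the exact case applies to ex.\<close>
    fix x y
    assume xy: "x \<in> carrier A" "y \<in> carrier A"
    then show "sigma Y (elt (bim Y) \<Omega> (\<theta> e) (x \<rhd>\<^bsub>\<Omega>\<^esub> d y)) = ?U (sigma X (elt (bim X) \<Omega> e (x \<rhd>\<^bsub>\<Omega>\<^esub> d y)))"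
      using e exact[of "e \<lhd>\<^bsub>bim X\<^esub> x" y] by (simp add: tensor_elt_balanced)
  qed (use e in simp_all)
  note elt = this
  show ?thesis
    using t is_conn_bimodule[OF assms(1)] Omega_bimodule
    by (induct rule: tensor_induct) (simp_all add: elt)
qed

lemma id_map_conn_hom:
  assumes [simp]: "is_conn X"
  shows "id_map (bim X) \<in> conn_hom A \<Omega> X X"
proof (rule conn_homI)
  have "tensor_map A \<Omega> \<Omega> (bim X) (bim X) (id_map \<Omega>) (id_map (bim X)) t = t"
    if "t \<in> carrier (\<Omega> \<boxtimes> bim X)" for t
    using that Omega_bimodule is_conn_bimodule[OF assms]
    by (induct rule: tensor_induct) (simp_all add: id_map_hom)
  then show "nabla X (id_map (bim X) e)
      = tensor_map A \<Omega> \<Omega> (bim X) (bim X) (id_map \<Omega>) (id_map (bim X)) (nabla X e)"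
    if "e \<in> carrier (bim X)" for e
    using that by simp
qed (simp add: id_map_hom)

lemma compose_conn_hom:
  assumes [simp]: "is_conn X" "is_conn Y" "is_conn Z"
    and \<theta>: "\<theta> \<in> conn_hom A \<Omega> X Y" and \<phi>: "\<phi> \<in> conn_hom A \<Omega> Y Z"
  shows "compose (carrier (bim X)) \<phi> \<theta> \<in> conn_hom A \<Omega> X Z"
proof (rule conn_homI)
  note homs [simp] = conn_homD(1)[OF \<theta>] conn_homD(1)[OF \<phi>]
  note [simp] = bimod_homD[OF homs(1)] bimod_homD[OF homs(2)]
  show hom [simp]: "compose (carrier (bim X)) \<phi> \<theta> \<in> bimod_hom A (bim X) (bim Z)"
    by (rule bimod_hom_compose[OF homs]) simp
  have "tensor_map A \<Omega> \<Omega> (bim X) (bim Z) (id_map \<Omega>) (compose (carrier (bim X)) \<phi> \<theta>) t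
      = tensor_map A \<Omega> \<Omega> (bim Y) (bim Z) (id_map \<Omega>) \<phi>
          (tensor_map A \<Omega> \<Omega> (bim X) (bim Y) (id_map \<Omega>) \<theta> t)"
    if "t \<in> carrier (\<Omega> \<boxtimes> bim X)" for t
    using that Omega_bimodule is_conn_bimodule[OF assms(1)]
    by (induct rule: tensor_induct) (simp_all add: compose_eq)
  then show "nabla Z (compose (carrier (bim X)) \<phi> \<theta> e)
      = tensor_map A \<Omega> \<Omega> (bim X) (bim Z) (id_map \<Omega>) (compose (carrier (bim X)) \<phi> \<theta>) (nabla X e)"
    if "e \<in> carrier (bim X)" for e
    using that by (simp add: compose_eq conn_homD(2)[OF \<theta>] conn_homD(2)[OF \<phi>])
qed

text \<open>id \<otimes> \<psi> undoes id \<otimes> \<theta>, so the relation for \<theta> at \<psi>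
  f can be solved for the derivative of \<psi> f. Structure isomorphisms therefore need checking in
  one direction only.\<close>

lemma map_inverse_conn_hom:
  assumes [simp]: "is_conn X" "is_conn Y"
    and \<theta>: "\<theta> \<in> conn_hom A \<Omega> X Y" and iso: "bimod_iso (bim X) (bim Y) \<theta>"
  shows "map_inverse (bim X) (bim Y) \<theta> \<in> conn_hom A \<Omega> Y X"
proof (rule conn_homI)
  let ?\<psi> = "map_inverse (bim X) (bim Y) \<theta>"
  note [simp] = conn_homD(1)[OF \<theta>] bimod_homD[OF conn_homD(1)[OF \<theta>]] map_inverse_simps[OF iso]
  show hom [simp]: "?\<psi> \<in> bimod_hom A (bim Y) (bim X)"
    by (rule map_inverse_hom[OF iso]) simp
  have "tensor_map A \<Omega> \<Omega> (bim Y) (bim X) (id_map \<Omega>) ?\<psi>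
      (tensor_map A \<Omega> \<Omega> (bim X) (bim Y) (id_map \<Omega>) \<theta> t) = t"
    if "t \<in> carrier (\<Omega> \<boxtimes> bim X)" for t
    using that Omega_bimodule is_conn_bimodule[OF assms(1)]
    by (induct rule: tensor_induct) simp_all
  then show "nabla X (?\<psi> f) = tensor_map A \<Omega> \<Omega> (bim Y) (bim X) (id_map \<Omega>) ?\<psi> (nabla Y f)"
    if "f \<in> carrier (bim Y)" for f
    using that conn_homD(2)[OF \<theta>, of "?\<psi> f"] by simp
qed

text \<open>In the second summand a form is carried past E by \<sigma>, which is why
  \<open>sigma_natural\<close> is needed for \<theta>; from \<phi> only the relation between the
  derivatives enters.\<close>

lemma tensor_map_conn_hom:
  assumes [simp]: "is_conn X" "is_conn X'" "is_conn Y" "is_conn Y'"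
    and \<theta>: "\<theta> \<in> conn_hom A \<Omega> X X'" and \<phi>: "\<phi> \<in> conn_hom A \<Omega> Y Y'"
  shows "tensor_map A (bim X) (bim X') (bim Y) (bim Y') \<theta> \<phi>
    \<in> conn_hom A \<Omega> (conn_tensor A \<Omega> X Y) (conn_tensor A \<Omega> X' Y')"
proof (rule conn_homI; simp only: bim_conn_tensor)
  let ?E = "bim X" and ?E' = "bim X'" and ?F = "bim Y" and ?F' = "bim Y'"
  let ?T = "tensor_map A ?E ?E' ?F ?F' \<theta> \<phi>"
  let ?U = "tensor_map A \<Omega> \<Omega> (?E \<boxtimes> ?F) (?E' \<boxtimes> ?F') (id_map \<Omega>) ?T"
  note homs [simp] = conn_homD(1)[OF \<theta>] conn_homD(1)[OF \<phi>]
  note [simp] = bimod_homD[OF homs(1)] bimod_homD[OF homs(2)]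
  show hom [simp]: "?T \<in> bimod_hom A (?E \<boxtimes> ?F) (?E' \<boxtimes> ?F')"
    by (rule tensor_map_hom) simp_all
  have assoc: "?U (bimod_assoc A \<Omega> ?E ?F (elt (\<Omega> \<boxtimes> ?E) ?F t f))
      = bimod_assoc A \<Omega> ?E' ?F' (elt (\<Omega> \<boxtimes> ?E') ?F' (tensor_map A \<Omega> \<Omega> ?E ?E' (id_map \<Omega>) \<theta> t) (\<phi> f))"
    if t: "t \<in> carrier (\<Omega> \<boxtimes> ?E)" and f: "f \<in> carrier ?F" for t f
    using t Omega_bimodule is_conn_bimodule[OF assms(1)]
    by (induct rule: tensor_induct) (use f in simp_all)
  have shift: "?U (shift X ?F (elt ?E (\<Omega> \<boxtimes> ?F) e u))
      = shift X' ?F' (elt ?E' (\<Omega> \<boxtimes> ?F') (\<theta> e) (tensor_map A \<Omega> \<Omega> ?F ?F' (id_map \<Omega>) \<phi> u))"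
    if u: "u \<in> carrier (\<Omega> \<boxtimes> ?F)" and e: "e \<in> carrier ?E" for u e
    using u Omega_bimodule is_conn_bimodule[OF assms(3)]
  proof (induct rule: tensor_induct)
    case (elt w f)
    then show ?case
      using e sigma_natural[OF _ _ \<theta>, of "elt ?E \<Omega> e w"] by (simp add: assoc)
  qed (use e in simp)
  show "nabla (conn_tensor A \<Omega> X' Y') (?T t) = ?U (nabla (conn_tensor A \<Omega> X Y) t)"
    if "t \<in> carrier (?E \<boxtimes> ?F)" for t
    using that is_conn_bimodule[OF assms(1)] is_conn_bimodule[OF assms(3)]
    by (induct rule: tensor_induct) (simp_all add: assoc shift conn_homD(2)[OF \<theta>] conn_homD(2)[OF \<phi>])
qed

text \<open>Both derivatives of e \<otimes> f \<otimes> g have three summands, with the derivative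
  on e, f or g, and they match separately. Once \<open>shift\<close> is evaluated at a form, the
  third case is an instance of the second and the second of the first.\<close>

lemma bimod_assoc_conn_hom:
  assumes [simp]: "is_conn X" "is_conn Y" "is_conn Z"
  shows "bimod_assoc A (bim X) (bim Y) (bim Z) \<in> conn_hom A \<Omega>
    (conn_tensor A \<Omega> (conn_tensor A \<Omega> X Y) Z) (conn_tensor A \<Omega> X (conn_tensor A \<Omega> Y Z))"
proof (rule conn_homI; simp only: bim_conn_tensor)
  let ?E = "bim X" and ?F = "bim Y" and ?G = "bim Z"
  note bims = assms[THEN is_conn_bimodule]
  let ?a = "bimod_assoc A ?E ?F ?G"
  let ?U = "tensor_map A \<Omega> \<Omega> ((?E \<boxtimes> ?F) \<boxtimes> ?G) (?E \<boxtimes> ?F \<boxtimes> ?G) (id_map \<Omega>) ?a"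
  show hom [simp]: "?a \<in> bimod_hom A ((?E \<boxtimes> ?F) \<boxtimes> ?G) (?E \<boxtimes> ?F \<boxtimes> ?G)"
    by (rule bimod_assoc_hom) simp_all
  have first: "?U (bimod_assoc A \<Omega> (?E \<boxtimes> ?F) ?G (elt (\<Omega> \<boxtimes> ?E \<boxtimes> ?F) ?G
        (bimod_assoc A \<Omega> ?E ?F (elt (\<Omega> \<boxtimes> ?E) ?F t f)) g))
      = bimod_assoc A \<Omega> ?E (?F \<boxtimes> ?G) (elt (\<Omega> \<boxtimes> ?E) (?F \<boxtimes> ?G) t (elt ?F ?G f g))"
    if t: "t \<in> carrier (\<Omega> \<boxtimes> ?E)" and fg: "f \<in> carrier ?F" "g \<in> carrier ?G" for t f g
    using t Omega_bimodule bims(1)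
    by (induct rule: tensor_induct) (use fg in simp_all)
  have second: "?U (bimod_assoc A \<Omega> (?E \<boxtimes> ?F) ?G (elt (\<Omega> \<boxtimes> ?E \<boxtimes> ?F) ?G
        (shift X ?F (elt ?E (\<Omega> \<boxtimes> ?F) e u)) g))
      = shift X (?F \<boxtimes> ?G) (elt ?E (\<Omega> \<boxtimes> ?F \<boxtimes> ?G) e (bimod_assoc A \<Omega> ?F ?G (elt (\<Omega> \<boxtimes> ?F) ?G u g)))"
    if u: "u \<in> carrier (\<Omega> \<boxtimes> ?F)" and eg: "e \<in> carrier ?E" "g \<in> carrier ?G" for e u g
    using u Omega_bimodule bims(2)
    by (induct rule: tensor_induct) (use eg in \<open>simp_all add: first\<close>)
  have third: "?U (shift (conn_tensor A \<Omega> X Y) ?G (elt (?E \<boxtimes> ?F) (\<Omega> \<boxtimes> ?G) (elt ?E ?F e f) v))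
      = shift X (?F \<boxtimes> ?G) (elt ?E (\<Omega> \<boxtimes> ?F \<boxtimes> ?G) e (shift Y ?G (elt ?F (\<Omega> \<boxtimes> ?G) f v)))"
    if v: "v \<in> carrier (\<Omega> \<boxtimes> ?G)" and ef: "e \<in> carrier ?E" "f \<in> carrier ?F" for e f v
    using v Omega_bimodule bims(3)
    by (induct rule: tensor_induct) (use ef in \<open>simp_all add: second\<close>)
  show "nabla (conn_tensor A \<Omega> X (conn_tensor A \<Omega> Y Z)) (?a t)
      = ?U (nabla (conn_tensor A \<Omega> (conn_tensor A \<Omega> X Y) Z) t)"
    if "t \<in> carrier ((?E \<boxtimes> ?F) \<boxtimes> ?G)" for t
    using that tensor_bimodule[OF bims(1,2)] bims(3)
  proof (induct rule: tensor_induct)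
    case (elt s g)
    from elt(1) bims(1,2) show ?case
      by (induct rule: tensor_induct) (use elt(2) in \<open>simp_all add: first second third bimodule_add_ac\<close>)
  qed simp
qed

text \<open>For a \<otimes> e the two summands of the tensor derivative become da \<otimes> e and a
  \<nabla>e, which is the left Leibniz rule.\<close>

lemma bimod_lunit_conn_hom:
  assumes [simp]: "is_conn X"
  shows "bimod_lunit A (bim X) \<in> conn_hom A \<Omega> (conn_tensor A \<Omega> (conn_unit A \<Omega> d) X) X"
proof (rule conn_homI; simp only: bim_conn_tensor conn_unit_simps(1))
  let ?E = "bim X" and ?R = "regular_bimod A"
  let ?U = "tensor_map A \<Omega> \<Omega> (?R \<boxtimes> ?E) ?E (id_map \<Omega>) (bimod_lunit A ?E)"
  show hom [simp]: "bimod_lunit A ?E \<in> bimod_hom A (?R \<boxtimes> ?E) ?E"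
    by (rule bimod_lunit_hom) simp
  have shift: "?U (shift (conn_unit A \<Omega> d) ?E (elt ?R (\<Omega> \<boxtimes> ?E) a u)) = a \<rhd>\<^bsub>\<Omega> \<boxtimes> ?E\<^esub> u"
    if u: "u \<in> carrier (\<Omega> \<boxtimes> ?E)" and a: "a \<in> carrier A" for u a
    using u Omega_bimodule is_conn_bimodule[OF assms]
    by (induct rule: tensor_induct) (use a in simp_all)
  show "nabla X (bimod_lunit A ?E t) = ?U (nabla (conn_tensor A \<Omega> (conn_unit A \<Omega> d) X) t)"
    if "t \<in> carrier (?R \<boxtimes> ?E)" for t
    using that regular_bimodule is_conn_bimodule[OF assms]
    by (induct rule: tensor_induct) (simp_all add: shift)
qed

text \<open>Here the summands become (\<nabla>e)a and \<sigma>(e \<otimes> da), which is the right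
  Leibniz rule.\<close>

lemma bimod_runit_conn_hom:
  assumes [simp]: "is_conn X"
  shows "bimod_runit A (bim X) \<in> conn_hom A \<Omega> (conn_tensor A \<Omega> X (conn_unit A \<Omega> d)) X"
proof (rule conn_homI; simp only: bim_conn_tensor conn_unit_simps(1))
  let ?E = "bim X" and ?R = "regular_bimod A"
  let ?U = "tensor_map A \<Omega> \<Omega> (?E \<boxtimes> ?R) ?E (id_map \<Omega>) (bimod_runit A ?E)"
  show hom [simp]: "bimod_runit A ?E \<in> bimod_hom A (?E \<boxtimes> ?R) ?E"
    by (rule bimod_runit_hom) simp
  have assoc: "?U (bimod_assoc A \<Omega> ?E ?R (elt (\<Omega> \<boxtimes> ?E) ?R t a)) = t \<lhd>\<^bsub>\<Omega> \<boxtimes> ?E\<^esub> a"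
    if t: "t \<in> carrier (\<Omega> \<boxtimes> ?E)" and a: "a \<in> carrier A" for t a
    using t Omega_bimodule is_conn_bimodule[OF assms]
    by (induct rule: tensor_induct) (use a in simp_all)
  show "nabla X (bimod_runit A ?E t) = ?U (nabla (conn_tensor A \<Omega> X (conn_unit A \<Omega> d)) t)"
    if "t \<in> carrier (?E \<boxtimes> ?R)" for t
    using that is_conn_bimodule[OF assms] regular_bimodule
    by (induct rule: tensor_induct) (simp_all add: assoc)
qed

section \<open>The bar category of connections\<close>

text \<open>The conjugate derivative contains the inverse of \<sigma>, so \<theta> has to intertwine
  these inverses as well; applying \<sigma> of Y reduces this to
  \<open>sigma_natural\<close>.\<close>

lemma bar_conn_hom:
  assumes [simp]: "is_conn X" "is_conn Y" and \<theta>: "\<theta> \<in> conn_hom A \<Omega> X Y"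
  shows "\<theta> \<in> conn_hom A \<Omega> (conn_bar A \<Omega> st X) (conn_bar A \<Omega> st Y)"
proof (rule conn_homI)
  let ?E = "bim X" and ?F = "bim Y"
  let ?V = "tensor_map A ?E ?F \<Omega> \<Omega> \<theta> (id_map \<Omega>)"
  note hom [simp] = conn_homD(1)[OF \<theta>] bimod_hom_conj[OF conn_homD(1)[OF \<theta>]]
  note [simp] = bimod_homD[OF hom(1)]
  show "\<theta> \<in> bimod_hom A (bim (conn_bar A \<Omega> st X)) (bim (conn_bar A \<Omega> st Y))"
    by simp
  have swap: "swap ?F (?V t) = tensor_map A \<Omega> \<Omega> (conj_bimod A ?E) (conj_bimod A ?F) (id_map \<Omega>) \<theta> (swap ?E t)"
    if "t \<in> carrier (?E \<boxtimes> \<Omega>)" for t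
    using that is_conn_bimodule[OF assms(1)] Omega_bimodule
    by (induct rule: tensor_induct) simp_all
  have sigma: "sigma_inv Y (tensor_map A \<Omega> \<Omega> ?E ?F (id_map \<Omega>) \<theta> t) = ?V (sigma_inv X t)"
    if "t \<in> carrier (\<Omega> \<boxtimes> ?E)" for t
    by (rule map_inverse_eqI[OF is_conn_sigma_iso])
      (use that in \<open>simp_all add: sigma_natural[OF _ _ \<theta>]\<close>)
  show "nabla (conn_bar A \<Omega> st Y) (\<theta> e) = tensor_map A \<Omega> \<Omega> (bim (conn_bar A \<Omega> st X))
      (bim (conn_bar A \<Omega> st Y)) (id_map \<Omega>) \<theta> (nabla (conn_bar A \<Omega> st X) e)"
    if "e \<in> carrier (bim (conn_bar A \<Omega> st X))" for e
    using that by (simp add: conn_homD(2)[OF \<theta>] sigma swap)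
qed

text \<open>The inverse \<sigma> of the tensor product sends \<open>shift\<close> of e \<otimes>
  \<nabla>f to e \<otimes> \<sigma>^-1 \<nabla>f, and the flip makes this the derivative of the
  conjugate of f, tensored with e. The summand with \<nabla>e becomes the second one, its form being
  carried past the conjugate of F by the \<sigma> there.\<close>

lemma bimod_Upsilon_conn_hom:
  assumes X [simp]: "is_conn X" and Y [simp]: "is_conn Y"
  shows "bimod_Upsilon A (bim X) (bim Y) \<in> conn_hom A \<Omega> (conn_bar A \<Omega> st (conn_tensor A \<Omega> X Y))
    (conn_tensor A \<Omega> (conn_bar A \<Omega> st Y) (conn_bar A \<Omega> st X))"
proof (rule conn_homI)
  let ?E = "bim X" and ?F = "bim Y" and ?XY = "conn_tensor A \<Omega> X Y"
  let ?E' = "conj_bimod A ?E" and ?F' = "conj_bimod A ?F"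
  let ?U = "tensor_map A \<Omega> \<Omega> (conj_bimod A (?E \<boxtimes> ?F)) (?F' \<boxtimes> ?E') (id_map \<Omega>) (bimod_Upsilon A ?E ?F)"
  let ?s = "map_inverse ((?E \<boxtimes> ?F) \<boxtimes> \<Omega>) (\<Omega> \<boxtimes> ?E \<boxtimes> ?F) (sigma ?XY)"
  have hom [simp]: "bimod_Upsilon A ?E ?F \<in> bimod_hom A (conj_bimod A (?E \<boxtimes> ?F)) (?F' \<boxtimes> ?E')"
    by (rule bimod_Upsilon_hom) simp_all
  then show "bimod_Upsilon A ?E ?F \<in> bimod_hom A (bim (conn_bar A \<Omega> st ?XY))
      (bim (conn_tensor A \<Omega> (conn_bar A \<Omega> st Y) (conn_bar A \<Omega> st X)))"
    by simp
  have sigma: "sigma ?XY (assoc_inv ?E ?F \<Omega> (elt ?E (?F \<boxtimes> \<Omega>) e v)) = shift X ?F (elt ?E (\<Omega> \<boxtimes> ?F) e (sigma Y v))"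
    if v: "v \<in> carrier (?F \<boxtimes> \<Omega>)" and e: "e \<in> carrier ?E" for e v
    using v is_conn_bimodule[OF Y] Omega_bimodule
    by (induct rule: tensor_induct) (use e in simp_all)
  have inv_shift: "?s (shift X ?F (elt ?E (\<Omega> \<boxtimes> ?F) e u)) = assoc_inv ?E ?F \<Omega> (elt ?E (?F \<boxtimes> \<Omega>) e (sigma_inv Y u))"
    if "u \<in> carrier (\<Omega> \<boxtimes> ?F)" "e \<in> carrier ?E" for e u
    using that by (intro map_inverse_eqI[OF conn_tensor_sigma_iso]) (simp_all add: sigma)
  have swap: "?U (swap (?E \<boxtimes> ?F) (assoc_inv ?E ?F \<Omega> (elt ?E (?F \<boxtimes> \<Omega>) e v)))
      = bimod_assoc A \<Omega> ?F' ?E' (elt (\<Omega> \<boxtimes> ?F') ?E' (swap ?F v) e)"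
    if v: "v \<in> carrier (?F \<boxtimes> \<Omega>)" and e: "e \<in> carrier ?E" for e v
    using v is_conn_bimodule[OF Y] Omega_bimodule
    by (induct rule: tensor_induct) (use e in simp_all)
  \<comment> \<open>The parameter is u in E \<boxtimes> \<Omega> rather than \<sigma>(u): at u = e
    \<otimes> w the argument of \<open>?s\<close> is \<open>shift\<close> of e \<otimes> (w
    \<otimes> f), to which \<open>inv_shift\<close> applies, whereas the inverse of \<sigma> has no
    formula on elementary tensors of \<Omega> \<boxtimes> E.\<close>
  have inv_assoc: "?U (swap (?E \<boxtimes> ?F) (?s (bimod_assoc A \<Omega> ?E ?F (elt (\<Omega> \<boxtimes> ?E) ?F (sigma X u) f))))
      = shift (conn_bar A \<Omega> st Y) ?E' (elt ?F' (\<Omega> \<boxtimes> ?E') f (swap ?E u))"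
    if u: "u \<in> carrier (?E \<boxtimes> \<Omega>)" and f: "f \<in> carrier ?F" for u f
    using u is_conn_bimodule[OF X] Omega_bimodule
  proof (induct rule: tensor_induct)
    case (elt e w)
    then show ?case
      using f inv_shift[of "elt \<Omega> ?F w f" e] by (simp add: swap)
  qed (use f in simp)
  have "nabla (conn_tensor A \<Omega> (conn_bar A \<Omega> st Y) (conn_bar A \<Omega> st X)) (bimod_Upsilon A ?E ?F t)
      = ?U (swap (?E \<boxtimes> ?F) (?s (nabla ?XY t)))"
    if t: "t \<in> carrier (?E \<boxtimes> ?F)" for t
    using t is_conn_bimodule[OF X] is_conn_bimodule[OF Y]
  proof (induct rule: tensor_induct)
    case (elt e f)
    then show ?case
      using inv_assoc[of "sigma_inv X (nabla X e)" f]
      by (simp add: inv_shift swap bimodule_add_ac)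
  qed simp
  then show "nabla (conn_tensor A \<Omega> (conn_bar A \<Omega> st Y) (conn_bar A \<Omega> st X)) (bimod_Upsilon A ?E ?F t)
      = tensor_map A \<Omega> \<Omega> (bim (conn_bar A \<Omega> st ?XY))
          (bim (conn_tensor A \<Omega> (conn_bar A \<Omega> st Y) (conn_bar A \<Omega> st X)))
          (id_map \<Omega>) (bimod_Upsilon A ?E ?F) (nabla (conn_bar A \<Omega> st ?XY) t)"
    if "t \<in> carrier (bim (conn_bar A \<Omega> st ?XY))" for t
    using that by simp
qed

text \<open>The conjugate has derivative \<open>swap\<close> \<sigma>^-1 \<nabla> and braiding
  \<open>swap\<close> \<sigma>^-1 \<open>unswap\<close>. In the double conjugate \<sigma> and the
  inner \<open>swap\<close> cancel, leaving \<open>swap\<close> after the inverse of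
  \<open>unswap\<close>, which is the identity up to \<open>bb\<close>.\<close>

lemma bb_conn_hom:
  assumes [simp]: "is_conn X"
  shows "id_map (bim X) \<in> conn_hom A \<Omega> X (conn_bar A \<Omega> st (conn_bar A \<Omega> st X))"
proof (rule conn_homI)
  let ?E = "bim X" and ?c = "conj_bimod A"
  have hom [simp]: "id_map ?E \<in> bimod_hom A ?E (?c (?c ?E))"
    by (rule bimod_iso_hom[OF id_map_bb_iso]) simp
  then show "id_map ?E \<in> bimod_hom A ?E (bim (conn_bar A \<Omega> st (conn_bar A \<Omega> st X)))"
    by simp
  \<comment> \<open>In place of an inverse of \<open>unswap\<close>, a preimage with known
    \<open>swap\<close> is produced; for w \<otimes> e it is e \<otimes>
    \<open>st w\<close>.\<close>
  have double: "\<exists>s\<in>carrier (?c ?E \<boxtimes> \<Omega>). unswap ?E s = t \<and>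
      swap (?c ?E) s = tensor_map A \<Omega> \<Omega> ?E (?c (?c ?E)) (id_map \<Omega>) (id_map ?E) t"
    if "t \<in> carrier (\<Omega> \<boxtimes> ?E)" for t
    using that Omega_bimodule is_conn_bimodule[OF assms]
  proof (induct rule: tensor_induct)
    case (elt w e)
    then show ?case
      by (intro bexI[of _ "elt (?c ?E) \<Omega> e (st w)"]) simp_all
  next
    case (add s t)
    then obtain s' t' where "s' \<in> carrier (?c ?E \<boxtimes> \<Omega>)" "t' \<in> carrier (?c ?E \<boxtimes> \<Omega>)"
      "unswap ?E s' = s" "unswap ?E t' = t"
      "swap (?c ?E) s' = tensor_map A \<Omega> \<Omega> ?E (?c (?c ?E)) (id_map \<Omega>) (id_map ?E) s"
      "swap (?c ?E) t' = tensor_map A \<Omega> \<Omega> ?E (?c (?c ?E)) (id_map \<Omega>) (id_map ?E) t"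
      by blast
    with add(1,2) show ?case
      by (intro bexI[of _ "s' \<oplus>\<^bsub>?c ?E \<boxtimes> \<Omega>\<^esub> t'"]) simp_all
  qed
  fix e
  assume e: "e \<in> carrier ?E"
  then obtain s where s: "s \<in> carrier (?c ?E \<boxtimes> \<Omega>)" "unswap ?E s = nabla X e"
    "swap (?c ?E) s = tensor_map A \<Omega> \<Omega> ?E (?c (?c ?E)) (id_map \<Omega>) (id_map ?E) (nabla X e)"
    using double[of "nabla X e"] by auto
  have "sigma_inv (conn_bar A \<Omega> st X) (nabla (conn_bar A \<Omega> st X) e) = s"
    by (rule map_inverse_eqI[OF is_conn_sigma_iso]) (use e s in simp_all)
  then show "nabla (conn_bar A \<Omega> st (conn_bar A \<Omega> st X)) (id_map ?E e)
      = tensor_map A \<Omega> \<Omega> ?E (bim (conn_bar A \<Omega> st (conn_bar A \<Omega> st X))) (id_map \<Omega>) (id_map ?E) (nabla X e)"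
    using e s by simp
qed

text \<open>At \<open>star A a\<close> the conjugate derivative is \<open>swap\<close> of 1
  \<otimes> \<open>d (star A a)\<close>, that is da \<otimes> 1. This is also the image of da
  \<otimes> 1 under id \<otimes> \<open>star A\<close>, the unit being self-adjoint.\<close>

lemma unit_star_conn_hom:
  "(\<lambda>a\<in>carrier A. star A a) \<in> conn_hom A \<Omega> (conn_unit A \<Omega> d) (conn_bar A \<Omega> st (conn_unit A \<Omega> d))"
proof (rule conn_homI)
  let ?R = "regular_bimod A" and ?I = "conn_unit A \<Omega> d"
  have hom [simp]: "(\<lambda>a\<in>carrier A. star A a) \<in> bimod_hom A ?R (conj_bimod A ?R)"
    by (rule bimod_iso_hom[OF restrict_star_iso])
  then show "(\<lambda>a\<in>carrier A. star A a) \<in> bimod_hom A (bim ?I) (bim (conn_bar A \<Omega> st ?I))"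
    by simp
  fix a
  assume "a \<in> carrier (bim ?I)"
  then have a: "a \<in> carrier A" by simp
  have "sigma_inv ?I (nabla ?I (star A a)) = elt ?R \<Omega> \<one> (d (star A a))"
    by (rule map_inverse_eqI[OF is_conn_sigma_iso]) (use a in simp_all)
  then show "nabla (conn_bar A \<Omega> st ?I) ((\<lambda>a\<in>carrier A. star A a) a)
      = tensor_map A \<Omega> \<Omega> (bim ?I) (bim (conn_bar A \<Omega> st ?I)) (id_map \<Omega>) (\<lambda>a\<in>carrier A. star A a) (nabla ?I a)"
    using a by simp
qed

section \<open>Transfer of the laws from bimodules to connections\<close>

lemma conn_category_simps [simp]:
  "Obj (conn_category A \<Omega> d st) = {X. is_conn X}"
  "Hom (conn_category A \<Omega> d st) = conn_hom A \<Omega>"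
  "ident (conn_category A \<Omega> d st) X = id_map (bim X)"
  "comp (conn_category A \<Omega> d st) X Y Z \<phi> \<theta> = compose (carrier (bim X)) \<phi> \<theta>"
  "tensor_ob (conn_category A \<Omega> d st) = conn_tensor A \<Omega>"
  "tensor_mor (conn_category A \<Omega> d st) X X' Y Y' = tensor_map A (bim X) (bim X') (bim Y) (bim Y')"
  "unit_ob (conn_category A \<Omega> d st) = conn_unit A \<Omega> d"
  "associator (conn_category A \<Omega> d st) X Y Z = bimod_assoc A (bim X) (bim Y) (bim Z)"
  "lunitor (conn_category A \<Omega> d st) X = bimod_lunit A (bim X)"
  "runitor (conn_category A \<Omega> d st) X = bimod_runit A (bim X)"
  "bar_ob (conn_category A \<Omega> d st) = conn_bar A \<Omega> st"
  "bar_mor (conn_category A \<Omega> d st) X Y \<theta> = \<theta>"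
  "Upsilon (conn_category A \<Omega> d st) X Y = bimod_Upsilon A (bim X) (bim Y)"
  "bb (conn_category A \<Omega> d st) X = id_map (bim X)"
  "unit_star (conn_category A \<Omega> d st) = (\<lambda>a\<in>carrier A. star A a)"
  by (simp_all add: conn_category_def Let_def)

text \<open>Composition and identities are those of bimodules, so the only question is whether the
  inverse respects the derivatives. By uniqueness it is \<open>map_inverse\<close>, which
  does.\<close>

lemma conn_is_inverse_iff:
  assumes [simp]: "is_conn X" "is_conn Y" and \<theta>: "\<theta> \<in> conn_hom A \<Omega> X Y"
  shows "is_inverse (conn_category A \<Omega> d st) X Y \<theta> \<phi>
    \<longleftrightarrow> is_inverse (bimod_category A) (bim X) (bim Y) \<theta> \<phi>"
proof
  assume "is_inverse (bimod_category A) (bim X) (bim Y) \<theta> \<phi>"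
  moreover from this have iso: "bimod_iso (bim X) (bim Y) \<theta>"
    using bimod_is_iso_iff[of "bim X" "bim Y"] by (auto simp: is_iso_def)
  ultimately have "\<phi> = map_inverse (bim X) (bim Y) \<theta>"
    using category.is_inverse_unique[OF bimod_category, of "bim X" "bim Y" \<theta> \<phi>]
      bimod_iso_is_inverse[OF iso] by simp
  then show "is_inverse (conn_category A \<Omega> d st) X Y \<theta> \<phi>"
    using bimod_iso_is_inverse[OF iso] \<theta> map_inverse_conn_hom[OF assms iso]
    by (simp add: is_inverse_def)
qed (use conn_homD(1) in \<open>auto simp: is_inverse_def\<close>)

lemma conn_is_isoI:
  assumes "is_conn X" "is_conn Y" "\<theta> \<in> conn_hom A \<Omega> X Y" "bimod_iso (bim X) (bim Y) \<theta>"
  shows "is_iso (conn_category A \<Omega> d st) X Y \<theta>"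
  using bimod_iso_is_inverse[OF assms(4)] assms conn_is_inverse_iff[OF assms(1-3)]
  by (auto simp: is_iso_def)

text \<open>As \<open>inverse_mor\<close> is a definite description, equivalent inverse predicates
  give equal inverses, and the one computed among bimodules can be reused.\<close>

lemma conn_inverse_unit_star:
  "inverse_mor (conn_category A \<Omega> d st) (conn_unit A \<Omega> d) (conn_bar A \<Omega> st (conn_unit A \<Omega> d))
    (\<lambda>a\<in>carrier A. star A a) = (\<lambda>a\<in>carrier A. star A a)"
proof -
  have "is_inverse (conn_category A \<Omega> d st) (conn_unit A \<Omega> d) (conn_bar A \<Omega> st (conn_unit A \<Omega> d))
      (\<lambda>a\<in>carrier A. star A a) = is_inverse (bimod_category A) (regular_bimod A)
      (conj_bimod A (regular_bimod A)) (\<lambda>a\<in>carrier A. star A a)"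
    by (rule ext) (simp add: conn_is_inverse_iff unit_star_conn_hom)
  then show ?thesis
    using inverse_restrict_star by (simp add: inverse_mor_def)
qed

theorem conn_bar_category: "bar_category (conn_category A \<Omega> d st)"
proof -
  interpret M: bar_category "bimod_category A"
    by (rule bimod_bar_category)
  have cat: "category (conn_category A \<Omega> d st)"
  proof (unfold_locales, goal_cases)
    case 1 then show ?case using id_map_conn_hom by simp
  next
    case 2 then show ?case using compose_conn_hom by simp
  next
    case (3 X Y f) then show ?case using M.comp_ident_left[of "bim X" "bim Y" f] conn_homD(1) by simp
  next
    case (4 X Y f) then show ?case using M.comp_ident_right[of "bim X" "bim Y" f] conn_homD(1) by simp
  next
    case (5 W X Y Z f g h) then show ?case
      using M.comp_assoc[of "bim W" "bim X" "bim Y" "bim Z" f g h] conn_homD(1) by simp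
  qed
  have mon: "monoidal_category (conn_category A \<Omega> d st)"
  proof (intro monoidal_category.intro monoidal_category_axioms.intro cat, goal_cases)
    case 1 then show ?case by simp
  next
    case 2 then show ?case using tensor_map_conn_hom by simp
  next
    case (3 X Y) then show ?case using M.tensor_ident[of "bim X" "bim Y"] by simp
  next
    case (4 X X' X'' Y Y' Y'' f f' g g') then show ?case
      using M.tensor_comp[of "bim X" "bim X'" "bim X''" "bim Y" "bim Y'" "bim Y''" f f' g g'] conn_homD(1)
      by simp
  next
    case 5 then show ?case by simp
  next
    case 6 then show ?case by (intro conn_is_isoI) (simp_all add: bimod_assoc_conn_hom bimod_assoc_iso)
  next
    case 7 then show ?case by (intro conn_is_isoI) (simp_all add: bimod_lunit_conn_hom bimod_lunit_iso)
  next
    case 8 then show ?case by (intro conn_is_isoI) (simp_all add: bimod_runit_conn_hom bimod_runit_iso)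
  next
    case (9 X X' Y Y' Z Z' f g h) then show ?case
      using M.associator_natural[of "bim X" "bim X'" "bim Y" "bim Y'" "bim Z" "bim Z'" f g h] conn_homD(1)
      by simp
  next
    case (10 X X' f) then show ?case using M.lunitor_natural[of "bim X" "bim X'" f] conn_homD(1) by simp
  next
    case (11 X X' f) then show ?case using M.runitor_natural[of "bim X" "bim X'" f] conn_homD(1) by simp
  next
    case (12 W X Y Z) then show ?case using M.pentagon[of "bim W" "bim X" "bim Y" "bim Z"] by simp
  next
    case (13 X Y) then show ?case using M.triangle[of "bim X" "bim Y"] by simp
  qed
  show ?thesis
  proof (intro bar_category.intro bar_category_axioms.intro mon, goal_cases)
    case 1 then show ?case by simp
  next
    case 2 then show ?case using bar_conn_hom by simp
  next
    case 3 then show ?case by simp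
  next
    case 4 then show ?case by simp
  next
    case 5 then show ?case
      by (intro conn_is_isoI) (simp_all add: bimod_Upsilon_conn_hom bimod_Upsilon_iso)
  next
    case (6 X X' Y Y' f g) then show ?case
      using M.Upsilon_natural[of "bim X" "bim X'" "bim Y" "bim Y'" f g] conn_homD(1) by simp
  next
    case 7 then show ?case by (intro conn_is_isoI) (simp_all add: bb_conn_hom id_map_bb_iso)
  next
    case (8 X Y f) then show ?case using M.bb_natural[of "bim X" "bim Y" f] conn_homD(1) by simp
  next
    case 9 show ?case by (intro conn_is_isoI) (simp_all add: unit_star_conn_hom restrict_star_iso)
  next
    case (10 X Y Z) then show ?case using M.Upsilon_associator[of "bim X" "bim Y" "bim Z"] by simp
  next
    case (11 X) then show ?case
      using M.Upsilon_runitor[of "bim X"] by (simp add: conn_inverse_unit_star inverse_restrict_star)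
  next
    case (12 X) then show ?case
      using M.Upsilon_lunitor[of "bim X"] by (simp add: conn_inverse_unit_star inverse_restrict_star)
  next
    case 13 show ?case using M.bar_unit_star by simp
  next
    case 14 then show ?case by simp
  qed
qed

end

theorem theorem2p4p2:
  fixes A :: "'u::infinite star_alg" and \<Omega> :: "'u bimod" and d st :: "'u \<Rightarrow> 'u"
  assumes "star_algebra A"
    and "differential_structure A \<Omega> d"
    and "star_object (bimod_category A) \<Omega> st"
    and "\<forall>a\<in>carrier A. st (d a) = d (star A a)"
  shows "bar_category (conn_category A \<Omega> d st)"
proof -
  interpret star_calculus A \<Omega> d st
    using assms by (intro star_calculus.intro infinite_star_algebra.intro star_calculus_axioms.intro)
  show ?thesis
    by (rule conn_bar_category)
qed

end
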